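(* For any $\varepsilon>0$, the estimate $m_k(K)=O\left(k^{1-1/\rho(K)-\varepsilon}\right)$ fails whenever $K$ is a GB-set with $\rho(K)>\frac23$. GB-sets $K$ with $\rho(K)>\frac23$ do exist. Therefore, any GB-set $K$ with $\rho(K)>\frac23$ provides a counterexample to the Gao–Vitale conjecture.
   Context: Intrinsic volumes: for a nonempty compact convex $K\subset\mathbb{R}^d$, the numbers $V_0(K)=1,V_1(K),\dots,V_d(K)$ are defined by $\mathrm{Vol}_d(K+\lambda B^d)=\sum_{k=0}^d \kappa_{d-k}V_k(K)\lambda^{d-k}$ for all $\lambda\ge 0$, where $B^d$ is the Euclidean unit ball and $\kappa_j=\mathrm{Vol}_j(B^j)=\pi^{j/2}/\Gamma(j/2+1)$; set $V_k(K)=0$ for $k>\dim K$. They do not depend on the ambient dimension, so they are defined for every finite-dimensional nonempty compact convex set in a Hilbert space. For a nonempty compact convex $K$ in a separable real Hilbert space $H$, $V_k(K):=\sup V_k(K')\in[0,\infty]$, the supremum being over all finite-dimensional compact convex $K'\subset K$. A GB-set (Gaussian bounded set) is a nonempty compact convex set $K\subset H$ with $V_1(K)<\infty$; it is known that then $V_k(K)\le V_1(K)^k/k!<\infty$ for all $k\ge0$. The Steiner entire function of a GB-set $K$ is $f_K(z)=\sum_{k=0}^\infty V_k(K)z^k$, $z\in\mathbb{C}$; it is entire. Its order, denoted $\rho(K)$, is the infimum of all real $\mu$ such that $f_K(z)=O(e^{|z|^\mu})$ as $|z|\to\infty$. For $k\ge0$, $m_k(K):=\dfrac{(k+1)V_{k+1}(K)}{V_k(K)}$,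 with the convention $0/0:=0$. It is known that the sequence $(m_k(K))_{k\ge0}$ is non-increasing, so it has a limit in $[0,\infty)$. The Gao–Vitale conjecture (2001) states: for every convex GB-compact set $K$ in a separable Hilbert space, either $\lim_{k\to\infty}m_k(K)>0$, or $m_k(K)=O(k^{-1/2})$ as $k\to\infty$; in other words, the sequence $m_k(K)$ cannot decay to zero at a rate slower than $k^{-1/2}$.
   Formalization: For GB-sets with ρ(K)>2/3, violation of the full conjecture is claimed only if m_k(K)→0 or ρ(K)<1, since sets with lim m_k(K)>0 (then ρ(K)=1) satisfy its first alternative; failure of O(k^{-1/2}) is proved for all, and existence of a genuine counterexample is added. *)

theory Defs
  imports "HOL-Analysis.Analysis" "HOL-Library.Landau_Symbols"
begin

section \<open>Intrinsic volumes of finite-dimensional convex sets\<close>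

definition orthonormal_set :: "'a::real_inner set \<Rightarrow> bool" where
  "orthonormal_set B \<longleftrightarrow> finite B \<and> pairwise orthogonal B \<and> (\<forall>b\<in>B. norm b = 1)"

text \<open>For a finite orthonormal set \<open>B\<close>, the span of \<open>B\<close> is a copy of Euclidean space of dimension
  \<open>card B\<close>; its Lebesgue measure is the product measure on coordinate vectors indexed by \<open>B\<close>
  (compare \<open>lborel_eq\<close>, which is the case \<open>B = Basis\<close>).\<close>

definition span_volume :: "'a::real_inner set \<Rightarrow> 'a set \<Rightarrow> real" where
  "span_volume B A = measure (\<Pi>\<^sub>M b\<in>B. (lborel :: real measure))
     {x \<in> space (\<Pi>\<^sub>M b\<in>B. (lborel :: real measure)). (\<Sum>b\<in>B. x b *\<^sub>R b) \<in> A}"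

lemma span_volume_Basis:
  fixes A :: "'a::euclidean_space set"
  assumes "A \<in> sets borel"
  shows "span_volume Basis A = measure lborel A"
proof -
  have m: "(\<lambda>f. \<Sum>b\<in>Basis. f b *\<^sub>R b) \<in> measurable (\<Pi>\<^sub>M b\<in>(Basis::'a set). (lborel :: real measure)) (borel :: 'a measure)"
    by measurable
  show ?thesis
    unfolding span_volume_def
    by (subst lborel_eq, subst measure_distr[OF m assms], rule arg_cong[where f = "measure _"]) auto
qed

text \<open>The parallel body at distance \<open>r\<close> of \<open>K\<close> inside the span of \<open>B\<close>.\<close>

definition parallel_body :: "'a::real_inner set \<Rightarrow> 'a set \<Rightarrow> real \<Rightarrow> 'a set" where
  "parallel_body B K r = {x + r *\<^sub>R u |x u. x \<in> K \<and> u \<in> span B \<and> norm u \<le> 1}"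

text \<open>The Steiner formula with ambient space the span of \<open>B\<close>; note that \<open>unit_ball_vol j\<close> is the
  constant usually written \<open>\<kappa>\<^sub>j\<close>.\<close>

definition steiner_formula :: "'a::real_inner set \<Rightarrow> 'a set \<Rightarrow> (nat \<Rightarrow> real) \<Rightarrow> bool" where
  "steiner_formula B K V \<longleftrightarrow>
     (\<forall>r\<ge>0. span_volume B (parallel_body B K r) =
        (\<Sum>k\<le>card B. unit_ball_vol (real (card B - k)) * V k * r ^ (card B - k))) \<and>
     (\<forall>k>card B. V k = 0)"

definition finite_dimensional :: "'a::real_inner set \<Rightarrow> bool" where
  "finite_dimensional K \<longleftrightarrow> (\<exists>B. finite B \<and> K \<subseteq> span B)"

text \<open>The intrinsic volumes do not depend on the ambient space, so they are the unique sequence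
  satisfying the Steiner formula in every Euclidean ambient space. The clause for indices above
  \<open>card B\<close>, applied to the smallest such space, makes them vanish above the dimension of \<open>K\<close>.\<close>

definition fin_intrinsic_volume :: "nat \<Rightarrow> 'a::real_inner set \<Rightarrow> real" where
  "fin_intrinsic_volume k K =
     (THE V. \<forall>B. orthonormal_set B \<and> K \<subseteq> span B \<longrightarrow> steiner_formula B K V) k"


section \<open>Intrinsic volumes in Hilbert space, GB-sets\<close>

definition intrinsic_volume :: "nat \<Rightarrow> 'a::real_inner set \<Rightarrow> ennreal" where
  "intrinsic_volume k K =
     (SUP L \<in> {L. L \<noteq> {} \<and> compact L \<and> convex L \<and> finite_dimensional L \<and> L \<subseteq> K}.
        ennreal (fin_intrinsic_volume k L))"

definition GB_set :: "'a::real_inner set \<Rightarrow> bool" where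
  "GB_set K \<longleftrightarrow> K \<noteq> {} \<and> compact K \<and> convex K \<and> intrinsic_volume 1 K < \<infinity>"

text \<open>From here on \<open>enn2real\<close> is harmless, since all intrinsic volumes of a GB-set are finite.\<close>

definition steiner_function :: "'a::real_inner set \<Rightarrow> complex \<Rightarrow> complex" where
  "steiner_function K z = (\<Sum>k. complex_of_real (enn2real (intrinsic_volume k K)) * z ^ k)"

text \<open>The order is taken in the extended reals because the set of exponents is all of \<open>\<real>\<close>
  (with infimum \<open>-\<infinity>\<close>) when the function is constant, i.e. for a one-point set.\<close>

definition entire_order :: "(complex \<Rightarrow> complex) \<Rightarrow> ereal" where
  "entire_order f =
     (INF \<mu> \<in> {\<mu>::real. f \<in> O[at_infinity](\<lambda>z. complex_of_real (exp (norm z powr \<mu>)))}. ereal \<mu>)"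

definition GB_order :: "'a::real_inner set \<Rightarrow> ereal" where
  "GB_order K = entire_order (steiner_function K)"

text \<open>Division by zero in HOL gives the convention \<open>0/0 = 0\<close>.\<close>

definition GB_ratio :: "'a::real_inner set \<Rightarrow> nat \<Rightarrow> real" where
  "GB_ratio K k =
     real (k + 1) * enn2real (intrinsic_volume (k + 1) K) / enn2real (intrinsic_volume k K)"

text \<open>The Gao--Vitale conjecture asserts this for every GB-set in a separable Hilbert space.\<close>

definition gao_vitale_alternative :: "'a::real_inner set \<Rightarrow> bool" where
  "gao_vitale_alternative K \<longleftrightarrow>
     (\<exists>L>0. GB_ratio K \<longlonglongrightarrow> L) \<or> GB_ratio K \<in> O(\<lambda>k. real k powr (- 1 / 2))"


section \<open>The Hilbert space of square-summable sequences\<close>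

text \<open>A concrete infinite-dimensional separable Hilbert space, needed to state existence.\<close>

typedef ell2 = "{x :: nat \<Rightarrow> real. summable (\<lambda>n. (x n)\<^sup>2)}"
  morphisms ell2_nth Abs_ell2
  by (rule exI[of _ "\<lambda>_. 0"]) simp

setup_lifting type_definition_ell2

lemma summable_ell2: "summable (\<lambda>n. (ell2_nth x n)\<^sup>2)"
  using ell2_nth[of x] by simp

lemma summable_mult_l2:
  fixes x y :: "nat \<Rightarrow> real"
  assumes "summable (\<lambda>n. (x n)\<^sup>2)" "summable (\<lambda>n. (y n)\<^sup>2)"
  shows "summable (\<lambda>n. x n * y n)"
proof (rule summable_comparison_test'[where N = 0])
  show "summable (\<lambda>n. (x n)\<^sup>2 + (y n)\<^sup>2)"
    using assms by (rule summable_add)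
  fix n :: nat
  have "2 * (\<bar>x n\<bar> * \<bar>y n\<bar>) \<le> (x n)\<^sup>2 + (y n)\<^sup>2"
    using sum_squares_bound[of "\<bar>x n\<bar>" "\<bar>y n\<bar>"] by simp
  moreover have "0 \<le> \<bar>x n\<bar> * \<bar>y n\<bar>" by simp
  ultimately show "norm (x n * y n) \<le> (x n)\<^sup>2 + (y n)\<^sup>2"
    unfolding real_norm_def abs_mult by linarith
qed

lemma summable_add_l2:
  fixes x y :: "nat \<Rightarrow> real"
  assumes "summable (\<lambda>n. (x n)\<^sup>2)" "summable (\<lambda>n. (y n)\<^sup>2)"
  shows "summable (\<lambda>n. (x n + y n)\<^sup>2)"
proof -
  have "summable (\<lambda>n. (x n)\<^sup>2 + (y n)\<^sup>2 + 2 * (x n * y n))"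
    by (intro summable_add summable_mult summable_mult_l2 assms)
  then show ?thesis by (simp add: power2_sum mult.assoc)
qed

lemma summable_scale_l2:
  fixes x :: "nat \<Rightarrow> real"
  assumes "summable (\<lambda>n. (x n)\<^sup>2)"
  shows "summable (\<lambda>n. (c * x n)\<^sup>2)"
  using summable_mult[OF assms, of "c\<^sup>2"] by (simp add: power_mult_distrib)

instantiation ell2 :: real_vector
begin

lift_definition zero_ell2 :: ell2 is "\<lambda>_. 0" by simp
lift_definition plus_ell2 :: "ell2 \<Rightarrow> ell2 \<Rightarrow> ell2" is "\<lambda>x y n. x n + y n"
  by (rule summable_add_l2)
lift_definition scaleR_ell2 :: "real \<Rightarrow> ell2 \<Rightarrow> ell2" is "\<lambda>c x n. c * x n"
  by (rule summable_scale_l2)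
lift_definition uminus_ell2 :: "ell2 \<Rightarrow> ell2" is "\<lambda>x n. - x n" by simp
lift_definition minus_ell2 :: "ell2 \<Rightarrow> ell2 \<Rightarrow> ell2" is "\<lambda>x y n. x n - y n"
  subgoal for x y using summable_add_l2[of x "\<lambda>n. - y n"] by simp
  done
instance
proof
  fix x y z :: ell2 and a b :: real
  show "x + y + z = x + (y + z)" by transfer (simp add: add.assoc)
  show "x + y = y + x" by transfer (simp add: add.commute)
  show "0 + x = x" by transfer simp
  show "- x + x = 0" by transfer simp
  show "x - y = x + - y" by transfer simp
  show "a *\<^sub>R (x + y) = a *\<^sub>R x + a *\<^sub>R y" by transfer (simp add: algebra_simps)
  show "(a + b) *\<^sub>R x = a *\<^sub>R x + b *\<^sub>R x" by transfer (simp add: algebra_simps)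
  show "a *\<^sub>R b *\<^sub>R x = (a * b) *\<^sub>R x" by transfer (simp add: algebra_simps)
  show "1 *\<^sub>R x = x" by transfer simp
qed

end

instantiation ell2 :: real_inner
begin

lift_definition inner_ell2 :: "ell2 \<Rightarrow> ell2 \<Rightarrow> real" is "\<lambda>x y. \<Sum>n. x n * y n" .

definition norm_ell2 :: "ell2 \<Rightarrow> real" where "norm_ell2 x = sqrt (inner x x)"
definition sgn_ell2 :: "ell2 \<Rightarrow> ell2" where "sgn_ell2 x = x /\<^sub>R norm x"
definition dist_ell2 :: "ell2 \<Rightarrow> ell2 \<Rightarrow> real" where "dist_ell2 x y = norm (x - y)"
definition uniformity_ell2 :: "(ell2 \<times> ell2) filter" where
  "uniformity_ell2 = (INF e\<in>{0 <..}. principal {(x, y). dist x y < e})"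
definition open_ell2 :: "ell2 set \<Rightarrow> bool" where
  "open_ell2 U \<longleftrightarrow> (\<forall>x\<in>U. eventually (\<lambda>(x', y). x' = x \<longrightarrow> y \<in> U) uniformity)"

instance
proof
  fix x y z :: ell2 and r :: real
  show "dist x y = norm (x - y)" by (rule dist_ell2_def)
  show "sgn x = x /\<^sub>R norm x" by (rule sgn_ell2_def)
  show "uniformity = (INF e\<in>{0 <..}. principal {(x, y :: ell2). dist x y < e})"
    by (rule uniformity_ell2_def)
  show "open U \<longleftrightarrow> (\<forall>x\<in>U. eventually (\<lambda>(x', y). x' = x \<longrightarrow> y \<in> U) uniformity)"
    for U :: "ell2 set"
    by (rule open_ell2_def)
  show "inner x y = inner y x" by transfer (simp add: mult.commute)
  show "inner (x + y) z = inner x z + inner y z"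
    by transfer (simp add: distrib_right suminf_add summable_mult_l2)
  show "inner (r *\<^sub>R x) y = r * inner x y"
    by transfer (simp add: mult.assoc suminf_mult summable_mult_l2)
  show "0 \<le> inner x x"
    by transfer (auto intro!: suminf_nonneg simp: power2_eq_square)
  show "inner x x = 0 \<longleftrightarrow> x = 0"
  proof transfer
    fix x :: "nat \<Rightarrow> real"
    assume "summable (\<lambda>n. (x n)\<^sup>2)"
    then have "(\<Sum>n. x n * x n) = 0 \<longleftrightarrow> (\<forall>n. x n * x n = 0)"
      by (intro suminf_eq_zero_iff) (auto simp: power2_eq_square)
    then show "(\<Sum>n. x n * x n) = 0 \<longleftrightarrow> x = (\<lambda>_. 0)" by auto
  qed
  show "norm x = sqrt (inner x x)" by (rule norm_ell2_def)
qed

end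

lemma norm_ell2_squared: "(norm x)\<^sup>2 = (\<Sum>n. (ell2_nth x n)\<^sup>2)" for x :: ell2
  unfolding power2_norm_eq_inner by transfer (simp add: power2_eq_square)

lemma ell2_nth_diff: "ell2_nth (x - y) n = ell2_nth x n - ell2_nth y n"
  by transfer simp

lemma sum_le_norm_ell2: "(\<Sum>n<N. (ell2_nth x n)\<^sup>2) \<le> (norm x)\<^sup>2"
  unfolding norm_ell2_squared by (rule sum_le_suminf) (auto simp: summable_ell2)

lemma abs_ell2_nth_le_norm: "\<bar>ell2_nth x n\<bar> \<le> norm x"
proof (rule abs_le_square_iff[THEN iffD2, of _ "norm x", simplified])
  have "(ell2_nth x n)\<^sup>2 \<le> (\<Sum>k<Suc n. (ell2_nth x k)\<^sup>2)"
    by (simp add: sum_nonneg)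
  then show "(ell2_nth x n)\<^sup>2 \<le> (norm x)\<^sup>2"
    using sum_le_norm_ell2[of x "Suc n"] by linarith
qed

instance ell2 :: complete_space
proof
  fix X :: "nat \<Rightarrow> ell2"
  assume X: "Cauchy X"
  have "Cauchy (\<lambda>i. ell2_nth (X i) n)" for n
  proof (rule metric_CauchyI)
    fix e :: real assume "0 < e"
    then obtain M where M: "\<And>i j. i \<ge> M \<Longrightarrow> j \<ge> M \<Longrightarrow> dist (X i) (X j) < e"
      using X metric_CauchyD by blast
    have "dist (ell2_nth (X i) n) (ell2_nth (X j) n) < e" if "i \<ge> M" "j \<ge> M" for i j
      using abs_ell2_nth_le_norm[of "X i - X j" n] M[OF that]
      by (simp add: dist_norm ell2_nth_diff)
    then show "\<exists>M. \<forall>i\<ge>M. \<forall>j\<ge>M. dist (ell2_nth (X i) n) (ell2_nth (X j) n) < e" by blast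
  qed
  then have "\<forall>n. \<exists>l. (\<lambda>i. ell2_nth (X i) n) \<longlonglongrightarrow> l"
    by (simp add: Cauchy_convergent_iff convergent_def)
  then obtain x where x: "\<And>n. (\<lambda>i. ell2_nth (X i) n) \<longlonglongrightarrow> x n" by metis
  have bound: "\<exists>M. \<forall>i\<ge>M. \<forall>N. (\<Sum>n<N. (x n - ell2_nth (X i) n)\<^sup>2) \<le> e\<^sup>2" if "0 < e" for e :: real
  proof -
    obtain M where M: "\<And>i j. i \<ge> M \<Longrightarrow> j \<ge> M \<Longrightarrow> dist (X i) (X j) < e"
      using X \<open>0 < e\<close> metric_CauchyD by blast
    have "(\<Sum>n<N. (x n - ell2_nth (X i) n)\<^sup>2) \<le> e\<^sup>2" if "i \<ge> M" for i N
    proof (rule tendsto_upperbound)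
      show "(\<lambda>j. \<Sum>n<N. (ell2_nth (X j) n - ell2_nth (X i) n)\<^sup>2)
              \<longlonglongrightarrow> (\<Sum>n<N. (x n - ell2_nth (X i) n)\<^sup>2)"
        by (intro tendsto_intros x)
      show "\<forall>\<^sub>F j in sequentially. (\<Sum>n<N. (ell2_nth (X j) n - ell2_nth (X i) n)\<^sup>2) \<le> e\<^sup>2"
        using eventually_ge_at_top[of M]
      proof eventually_elim
        case (elim j)
        have "norm (X j - X i) \<le> e" using M[OF elim that] by (simp add: dist_norm)
        then have "(norm (X j - X i))\<^sup>2 \<le> e\<^sup>2" by (intro power_mono) auto
        then show ?case using sum_le_norm_ell2[of "X j - X i" N] by (simp add: ell2_nth_diff)
      qed
    qed simp
    then show ?thesis by blast
  qed
  have summ: "summable (\<lambda>n. (x n - ell2_nth (X i) n)\<^sup>2)"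
    if "\<And>N. (\<Sum>n<N. (x n - ell2_nth (X i) n)\<^sup>2) \<le> c" for i c
    by (rule summableI_nonneg_bounded[where x = c]) (use that in auto)
  obtain i0 where i0: "\<And>N. (\<Sum>n<N. (x n - ell2_nth (X i0) n)\<^sup>2) \<le> 1\<^sup>2"
    using bound[of 1] by auto
  have "summable (\<lambda>n. ((x n - ell2_nth (X i0) n) + ell2_nth (X i0) n)\<^sup>2)"
    by (rule summable_add_l2[OF summ[OF i0] summable_ell2])
  then have sx: "summable (\<lambda>n. (x n)\<^sup>2)" by simp
  define y where "y = Abs_ell2 x"
  have y: "ell2_nth y = x" unfolding y_def by (rule Abs_ell2_inverse) (simp add: sx)
  have "X \<longlonglongrightarrow> y"
  proof (rule metric_LIMSEQ_I)
    fix e :: real assume "0 < e"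
    then obtain M where M: "\<And>i N. i \<ge> M \<Longrightarrow> (\<Sum>n<N. (x n - ell2_nth (X i) n)\<^sup>2) \<le> (e / 2)\<^sup>2"
      using bound[of "e / 2"] by auto
    have "dist (X i) y < e" if "i \<ge> M" for i
    proof -
      have "(norm (y - X i))\<^sup>2 \<le> (e / 2)\<^sup>2"
        unfolding norm_ell2_squared ell2_nth_diff y
        by (rule suminf_le_const[OF summ[OF M[OF that]] M[OF that]])
      then have "norm (y - X i) \<le> e / 2"
        by (rule power2_le_imp_le) (use \<open>0 < e\<close> in auto)
      then show ?thesis using \<open>0 < e\<close> by (simp add: dist_norm norm_minus_commute)
    qed
    then show "\<exists>M. \<forall>i\<ge>M. dist (X i) y < e" by blast
  qed
  then show "convergent X" by (auto simp: convergent_def)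
qed

lift_definition ell2_of_list :: "rat list \<Rightarrow> ell2" is
  "\<lambda>q n. if n < length q then real_of_rat (q ! n) else 0"
  by (rule summable_finite[of "{..<length _}"]) auto

lemma ell2_of_list_dense:
  assumes "0 < e"
  shows "\<exists>q. dist (ell2_of_list q) x < e"
proof -
  have e2: "0 < e\<^sup>2 / 2" using assms by simp
  obtain N where N: "norm (\<Sum>n. (ell2_nth x (n + N))\<^sup>2) < e\<^sup>2 / 2"
    using suminf_exist_split[OF e2 summable_ell2[of x]] by blast
  define d where "d = e / sqrt (2 * (real N + 1))"
  have d: "0 < d" using assms by (simp add: d_def)
  have "\<exists>r. \<bar>real_of_rat r - ell2_nth x n\<bar> < d" for n
    using of_rat_dense[of "ell2_nth x n" "ell2_nth x n + d"] d
    by (smt (verit))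
  then obtain r where r: "\<And>n. \<bar>real_of_rat (r n) - ell2_nth x n\<bar> < d" by metis
  define q where "q = map r [0..<N]"
  define w where "w = ell2_of_list q - x"
  have w: "ell2_nth w n = (if n < N then real_of_rat (r n) else 0) - ell2_nth x n" for n
    unfolding w_def ell2_nth_diff by (simp add: ell2_of_list.rep_eq q_def)
  have "(norm w)\<^sup>2 = (\<Sum>n. (ell2_nth w (n + N))\<^sup>2) + (\<Sum>n<N. (ell2_nth w n)\<^sup>2)"
    unfolding norm_ell2_squared by (rule suminf_split_initial_segment[OF summable_ell2])
  also have "(\<Sum>n. (ell2_nth w (n + N))\<^sup>2) = (\<Sum>n. (ell2_nth x (n + N))\<^sup>2)"
    by (simp add: w)
  also have "\<dots> < e\<^sup>2 / 2" using N by simp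
  also have "(\<Sum>n<N. (ell2_nth w n)\<^sup>2) \<le> (\<Sum>n<N. d\<^sup>2)"
  proof (rule sum_mono)
    fix n assume "n \<in> {..<N}"
    then have "\<bar>ell2_nth w n\<bar> \<le> d" using r[of n] by (simp add: w)
    then show "(ell2_nth w n)\<^sup>2 \<le> d\<^sup>2" using power_mono[of "\<bar>ell2_nth w n\<bar>" d 2] by simp
  qed
  also have "(\<Sum>n<N. d\<^sup>2) \<le> e\<^sup>2 / 2"
  proof -
    have "(\<Sum>n<N. d\<^sup>2) = (e\<^sup>2 / 2) * (real N / (real N + 1))"
      by (simp add: d_def power_divide)
    also have "\<dots> \<le> (e\<^sup>2 / 2) * 1" by (intro mult_left_mono) auto
    finally show ?thesis by simp
  qed
  finally have "(norm w)\<^sup>2 < e\<^sup>2" by simp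
  then have "norm w < e" by (rule power2_less_imp_less) (use assms in auto)
  then show ?thesis by (auto simp: dist_norm w_def)
qed

instance ell2 :: polish_space
proof
  define B where "B = (\<lambda>(q, r). ball (ell2_of_list q) (real_of_rat r)) ` (UNIV :: (rat list \<times> rat) set)"
  have "topological_basis B"
  proof (rule topological_basisI)
    fix U :: "ell2 set" and x assume "open U" "x \<in> U"
    then obtain e where e: "0 < e" "ball x e \<subseteq> U" using open_contains_ball by blast
    obtain q where q: "dist (ell2_of_list q) x < e / 2"
      using ell2_of_list_dense[of "e / 2" x] e by auto
    obtain r where r: "dist (ell2_of_list q) x < real_of_rat r" "real_of_rat r < e / 2"
      using of_rat_dense[OF q] by blast
    have "ball (ell2_of_list q) (real_of_rat r) \<subseteq> ball x e"
    proof
      fix y assume "y \<in> ball (ell2_of_list q) (real_of_rat r)"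
      then show "y \<in> ball x e"
        using dist_triangle[of x y "ell2_of_list q"] q r by (simp add: dist_commute)
    qed
    then show "\<exists>V\<in>B. x \<in> V \<and> V \<subseteq> U" using e r by (force simp: B_def)
  qed (auto simp: B_def)
  moreover have "countable B" unfolding B_def by (intro countable_image countableI_type)
  ultimately show "\<exists>B :: ell2 set set. countable B \<and> open = generate_topology B"
    using topological_basis_imp_subbasis by blast
qed

end

theory Submission
  imports Defs "HOL-Probability.Probability"
begin

text \<open>
  For a convex body \<open>A\<close> and a vector \<open>u\<close>, the volume of \<open>A + t [0, u]\<close> is affine in \<open>t\<close>, with slope the
  volume of a projection of \<open>A\<close>. Hence the volume of \<open>A + r Z\<close>, for a zonotope \<open>Z\<close>, is a polynomial in
  \<open>r\<close> whose coefficients are non-negative and monotone in \<open>A\<close>; growth bounds its degree by the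
  dimension, and approximating the ball by zonotopes gives the Steiner formula and the monotonicity
  of intrinsic volumes. Weighting the parallel volumes with a Gaussian gives the Wills functional
  \<open>\<integral> exp (- \<pi> dist(x, \<lambda> L)\<^sup>2) dx = \<Sum> V\<^sub>k(L) \<lambda>\<^sup>k\<close>. The integrand is jointly log-concave in \<open>(x, \<lambda>)\<close>, so by
  Prekopa--Leindler the functional is log-concave in \<open>\<lambda>\<close> and therefore at most \<open>exp (\<lambda> V\<^sub>1(L))\<close>: all
  intrinsic volumes of a GB-set are finite. The recursion \<open>(k + 1) V\<^sub>k\<^sub>+\<^sub>1 = m\<^sub>k V\<^sub>k\<close> turns
  \<open>m\<^sub>k = O(k\<^sup>1\<^sup>-\<^sup>s)\<close> into \<open>V\<^sub>k = O(C\<^sup>k / k!\<^sup>s)\<close>, that is, into order at most \<open>1/s\<close>.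

  The example is the box with sides \<open>a\<^sub>n = n\<^sup>-\<^sup>5\<^sup>/\<^sup>4\<close>. The Wills functional is multiplicative over
  orthogonal sums, so the Steiner function of the box dominates \<open>\<Prod>\<^bsub>n<N\<^esub> (1 + \<lambda> a\<^sub>n)\<close>. A finite-dimensional
  subset of the box is almost isometric to its truncation to the first \<open>N\<close> coordinates, which
  bounds its intrinsic volumes from above by the same products; thus the order lies in \<open>[4/5, 9/10]\<close>.
\<close>

section \<open>Lebesgue measure on a span\<close>

text \<open>The intrinsic volumes are given by a definite description over all ambient spans, so
  nothing can be said about them before the Steiner formula is known to exist, to be unique and to
  survive a change of the ambient space. After that the estimates go through the Wills functional:
  being an integral, it is open to Fubini, change of variables and Prekopa-Leindler, and a single
  V_k is recovered from its values on dilates.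

  The threshold 2/3 is 1/s for the exponent 1 - s = -1/2. Sides n^(-p) have convergence exponent
  1/p, so p is sought between 1 and 3/2: p < 3/2 lifts the order above 2/3, while p > 1 makes the
  box a GB-set and keeps the order below 1. The latter disposes of the other half of the
  alternative, because a positive limit of m_k forces order at least 1.\<close>

definition span_lborel :: "'a::{real_inner,polish_space} set \<Rightarrow> 'a measure" where
  "span_lborel B = distr (\<Pi>\<^sub>M b\<in>B. (lborel :: real measure)) borel (\<lambda>x. \<Sum>b\<in>B. x b *\<^sub>R b)"

lemma sets_span_lborel [simp, measurable_cong]: "sets (span_lborel B) = sets borel"
  by (simp add: span_lborel_def)

lemma space_span_lborel [simp]: "space (span_lborel B) = UNIV"
  by (simp add: span_lborel_def)

lemma borel_measurable_span_lborel [simp]: "borel_measurable (span_lborel B) = borel_measurable borel"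
  by (rule measurable_cong_sets) simp_all

lemma measurable_lincomb [measurable]:
  fixes B :: "'a::{real_inner,polish_space} set"
  shows "(\<lambda>x. \<Sum>b\<in>B. x b *\<^sub>R b) \<in> measurable (\<Pi>\<^sub>M b\<in>B. (lborel :: real measure)) borel"
  by measurable

lemma span_volume_eq:
  assumes "A \<in> sets borel"
  shows "span_volume B A = measure (span_lborel B) A"
  unfolding span_volume_def span_lborel_def measure_distr[OF measurable_lincomb assms]
  by (rule arg_cong[where f = "measure _"]) auto

lemma nn_integral_span_lborel:
  assumes [measurable]: "f \<in> borel_measurable borel"
  shows "(\<integral>\<^sup>+x. f x \<partial>span_lborel B) = (\<integral>\<^sup>+x. f (\<Sum>b\<in>B. x b *\<^sub>R b) \<partial>(\<Pi>\<^sub>M b\<in>B. (lborel :: real measure)))"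
  unfolding span_lborel_def by (subst nn_integral_distr) auto

lemma nn_integral_span_lborel_empty:
  fixes f :: "'a::{real_inner,polish_space} \<Rightarrow> ennreal"
  assumes "f \<in> borel_measurable borel"
  shows "(\<integral>\<^sup>+x. f x \<partial>span_lborel {}) = f 0"
proof -
  interpret product_sigma_finite "\<lambda>_::'a. lborel :: real measure" by standard
  show ?thesis unfolding nn_integral_span_lborel[OF assms] by (simp add: PiM_empty nn_integral_count_space_finite)
qed

lemma
  fixes f :: "'a::{real_inner,polish_space} \<Rightarrow> ennreal"
  assumes fin: "finite C" and b: "b \<notin> C" and f [measurable]: "f \<in> borel_measurable borel"
  shows nn_integral_span_lborel_insert:
      "(\<integral>\<^sup>+x. f x \<partial>span_lborel (insert b C)) = (\<integral>\<^sup>+y. (\<integral>\<^sup>+s. f (s *\<^sub>R b + y) \<partial>lborel) \<partial>span_lborel C)"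
    and nn_integral_span_lborel_insert':
      "(\<integral>\<^sup>+x. f x \<partial>span_lborel (insert b C)) = (\<integral>\<^sup>+s. (\<integral>\<^sup>+y. f (s *\<^sub>R b + y) \<partial>span_lborel C) \<partial>lborel)"
proof -
  interpret product_sigma_finite "\<lambda>_::'a. lborel :: real measure" by standard
  have *: "(\<Sum>c\<in>insert b C. (x(b := s)) c *\<^sub>R c) = s *\<^sub>R b + (\<Sum>c\<in>C. x c *\<^sub>R c)" for x s
    using fin b by (simp add: sum.insert) (auto intro!: sum.cong)
  have m: "(\<lambda>x. f (\<Sum>b\<in>insert b C. x b *\<^sub>R b)) \<in> borel_measurable (\<Pi>\<^sub>M c\<in>insert b C. (lborel :: real measure))"
    by measurable
  show "(\<integral>\<^sup>+x. f x \<partial>span_lborel (insert b C)) = (\<integral>\<^sup>+y. (\<integral>\<^sup>+s. f (s *\<^sub>R b + y) \<partial>lborel) \<partial>span_lborel C)"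
    unfolding nn_integral_span_lborel[OF f] product_nn_integral_insert[OF fin b m] *
    by (subst nn_integral_span_lborel) simp_all
  show "(\<integral>\<^sup>+x. f x \<partial>span_lborel (insert b C)) = (\<integral>\<^sup>+s. (\<integral>\<^sup>+y. f (s *\<^sub>R b + y) \<partial>span_lborel C) \<partial>lborel)"
    unfolding nn_integral_span_lborel[OF f] product_nn_integral_insert_rev[OF fin b m] *
    by (subst nn_integral_span_lborel) simp_all
qed

lemma nn_integral_span_lborel_translate:
  fixes f :: "'a::{real_inner,polish_space} \<Rightarrow> ennreal"
  assumes "finite C" "f \<in> borel_measurable borel" "a \<in> span C"
  shows "(\<integral>\<^sup>+x. f (a + x) \<partial>span_lborel C) = (\<integral>\<^sup>+x. f x \<partial>span_lborel C)"
  using assms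
proof (induction C arbitrary: f a rule: finite_induct)
  case empty
  then show ?case by (simp add: nn_integral_span_lborel_empty)
next
  case (insert b C)
  note [measurable] = insert.prems(1)
  obtain k where k: "a - k *\<^sub>R b \<in> span C"
    using insert.prems(2) span_insert by blast
  define a' where "a' = a - k *\<^sub>R b"
  have a: "a = k *\<^sub>R b + a'" by (simp add: a'_def)
  have "(\<integral>\<^sup>+x. f (a + x) \<partial>span_lborel (insert b C))
      = (\<integral>\<^sup>+y. (\<integral>\<^sup>+s. f (a + (s *\<^sub>R b + y)) \<partial>lborel) \<partial>span_lborel C)"
    by (subst nn_integral_span_lborel_insert) (use insert in auto)
  also have "\<dots> = (\<integral>\<^sup>+y. (\<integral>\<^sup>+s. f (s *\<^sub>R b + (a' + y)) \<partial>lborel) \<partial>span_lborel C)"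
  proof (rule nn_integral_cong)
    fix y
    have "(\<integral>\<^sup>+s. f (s *\<^sub>R b + (a' + y)) \<partial>lborel) = (\<integral>\<^sup>+s. f ((k + 1 * s) *\<^sub>R b + (a' + y)) \<partial>lborel)"
      by (subst nn_integral_real_affine[where c = 1 and t = k]) auto
    then show "(\<integral>\<^sup>+s. f (a + (s *\<^sub>R b + y)) \<partial>lborel) = (\<integral>\<^sup>+s. f (s *\<^sub>R b + (a' + y)) \<partial>lborel)"
      by (simp add: a algebra_simps)
  qed
  also have "\<dots> = (\<integral>\<^sup>+y. (\<integral>\<^sup>+s. f (s *\<^sub>R b + y) \<partial>lborel) \<partial>span_lborel C)"
    by (rule insert.IH) (use k in \<open>auto simp: a'_def\<close>)
  also have "\<dots> = (\<integral>\<^sup>+x. f x \<partial>span_lborel (insert b C))"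
    by (subst nn_integral_span_lborel_insert) (use insert in auto)
  finally show ?case .
qed

text \<open>Replacing b by s b + c is a shear followed by a dilation: for fixed t the shift by t c
  disappears by translation invariance of the integral over C, and s enters by a substitution on the
  line. Such an exchange destroys orthonormality, which is why \<open>span_lborel\<close> is studied
  for arbitrary finite sets.\<close>

lemma nn_integral_span_lborel_exchange:
  fixes f :: "'a::{real_inner,polish_space} \<Rightarrow> ennreal"
  assumes "finite C" "f \<in> borel_measurable borel" "c \<in> span C" "s \<noteq> 0" "b \<notin> C" "b' \<notin> C"
    and b': "b' = s *\<^sub>R b + c"
  shows "(\<integral>\<^sup>+x. f x \<partial>span_lborel (insert b C)) = ennreal \<bar>s\<bar> * (\<integral>\<^sup>+x. f x \<partial>span_lborel (insert b' C))"
proof -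
  note [measurable] = assms(2)
  have "(\<integral>\<^sup>+x. f x \<partial>span_lborel (insert b' C)) = (\<integral>\<^sup>+t. (\<integral>\<^sup>+y. f ((t * s) *\<^sub>R b + (t *\<^sub>R c + y)) \<partial>span_lborel C) \<partial>lborel)"
    by (subst nn_integral_span_lborel_insert') (use assms in \<open>auto simp: algebra_simps\<close>)
  also have "\<dots> = (\<integral>\<^sup>+t. (\<integral>\<^sup>+y. f ((t * s) *\<^sub>R b + y) \<partial>span_lborel C) \<partial>lborel)"
    by (intro nn_integral_cong nn_integral_span_lborel_translate) (use assms in \<open>auto intro: span_scale\<close>)
  also have "\<dots> = (\<integral>\<^sup>+y. (\<integral>\<^sup>+t. f ((t * s) *\<^sub>R b + y) \<partial>lborel) \<partial>span_lborel C)"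
  proof -
    interpret product_sigma_finite "\<lambda>_::'a. lborel :: real measure" by standard
    interpret P: sigma_finite_measure "\<Pi>\<^sub>M c\<in>C. (lborel :: real measure)"
      by (rule sigma_finite) fact
    interpret pair_sigma_finite lborel "\<Pi>\<^sub>M c\<in>C. (lborel :: real measure)" by standard
    show ?thesis
      by (subst (1 2) nn_integral_span_lborel; measurable)
         (rule Fubini'[symmetric], measurable)
  qed
  finally have *: "(\<integral>\<^sup>+x. f x \<partial>span_lborel (insert b' C)) = (\<integral>\<^sup>+y. (\<integral>\<^sup>+t. f ((t * s) *\<^sub>R b + y) \<partial>lborel) \<partial>span_lborel C)" .
  have "(\<integral>\<^sup>+x. f x \<partial>span_lborel (insert b C)) = (\<integral>\<^sup>+y. (\<integral>\<^sup>+t. f (t *\<^sub>R b + y) \<partial>lborel) \<partial>span_lborel C)"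
    by (subst nn_integral_span_lborel_insert) (use assms in auto)
  also have "\<dots> = (\<integral>\<^sup>+y. ennreal \<bar>s\<bar> * (\<integral>\<^sup>+t. f ((t * s) *\<^sub>R b + y) \<partial>lborel) \<partial>span_lborel C)"
    by (intro nn_integral_cong, subst nn_integral_real_affine[where c = s and t = 0])
       (use assms in \<open>auto simp: mult.commute\<close>)
  also have "\<dots> = ennreal \<bar>s\<bar> * (\<integral>\<^sup>+y. (\<integral>\<^sup>+t. f ((t * s) *\<^sub>R b + y) \<partial>lborel) \<partial>span_lborel C)"
    by (rule nn_integral_cmult) measurable
  finally show ?thesis unfolding * .
qed

lemma span_insert_superset: "x \<in> span C \<Longrightarrow> x \<in> span (insert b C)"
  using span_mono[OF subset_insertI] by blast

text \<open>Steinitz exchange, one vector of B' at a time. Each exchange contributes a factor, and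
  their product is the absolute determinant of the change of basis. Only its existence is recorded;
  it is later evaluated or estimated by testing on a ball.\<close>

lemma span_lborel_proportional:
  fixes B B' :: "'a::{real_inner,polish_space} set"
  assumes "finite B" "finite B'" "independent B" "independent B'" "span B = span B'"
  shows "\<exists>c>0. \<forall>f. f \<in> borel_measurable borel \<longrightarrow>
           (\<integral>\<^sup>+x. f x \<partial>span_lborel B) = ennreal c * (\<integral>\<^sup>+x. f x \<partial>span_lborel B')"
  using assms
proof (induction "card (B' - B)" arbitrary: B)
  case 0
  then have sub: "B' \<subseteq> B" by simp
  have "B = B'"
  proof (rule ccontr)
    assume "B \<noteq> B'"
    then obtain x where x: "x \<in> B" "x \<notin> B'" using sub by blast
    then have "x \<in> span (B - {x})" using \<open>span B = span B'\<close> sub span_mono[of B' "B - {x}"]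
      by (metis Diff_empty subset_Diff_insert span_base subsetD)
    then show False using x \<open>independent B\<close> dependent_def by blast
  qed
  then show ?case by (intro exI[of _ 1]) auto
next
  case (Suc n)
  then obtain b' where b': "b' \<in> B'" "b' \<notin> B" by (metis Diff_iff card.empty equals0I nat.distinct(1))
  have "b' \<in> span B" using b' Suc.prems span_base by blast
  then obtain x where x: "b' = (\<Sum>b\<in>B. x b *\<^sub>R b)" using span_finite[OF \<open>finite B\<close>] by auto
  \<comment> \<open>The vector to be thrown out must not belong to B', so that card (B' - B) drops.
    If all coefficients outside B' vanished, b' would be a combination of the other vectors of
    B'.\<close>
  have "\<exists>b\<in>B - B'. x b \<noteq> 0"
  proof (rule ccontr)
    assume "\<not> ?thesis"
    then have "b' = (\<Sum>b\<in>B \<inter> B'. x b *\<^sub>R b)"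
      unfolding x by (intro sum.mono_neutral_right) (use Suc.prems in auto)
    also have "\<dots> \<in> span (B' - {b'})"
      by (intro span_sum span_scale span_base) (use b' in auto)
    finally show False using b' \<open>independent B'\<close> dependent_def by blast
  qed
  then obtain b where b: "b \<in> B" "b \<notin> B'" "x b \<noteq> 0" by blast
  define C where "C = B - {b}"
  have C: "finite C" "B = insert b C" "b \<notin> C" "b' \<notin> C" using b b' Suc.prems by (auto simp: C_def)
  define c where "c = (\<Sum>b\<in>C. x b *\<^sub>R b)"
  have c: "c \<in> span C" unfolding c_def by (intro span_sum span_scale span_base)
  have eq: "b' = x b *\<^sub>R b + c" unfolding x C(2) c_def using C by simp
  have spn: "span (insert b' C) = span B"
  proof -
    have "b = (1 / x b) *\<^sub>R b' - (1 / x b) *\<^sub>R c" using b by (simp add: eq algebra_simps)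
    moreover have "(1 / x b) *\<^sub>R b' - (1 / x b) *\<^sub>R c \<in> span (insert b' C)"
      by (rule span_diff[OF span_scale[OF span_base[OF insertI1]] span_scale[OF span_insert_superset[OF c]]])
    ultimately have "b \<in> span (insert b' C)" by simp
    moreover have "b' \<in> span (insert b C)" using \<open>b' \<in> span B\<close> C by simp
    moreover have "C \<subseteq> span (insert b' C)" "C \<subseteq> span (insert b C)"
      by (auto intro: span_base)
    ultimately show ?thesis
      unfolding C(2) span_eq by blast
  qed
  have ind: "independent (insert b' C)"
  proof -
    have "b' \<notin> span C"
    proof
      assume "b' \<in> span C"
      then have "b' - c \<in> span C" using c span_diff by blast
      then have "(1 / x b) *\<^sub>R (b' - c) \<in> span C" by (rule span_scale)
      then have "b \<in> span C" using b by (simp add: eq)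
      then show False using \<open>independent B\<close> C unfolding C_def dependent_def by blast
    qed
    moreover have "independent C" using \<open>independent B\<close> C independent_mono by blast
    ultimately show ?thesis by (rule independent_insertI)
  qed
  have "\<exists>c>0. \<forall>f. f \<in> borel_measurable borel \<longrightarrow>
           (\<integral>\<^sup>+x. f x \<partial>span_lborel (insert b' C)) = ennreal c * (\<integral>\<^sup>+x. f x \<partial>span_lborel B')"
  proof (rule Suc.hyps(1))
    have "B' - insert b' C = (B' - B) - {b'}" using b unfolding C_def by auto
    then show "n = card (B' - insert b' C)"
      using Suc.hyps(2) b' by (simp add: card_Diff_singleton)
  qed (use Suc.prems C spn ind in auto)
  then obtain k where k: "k > 0" "\<And>f. f \<in> borel_measurable borel \<Longrightarrow>
           (\<integral>\<^sup>+x. f x \<partial>span_lborel (insert b' C)) = ennreal k * (\<integral>\<^sup>+x. f x \<partial>span_lborel B')" by blast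
  show ?case
  proof (intro exI[of _ "\<bar>x b\<bar> * k"] conjI allI impI)
    fix f :: "'a \<Rightarrow> ennreal" assume f: "f \<in> borel_measurable borel"
    show "(\<integral>\<^sup>+x. f x \<partial>span_lborel B) = ennreal (\<bar>x b\<bar> * k) * (\<integral>\<^sup>+x. f x \<partial>span_lborel B')"
      unfolding C(2) nn_integral_span_lborel_exchange[OF C(1) f c b(3) C(3,4) eq] k(2)[OF f]
      using k(1) by (simp add: ennreal_mult' ennreal_mult mult.assoc)
  qed (use k b in auto)
qed

section \<open>Orthonormal sets\<close>

lemma orthonormal_setD:
  assumes "orthonormal_set B"
  shows "finite B" "\<And>b. b \<in> B \<Longrightarrow> norm b = 1" "\<And>b c. b \<in> B \<Longrightarrow> c \<in> B \<Longrightarrow> b \<noteq> c \<Longrightarrow> inner b c = 0"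
    "\<And>b. b \<in> B \<Longrightarrow> inner b b = 1"
  using assms unfolding orthonormal_set_def pairwise_def orthogonal_def by (auto simp: norm_eq_1)

lemma orthonormal_set_independent:
  assumes "orthonormal_set B" shows "independent B"
  using assms by (intro pairwise_orthogonal_independent) (auto simp: orthonormal_set_def)

lemma orthonormal_set_subset: "orthonormal_set B \<Longrightarrow> C \<subseteq> B \<Longrightarrow> orthonormal_set C"
  unfolding orthonormal_set_def by (meson finite_subset pairwise_subset subsetD)

lemma orthonormal_set_insert:
  assumes "orthonormal_set B" "norm b = 1" "\<And>c. c \<in> B \<Longrightarrow> inner b c = 0"
  shows "orthonormal_set (insert b B)"
  using assms unfolding orthonormal_set_def pairwise_insert orthogonal_def
  by (auto simp: inner_commute)

lemma inner_lincomb_orthonormal: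
  assumes "orthonormal_set B" "c \<in> B"
  shows "inner (\<Sum>b\<in>B. x b *\<^sub>R b) c = x c"
proof -
  have "inner (\<Sum>b\<in>B. x b *\<^sub>R b) c = (\<Sum>b\<in>B. if b = c then x c else 0)"
    unfolding inner_sum_left using assms orthonormal_setD[OF assms(1)] by (intro sum.cong) auto
  then show ?thesis using assms orthonormal_setD(1)[OF assms(1)] by simp
qed

lemma norm_lincomb_orthonormal:
  assumes "orthonormal_set B"
  shows "(norm (\<Sum>b\<in>B. x b *\<^sub>R b))\<^sup>2 = (\<Sum>b\<in>B. (x b)\<^sup>2)"
proof -
  have "(norm (\<Sum>b\<in>B. x b *\<^sub>R b))\<^sup>2 = (\<Sum>c\<in>B. inner (\<Sum>b\<in>B. x b *\<^sub>R b) (x c *\<^sub>R c))"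
    unfolding power2_norm_eq_inner by (simp add: inner_sum_right)
  also have "\<dots> = (\<Sum>c\<in>B. (x c)\<^sup>2)"
    using inner_lincomb_orthonormal[OF assms] by (intro sum.cong) (auto simp: power2_eq_square)
  finally show ?thesis .
qed

lemma orthonormal_expansion:
  assumes "orthonormal_set B" "x \<in> span B"
  shows "x = (\<Sum>b\<in>B. inner x b *\<^sub>R b)"
proof -
  obtain u where u: "x = (\<Sum>b\<in>B. u b *\<^sub>R b)"
    using assms(2) unfolding span_finite[OF orthonormal_setD(1)[OF assms(1)]] by blast
  have "inner x b = u b" if "b \<in> B" for b
    unfolding u by (rule inner_lincomb_orthonormal[OF assms(1) that])
  then have "(\<Sum>b\<in>B. inner x b *\<^sub>R b) = (\<Sum>b\<in>B. u b *\<^sub>R b)" by simp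
  then show ?thesis using u by simp
qed

lemma inner_span_orthogonal:
  assumes "\<And>c. c \<in> B \<Longrightarrow> inner b c = 0" "y \<in> span B"
  shows "inner b y = 0"
  using assms(2) by (induction rule: span_induct_alt) (auto simp: inner_add_right assms(1))

text \<open>One step of Gram-Schmidt: what is left of x after projection to span B,
  normalised.\<close>

lemma orthonormal_extend_step:
  assumes "orthonormal_set B" "x \<notin> span B"
  shows "\<exists>b. norm b = 1 \<and> (\<forall>c\<in>B. inner b c = 0) \<and> span (insert b B) = span (insert x B)"
proof -
  define p where "p = (\<Sum>b\<in>B. inner x b *\<^sub>R b)"
  have p: "p \<in> span B" unfolding p_def by (intro span_sum span_scale span_base)
  have nz: "x - p \<noteq> 0" using p assms(2) by auto
  define b where "b = (1 / norm (x - p)) *\<^sub>R (x - p)"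
  have "inner b c = 0" if "c \<in> B" for c
    using inner_lincomb_orthonormal[OF assms(1) that, of "inner x"] unfolding b_def p_def
    by (simp add: inner_diff_left)
  moreover have "norm b = 1" using nz by (simp add: b_def)
  moreover have "span (insert b B) = span (insert x B)"
  proof (rule span_eq[THEN iffD2], intro conjI)
    have "x = norm (x - p) *\<^sub>R b + p" using nz by (simp add: b_def)
    also have "\<dots> \<in> span (insert b B)"
      by (rule span_add[OF span_scale[OF span_base[OF insertI1]] span_insert_superset[OF p]])
    finally have "x \<in> span (insert b B)" .
    then show "insert x B \<subseteq> span (insert b B)" by (auto intro: span_base)
    have "b \<in> span (insert x B)" unfolding b_def
      by (rule span_scale[OF span_diff[OF span_base[OF insertI1] span_insert_superset[OF p]]])
    then show "insert b B \<subseteq> span (insert x B)" by (auto intro: span_base)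
  qed
  ultimately show ?thesis by blast
qed

lemma orthonormal_extension_span:
  assumes "orthonormal_set B" "finite F"
  shows "\<exists>B'. orthonormal_set B' \<and> B \<subseteq> B' \<and> span B' = span (B \<union> F)"
  using assms(2)
proof (induction F rule: finite_induct)
  case empty then show ?case using assms by auto
next
  case (insert x F)
  then obtain B' where B': "orthonormal_set B'" "B \<subseteq> B'" "span B' = span (B \<union> F)" by blast
  have eq: "span (insert x B') = span (B \<union> insert x F)" for x
    using B'(3) by (simp add: span_insert)
  show ?case
  proof (cases "x \<in> span B'")
    case True
    then show ?thesis using B' eq[of x] span_redundant[OF True] by metis
  next
    case False
    then obtain b where b: "norm b = 1" "\<forall>c\<in>B'. inner b c = 0" "span (insert b B') = span (insert x B')"
      using orthonormal_extend_step[OF B'(1)] by blast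
    then show ?thesis using B' eq[of x] orthonormal_set_insert[of B' b] by (intro exI[of _ "insert b B'"]) auto
  qed
qed

lemma orthonormal_set_empty [simp]: "orthonormal_set {}"
  by (simp add: orthonormal_set_def)

lemma orthonormal_basis_span:
  assumes "finite F"
  shows "\<exists>B. orthonormal_set B \<and> span B = span F"
  using orthonormal_extension_span[OF orthonormal_set_empty assms] by auto

lemma orthonormal_card_eq:
  assumes "orthonormal_set B" "orthonormal_set B'" "span B = span B'"
  shows "card B = card B'"
  by (metis assms dim_span orthonormal_set_independent dim_eq_card_independent)

section \<open>Volumes of balls and independence of the orthonormal basis\<close>

lemma emeasure_span_lborel_cball:
  assumes "orthonormal_set B" "r \<ge> 0"
  shows "emeasure (span_lborel B) (cball 0 r) = ennreal (unit_ball_vol (card B) * r ^ card B)"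
proof -
  have n: "norm (\<Sum>b\<in>B. x b *\<^sub>R b) = sqrt (\<Sum>b\<in>B. (x b)\<^sup>2)" for x
    using norm_lincomb_orthonormal[OF assms(1), of x] by (metis norm_ge_zero real_sqrt_unique)
  have fin: "finite B" using orthonormal_setD[OF assms(1)] by simp
  have eq: "emeasure (span_lborel B) (cball 0 r) = emeasure (Pi\<^sub>M B (\<lambda>_. lborel))
             ({f. sqrt (\<Sum>i\<in>B. (f i)\<^sup>2) \<le> r} \<inter> space (Pi\<^sub>M B (\<lambda>_. lborel)))"
    unfolding span_lborel_def
    by (subst emeasure_distr) (auto simp: n dist_norm vimage_def simp del: real_sqrt_le_iff')
  show ?thesis
  proof (cases "r = 0")
    case False
    then show ?thesis unfolding eq using emeasure_cball_aux[OF fin, of r] assms by simp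
  next
    \<comment> \<open>Radius 0 is reached as a limit of positive radii. With B empty the measure is
      a point mass at 0 and \<open>0 ^ 0 = 1\<close> stands on the right; otherwise both sides are
      0.\<close>
    case True
    show ?thesis
    proof (cases "B = {}")
      case True
      then show ?thesis using \<open>r = 0\<close> unfolding eq by (simp add: PiM_empty)
    next
      case False
      then have c: "card B > 0" using fin card_gt_0_iff by blast
      have "emeasure (span_lborel B) (cball 0 r) \<le> ennreal (unit_ball_vol (card B) * e ^ card B)" if "e > 0" for e
      proof -
        have "emeasure (span_lborel B) (cball 0 r) \<le> emeasure (span_lborel B) (cball 0 e)"
          using \<open>r = 0\<close> that by (intro emeasure_mono) auto
        also have "\<dots> = emeasure (Pi\<^sub>M B (\<lambda>_. lborel))
             ({f. sqrt (\<Sum>i\<in>B. (f i)\<^sup>2) \<le> e} \<inter> space (Pi\<^sub>M B (\<lambda>_. lborel)))"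
          unfolding span_lborel_def
          by (subst emeasure_distr) (auto simp: n dist_norm vimage_def simp del: real_sqrt_le_iff')
        finally show ?thesis using emeasure_cball_aux[OF fin that] by simp
      qed
      moreover have "((\<lambda>e. ennreal (unit_ball_vol (card B) * e ^ card B)) \<longlongrightarrow> ennreal (unit_ball_vol (card B) * 0 ^ card B)) (at_right 0)"
        by (intro tendsto_intros)
      moreover have "\<forall>\<^sub>F e in at_right (0::real). e > 0" by (rule eventually_at_right_less)
      ultimately have "emeasure (span_lborel B) (cball 0 r) \<le> ennreal (unit_ball_vol (card B) * 0 ^ card B)"
        by (intro tendsto_lowerbound[where F = "at_right (0::real)" and f = "\<lambda>e. ennreal (unit_ball_vol (card B) * e ^ card B)"])
           (auto elim: eventually_mono)
      then show ?thesis using c \<open>r = 0\<close> by (simp add: power_0_left)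
    qed
  qed
qed

lemma span_lborel_eq:
  assumes "orthonormal_set B" "orthonormal_set B'" "span B = span B'"
  shows "span_lborel B = span_lborel B'"
proof -
  \<comment> \<open>the unit ball has the same measure for both bases, so the proportionality factor is 1\<close>
  obtain c where c: "c > 0" "\<And>f. f \<in> borel_measurable borel \<Longrightarrow>
           (\<integral>\<^sup>+x. f x \<partial>span_lborel B) = ennreal c * (\<integral>\<^sup>+x. f x \<partial>span_lborel B')"
    using span_lborel_proportional[of B B'] assms orthonormal_set_independent orthonormal_setD(1) by metis
  have em: "emeasure (span_lborel B) A = ennreal c * emeasure (span_lborel B') A" if "A \<in> sets borel" for A
    using c(2)[of "indicator A"] that by simp
  have "ennreal (unit_ball_vol (card B)) = ennreal c * ennreal (unit_ball_vol (card B'))"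
    using em[of "cball 0 1"] emeasure_span_lborel_cball[OF assms(1), of 1]
      emeasure_span_lborel_cball[OF assms(2), of 1] by simp
  then have "unit_ball_vol (card B) = c * unit_ball_vol (card B)"
    using c(1) orthonormal_card_eq[OF assms] by (simp add: ennreal_mult[symmetric])
  moreover have "unit_ball_vol (real (card B)) \<noteq> 0"
    by (metis less_irrefl of_nat_0_le_iff unit_ball_vol_pos)
  ultimately have "c = 1" by simp
  then show ?thesis using em by (intro measure_eqI) auto
qed

section \<open>Volumes of Minkowski sums with zonotopes\<close>

lemma closed_span_orthonormal:
  assumes "orthonormal_set B" shows "closed (span B)"
proof -
  have "span B = {x. x = (\<Sum>b\<in>B. inner x b *\<^sub>R b)}"
    using orthonormal_expansion[OF assms]
    by (auto intro: span_sum span_scale span_base) (metis (no_types, lifting) span_base span_scale span_sum)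
  moreover have "closed \<dots>"
    by (intro closed_Collect_eq continuous_intros)
  ultimately show ?thesis by simp
qed

lemma span_lincomb: "(\<Sum>b\<in>B. x b *\<^sub>R b) \<in> span B"
  by (intro span_sum span_scale span_base)

lemma AE_span_lborel:
  fixes B :: "'a::{real_inner,polish_space} set"
  assumes "orthonormal_set B"
  shows "AE x in span_lborel B. x \<in> span B"
proof -
  have "{x. x \<in> span B} \<in> sets borel"
    using borel_closed[OF closed_span_orthonormal[OF assms]] by simp
  then show ?thesis
    unfolding span_lborel_def
    by (subst AE_distr_iff) (auto intro!: AE_I2 span_lincomb)
qed

section \<open>Minkowski sums and convex bodies in a span\<close>

definition minkowski_sum :: "'a::real_vector set \<Rightarrow> real \<Rightarrow> 'a set \<Rightarrow> 'a set" where
  "minkowski_sum A r Z = {x + r *\<^sub>R z |x z. x \<in> A \<and> z \<in> Z}"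

lemma minkowski_sum_image: "minkowski_sum A r Z = (\<lambda>(x, z). x + r *\<^sub>R z) ` (A \<times> Z)"
  unfolding minkowski_sum_def by auto

lemma parallel_body_eq: "parallel_body B K r = minkowski_sum K r (cball 0 1 \<inter> span B)"
  unfolding parallel_body_def minkowski_sum_def by auto

lemma minkowski_sum_mono: "A \<subseteq> A' \<Longrightarrow> Z \<subseteq> Z' \<Longrightarrow> minkowski_sum A r Z \<subseteq> minkowski_sum A' r Z'"
  unfolding minkowski_sum_def by blast

lemma minkowski_sum_span: "A \<subseteq> span B \<Longrightarrow> Z \<subseteq> span B \<Longrightarrow> minkowski_sum A r Z \<subseteq> span B"
  unfolding minkowski_sum_def by (auto intro!: span_add span_scale)

lemma compact_minkowski_sum:
  fixes A :: "'a::real_normed_vector set"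
  assumes "compact A" "compact Z" shows "compact (minkowski_sum A r Z)"
  unfolding minkowski_sum_image
  by (intro compact_continuous_image compact_Times assms)
     (auto intro!: continuous_intros simp: case_prod_unfold)

lemma convex_minkowski_sum:
  assumes "convex A" "convex Z" shows "convex (minkowski_sum A r Z)"
proof -
  have "linear (\<lambda>(x, z). x + r *\<^sub>R z)"
    by (rule linearI) (auto simp: algebra_simps)
  then show ?thesis
    unfolding minkowski_sum_image by (intro convex_linear_image convex_Times assms)
qed

lemma minkowski_sum_linear_image:
  assumes "linear f"
  shows "f ` minkowski_sum A r Z = minkowski_sum (f ` A) r (f ` Z)"
  unfolding minkowski_sum_image
  by (force simp: linear_add[OF assms] linear_scale[OF assms] image_iff)

text \<open>Bodies may be empty or of lower dimension; B only fixes the span in which they are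
  measured, so that one set can be viewed in several ambient spaces.\<close>

definition convex_body :: "'a::real_inner set \<Rightarrow> 'a set \<Rightarrow> bool" where
  "convex_body B A \<longleftrightarrow> compact A \<and> convex A \<and> A \<subseteq> span B"

lemma convex_bodyD:
  assumes "convex_body B A"
  shows "compact A" "convex A" "A \<subseteq> span B" "bounded A" "closed A" "A \<in> sets borel"
  using assms by (auto simp: convex_body_def compact_imp_bounded compact_imp_closed)

lemma convex_body_minkowski_sum:
  assumes "convex_body B A" "convex_body B Z" shows "convex_body B (minkowski_sum A r Z)"
  using assms unfolding convex_body_def
  by (auto intro!: compact_minkowski_sum convex_minkowski_sum dest: minkowski_sum_span)

lemma emeasure_span_lborel_bounded:
  fixes B :: "'a::{real_inner,polish_space} set"
  assumes "orthonormal_set B" "bounded A"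
  shows "emeasure (span_lborel B) A < \<infinity>"
proof -
  obtain r where r: "r > 0" "A \<subseteq> cball 0 r"
    using assms(2) by (auto simp: bounded_pos subset_iff)
  have "emeasure (span_lborel B) A \<le> emeasure (span_lborel B) (cball 0 r)"
    using r by (intro emeasure_mono) auto
  also have "\<dots> < \<infinity>" using emeasure_span_lborel_cball[OF assms(1), of r] r by simp
  finally show ?thesis .
qed

lemma emeasure_span_lborel_eq_measure:
  fixes B :: "'a::{real_inner,polish_space} set"
  assumes "orthonormal_set B" "bounded A"
  shows "emeasure (span_lborel B) A = ennreal (measure (span_lborel B) A)"
  using emeasure_span_lborel_bounded[OF assms] by (simp add: emeasure_eq_ennreal_measure top_unique)

lemma measure_span_lborel_mono:
  fixes B :: "'a::{real_inner,polish_space} set"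
  assumes "orthonormal_set B" "A \<subseteq> A'" "A \<in> sets borel" "A' \<in> sets borel" "bounded A'"
  shows "measure (span_lborel B) A \<le> measure (span_lborel B) A'"
  using assms emeasure_span_lborel_bounded[OF assms(1,5)]
  by (intro measure_mono_fmeasurable) (auto simp: fmeasurable_def)

lemma inner_proj:
  assumes "orthonormal_set (insert v C)" "v \<notin> C" "x \<in> span (insert v C)"
  shows "x - inner x v *\<^sub>R v \<in> span C"
proof -
  have "x = inner x v *\<^sub>R v + (\<Sum>b\<in>C. inner x b *\<^sub>R b)"
    using orthonormal_expansion[OF assms(1,3)] orthonormal_setD(1)[OF assms(1)] assms(2) by simp
  then have "x - inner x v *\<^sub>R v = (\<Sum>b\<in>C. inner x b *\<^sub>R b)" by (simp add: algebra_simps)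
  then show ?thesis by (simp add: span_sum span_scale span_base)
qed

lemma linear_proj: "linear (\<lambda>x. x - inner x v *\<^sub>R v)"
  by (rule linearI) (auto simp: algebra_simps inner_add_left)

lemma convex_body_proj:
  assumes "orthonormal_set (insert v C)" "v \<notin> C" "convex_body (insert v C) A"
  shows "convex_body C ((\<lambda>x. x - inner x v *\<^sub>R v) ` A)"
  unfolding convex_body_def using convex_bodyD[OF assms(3)] inner_proj[OF assms(1,2)]
  by (auto intro!: compact_continuous_image convex_linear_image linear_proj continuous_intros)

lemma section_interval:
  fixes A :: "'a::real_inner set"
  assumes "compact A" "convex A" "norm v = 1"
  shows "\<exists>a b. {s. s *\<^sub>R v + y \<in> A} = {a..b}"
proof -
  let ?S = "{s. s *\<^sub>R v + y \<in> A}"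
  have "closed ?S"
  proof -
    have "?S = (\<lambda>s. s *\<^sub>R v + y) -` A" by auto
    moreover have "closed \<dots>"
      by (intro continuous_closed_vimage compact_imp_closed assms) (auto intro!: continuous_intros)
    ultimately show ?thesis by simp
  qed
  moreover have "bounded ?S"
  proof -
    obtain R where R: "\<And>x. x \<in> A \<Longrightarrow> norm x \<le> R"
      using compact_imp_bounded[OF assms(1)] by (auto simp: bounded_iff)
    have "norm s \<le> R + norm y" if "s \<in> ?S" for s
    proof -
      have "norm (s *\<^sub>R v) \<le> norm (s *\<^sub>R v + y) + norm y"
        by (metis add_diff_cancel_right' norm_triangle_ineq4)
      then show ?thesis using R[of "s *\<^sub>R v + y"] that assms(3) by auto
    qed
    then show ?thesis by (auto simp: bounded_iff)
  qed
  moreover have "convex ?S"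
  proof (rule convexI)
    fix s t u w :: real
    assume "s \<in> ?S" "t \<in> ?S" "0 \<le> u" "0 \<le> w" "u + w = 1"
    then have "u *\<^sub>R (s *\<^sub>R v + y) + w *\<^sub>R (t *\<^sub>R v + y) \<in> A"
      using convexD[OF assms(2)] by blast
    moreover have "u *\<^sub>R (s *\<^sub>R v + y) + w *\<^sub>R (t *\<^sub>R v + y) = (u *\<^sub>R s + w *\<^sub>R t) *\<^sub>R v + (u + w) *\<^sub>R y"
      by (simp add: algebra_simps)
    ultimately show "u *\<^sub>R s + w *\<^sub>R t \<in> ?S" using \<open>u + w = 1\<close> by simp
  qed
  ultimately show ?thesis
    by (metis compact_eq_bounded_closed connected_compact_interval_1 convex_connected)
qed

lemma convex_body_segment: "u \<in> span B \<Longrightarrow> convex_body B ((\<lambda>s. s *\<^sub>R u) ` {0..1})"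
  unfolding convex_body_def
  by (auto intro!: compact_continuous_image convex_linear_image continuous_intros span_scale linearI simp: algebra_simps)

lemma nn_integral_indicator_section:
  fixes A :: "'a::{real_inner,polish_space} set"
  assumes "A \<in> sets borel"
  shows "(\<integral>\<^sup>+s. indicator A (s *\<^sub>R v + y) \<partial>lborel) = emeasure lborel {s::real. s *\<^sub>R v + y \<in> A}"
proof -
  have "(\<lambda>s::real. s *\<^sub>R v + y) \<in> borel_measurable borel" by measurable
  then have "(\<lambda>s::real. s *\<^sub>R v + y) -` A \<in> sets borel"
    by (rule measurable_sets_borel[OF _ assms])
  then have "{s::real. s *\<^sub>R v + y \<in> A} \<in> sets lborel" by (simp add: vimage_def)
  from nn_integral_indicator[OF this] show ?thesis by (simp add: indicator_def)
qed

text \<open>Fubini along v: a line parallel to v meets A in an interval, and adding the segment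
  lengthens every nonempty interval by t. The lines that meet A are parametrised by the projection
  of A, which yields the second summand.\<close>

lemma measure_add_segment:
  fixes A :: "'a::{real_inner,polish_space} set"
  assumes o: "orthonormal_set (insert v C)" and v: "v \<notin> C" and A: "convex_body (insert v C) A" and t: "t \<ge> 0"
  shows "measure (span_lborel (insert v C)) (minkowski_sum A t ((\<lambda>s. s *\<^sub>R v) ` {0..1})) =
           measure (span_lborel (insert v C)) A + t * measure (span_lborel C) ((\<lambda>x. x - inner x v *\<^sub>R v) ` A)"
proof -
  let ?Q = "\<lambda>x. x - inner x v *\<^sub>R v" and ?I = "(\<lambda>s. s *\<^sub>R v) ` {0..1::real}"
  let ?B = "insert v C" and ?M = "minkowski_sum A t ((\<lambda>s. s *\<^sub>R v) ` {0..1})"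
  have fin: "finite C" using orthonormal_setD[OF o] by simp
  have nv: "norm v = 1" "inner v v = 1" using orthonormal_setD[OF o] by auto
  have oC: "orthonormal_set C" using orthonormal_set_subset[OF o] by blast
  have ortho: "inner y v = 0" if "y \<in> span C" for y
    using inner_span_orthogonal[of C v y] orthonormal_setD(3)[OF o] v that by (metis inner_commute insertCI)
  have I: "convex_body ?B ?I" by (rule convex_body_segment) (simp add: span_base)
  have M: "convex_body ?B ?M" by (rule convex_body_minkowski_sum[OF A I])
  have QA: "convex_body C (?Q ` A)" by (rule convex_body_proj[OF o v A])
  note [measurable] = convex_bodyD(6)[OF A] convex_bodyD(6)[OF M] convex_bodyD(6)[OF QA]
  have sec: "(\<integral>\<^sup>+s. indicator ?M (s *\<^sub>R v + y) \<partial>lborel) =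
      (\<integral>\<^sup>+s. indicator A (s *\<^sub>R v + y) \<partial>lborel) + ennreal t * indicator (?Q ` A) y" if y: "y \<in> span C" for y
  proof -
    obtain a b where ab: "{s. s *\<^sub>R v + y \<in> A} = {a..b}"
      using section_interval[OF convex_bodyD(1,2)[OF A] nv(1)] by blast
    have M': "s *\<^sub>R v + y \<in> ?M \<longleftrightarrow> (\<exists>s'\<in>{a..b}. s' \<le> s \<and> s \<le> s' + t)" for s
    proof
      assume "s *\<^sub>R v + y \<in> ?M"
      then obtain x u where x: "x \<in> A" "0 \<le> u" "u \<le> 1" "s *\<^sub>R v + y = x + t *\<^sub>R u *\<^sub>R v"
        unfolding minkowski_sum_def by auto
      then have "(s - t * u) *\<^sub>R v + y \<in> A" by (simp add: algebra_simps)
      then have "s - t * u \<in> {a..b}" using ab by blast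
      moreover have "t * u \<le> t" "0 \<le> t * u" using x t by (auto simp: mult_left_le)
      ultimately show "\<exists>s'\<in>{a..b}. s' \<le> s \<and> s \<le> s' + t" by (intro bexI[of _ "s - t * u"]) auto
    next
      assume "\<exists>s'\<in>{a..b}. s' \<le> s \<and> s \<le> s' + t"
      then obtain s' where s': "s' *\<^sub>R v + y \<in> A" "s' \<le> s" "s \<le> s' + t" using ab by blast
      show "s *\<^sub>R v + y \<in> ?M"
      \<comment> \<open>For t = 0 the quotient by t used below has no meaning; then s' = s.\<close>
      proof (cases "t = 0")
        case True
        then have "s *\<^sub>R v + y = (s' *\<^sub>R v + y) + t *\<^sub>R (0 *\<^sub>R v)" using s' by simp
        then show ?thesis unfolding minkowski_sum_def using s' by force
      next
        case False
        then have eq: "s *\<^sub>R v + y = (s' *\<^sub>R v + y) + t *\<^sub>R (((s - s') / t) *\<^sub>R v)"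
          using False by (simp add: scaleR_left_diff_distrib)
        have "(s - s') / t \<in> {0..1}" using s' False t by (auto simp: field_simps)
        then show ?thesis unfolding minkowski_sum_def using s'(1) eq by blast
      qed
    qed
    have i1: "(\<integral>\<^sup>+s. indicator ?M (s *\<^sub>R v + y) \<partial>lborel) = emeasure lborel {s. s *\<^sub>R v + y \<in> ?M}"
      by (rule nn_integral_indicator_section) measurable
    have i2: "(\<integral>\<^sup>+s. indicator A (s *\<^sub>R v + y) \<partial>lborel) = emeasure lborel {s. s *\<^sub>R v + y \<in> A}"
      by (rule nn_integral_indicator_section) measurable
    have yQ: "y \<in> ?Q ` A \<longleftrightarrow> {a..b} \<noteq> {}"
    proof
      assume "y \<in> ?Q ` A"
      then obtain x where "x \<in> A" "x = inner x v *\<^sub>R v + y" by auto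
      then show "{a..b} \<noteq> {}" using ab by (metis empty_iff mem_Collect_eq)
    next
      assume "{a..b} \<noteq> {}"
      then obtain s where s: "s *\<^sub>R v + y \<in> A" using ab by blast
      have "y = ?Q (s *\<^sub>R v + y)" using ortho[OF y] nv by (simp add: inner_add_left)
      then show "y \<in> ?Q ` A" using s by blast
    qed
    show ?thesis
    proof (cases "a \<le> b")
      case True
      have "{s. s *\<^sub>R v + y \<in> ?M} = {a..b+t}"
      proof -
        have "(\<exists>s'\<in>{a..b}. s' \<le> s \<and> s \<le> s' + t) \<longleftrightarrow> s \<in> {a..b+t}" for s
          \<comment> \<open>The best choice of s' is the last point of {a..b} that does not exceed
            s, namely \<open>min s b\<close>.\<close>
          using True t by (auto intro!: bexI[of _ "min s b"] simp: min_def)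
        then show ?thesis unfolding M' by auto
      qed
      then show ?thesis unfolding i1 i2 ab using True t yQ
        by (simp add: ennreal_plus[symmetric] algebra_simps del: ennreal_plus)
    next
      case False
      then have "{s. s *\<^sub>R v + y \<in> ?M} = {}" unfolding M' by auto
      then show ?thesis unfolding i1 i2 ab using False yQ by simp
    qed
  qed
  have "emeasure (span_lborel ?B) ?M = (\<integral>\<^sup>+y. (\<integral>\<^sup>+s. indicator ?M (s *\<^sub>R v + y) \<partial>lborel) \<partial>span_lborel C)"
    by (subst nn_integral_span_lborel_insert[symmetric]) (use fin v in auto)
  also have "\<dots> = (\<integral>\<^sup>+y. (\<integral>\<^sup>+s. indicator A (s *\<^sub>R v + y) \<partial>lborel) + ennreal t * indicator (?Q ` A) y \<partial>span_lborel C)"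
    using AE_span_lborel[OF oC] by (intro nn_integral_cong_AE) (auto elim!: eventually_mono simp: sec)
  also have "\<dots> = (\<integral>\<^sup>+y. (\<integral>\<^sup>+s. indicator A (s *\<^sub>R v + y) \<partial>lborel) \<partial>span_lborel C) + t * emeasure (span_lborel C) (?Q ` A)"
    by (subst nn_integral_add) (auto simp: nn_integral_cmult)
  also have "(\<integral>\<^sup>+y. (\<integral>\<^sup>+s. indicator A (s *\<^sub>R v + y) \<partial>lborel) \<partial>span_lborel C) = emeasure (span_lborel ?B) A"
    by (subst nn_integral_span_lborel_insert[symmetric]) (use fin v in auto)
  finally have "ennreal (measure (span_lborel ?B) ?M) = ennreal (measure (span_lborel ?B) A) + ennreal t * ennreal (measure (span_lborel C) (?Q ` A))"
    using emeasure_span_lborel_eq_measure[OF o convex_bodyD(4)[OF A]]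
      emeasure_span_lborel_eq_measure[OF o convex_bodyD(4)[OF M]]
      emeasure_span_lborel_eq_measure[OF oC convex_bodyD(4)[OF QA]] by simp
  then show ?thesis
    using t by (simp add: ennreal_mult[symmetric] ennreal_plus[symmetric] del: ennreal_plus)
qed

section \<open>Zonotopes and the volumes of their Minkowski sums\<close>

fun zonotope :: "'a::real_vector list \<Rightarrow> 'a set" where
  "zonotope [] = {0}"
| "zonotope (u # us) = minkowski_sum (zonotope us) 1 ((\<lambda>s. s *\<^sub>R u) ` {0..1})"

lemma convex_body_zonotope: "set us \<subseteq> span B \<Longrightarrow> convex_body B (zonotope us)"
proof (induction us)
  case Nil
  then show ?case by (simp add: convex_body_def span_zero)
next
  case (Cons u us)
  then show ?case by (auto intro!: convex_body_minkowski_sum convex_body_segment)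
qed

lemma zonotope_linear_image:
  assumes "linear f" shows "f ` zonotope us = zonotope (map f us)"
proof (induction us)
  case Nil
  then show ?case using linear_0[OF assms] by simp
next
  case (Cons u us)
  then show ?case
    using minkowski_sum_linear_image[OF assms] by (simp add: image_image linear_scale[OF assms])
qed

text \<open>Peeling off one generator u adds r times norm u times the volume of a projection along
  u, and the projected set is again a Minkowski sum with a zonotope, one dimension lower; hence
  induction on the number of generators with C arbitrary. The coefficients are functions of A, since
  signs and monotonicity in A are inherited through projections. For now the degree is bounded only
  by the number of generators.\<close>

lemma zonotope_polynomial:
  fixes C :: "'a::{real_inner,polish_space} set"
  assumes "orthonormal_set C" "set us \<subseteq> span C"
  shows "\<exists>c. \<forall>A. convex_body C A \<longrightarrow>
    (\<forall>r\<ge>0. measure (span_lborel C) (minkowski_sum A r (zonotope us)) = (\<Sum>j\<le>length us. c j A * r ^ j)) \<and>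
    (\<forall>j. c j A \<ge> 0) \<and> (\<forall>A' j. convex_body C A' \<and> A \<subseteq> A' \<longrightarrow> c j A \<le> c j A')"
  using assms
proof (induction "length us" arbitrary: us C)
  case 0
  then show ?case
    by (intro exI[of _ "\<lambda>j A. if j = 0 then measure (span_lborel C) A else 0"])
       (auto simp: minkowski_sum_def intro!: measure_span_lborel_mono dest: convex_bodyD)
next
  case (Suc n vs)
  then obtain u us where us: "vs = u # us" "length us = n" by (cases vs) auto
  have length_vs: "length vs = Suc n" using us by simp
  have u: "u \<in> span C" "set us \<subseteq> span C" using Suc.prems us by auto
  obtain c where c: "\<And>A. convex_body C A \<Longrightarrow>
    (\<forall>r\<ge>0. measure (span_lborel C) (minkowski_sum A r (zonotope us)) = (\<Sum>j\<le>n. c j A * r ^ j)) \<and>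
    (\<forall>j. c j A \<ge> 0) \<and> (\<forall>A' j. convex_body C A' \<and> A \<subseteq> A' \<longrightarrow> c j A \<le> c j A')"
    using Suc.hyps(1)[OF us(2)[symmetric] Suc.prems(1) u(2)] us(2) by blast
  define v where "v = u /\<^sub>R norm u"
  have uv: "u = norm u *\<^sub>R v" by (cases "u = 0") (auto simp: v_def)
  have split: "minkowski_sum A r (zonotope vs) = minkowski_sum (minkowski_sum A r (zonotope us)) (r * norm u) ((\<lambda>s. s *\<^sub>R v) ` {0..1})" for A r
  proof (rule set_eqI)
    fix x
    have *: "r *\<^sub>R (s *\<^sub>R u) = (r * norm u) *\<^sub>R (s *\<^sub>R v)" for s
      by (subst uv) (simp add: mult_ac)
    show "x \<in> minkowski_sum A r (zonotope vs) \<longleftrightarrow> x \<in> minkowski_sum (minkowski_sum A r (zonotope us)) (r * norm u) ((\<lambda>s. s *\<^sub>R v) ` {0..1})"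
      unfolding us minkowski_sum_def zonotope.simps
      by (simp only: mem_Collect_eq image_iff Bex_def scaleR_one, safe)
         (simp only: scaleR_add_right * add.assoc[symmetric], blast,
          metis (no_types, opaque_lifting) * scaleR_add_right add.assoc)
  qed
  show ?case
  proof (cases "u = 0")
    case True
    have "(\<lambda>s. s *\<^sub>R u) ` {0..1::real} = {0}" using True by force
    then have z: "minkowski_sum A r (zonotope vs) = minkowski_sum A r (zonotope us)" for A r
      unfolding us by (simp add: minkowski_sum_def)
    show ?thesis
      by (rule exI[of _ "\<lambda>j A. if j \<le> n then c j A else 0"])
         (use c us(2) in \<open>auto simp: z length_vs\<close>)
  next
    case False
    have nv: "norm v = 1" and v: "v \<in> span C" using False u by (auto simp: v_def span_scale)
    obtain D where D: "orthonormal_set D" "{v} \<subseteq> D" "span D = span ({v} \<union> C)"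
      using orthonormal_extension_span[of "{v}" C] nv orthonormal_setD(1)[OF Suc.prems(1)]
      by (auto simp: orthonormal_set_def)
    \<comment> \<open>C' spans the orthogonal complement of v in span C. As D is just another
      orthonormal basis of span C, the measure stays the same.\<close>
    define C' where "C' = D - {v}"
    have D': "D = insert v C'" "v \<notin> C'" using D by (auto simp: C'_def)
    have spn: "span D = span C" using D(3) v by (simp add: span_redundant)
    have oC': "orthonormal_set C'" using orthonormal_set_subset[OF D(1)] by (auto simp: C'_def)
    let ?Q = "\<lambda>x. x - inner x v *\<^sub>R v"
    have leb: "span_lborel C = span_lborel D" by (rule span_lborel_eq[OF Suc.prems(1) D(1) spn[symmetric]])
    have cb: "convex_body C A \<longleftrightarrow> convex_body D A" for A unfolding convex_body_def spn ..
    have oD: "orthonormal_set (insert v C')" using D D' by simp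
    have Qus: "set (map ?Q us) \<subseteq> span C'" 
      using inner_proj[OF oD D'(2)] u(2) spn D' by auto
    obtain c' where c': "\<And>A. convex_body C' A \<Longrightarrow>
      (\<forall>r\<ge>0. measure (span_lborel C') (minkowski_sum A r (zonotope (map ?Q us))) = (\<Sum>j\<le>n. c' j A * r ^ j)) \<and>
      (\<forall>j. c' j A \<ge> 0) \<and> (\<forall>A' j. convex_body C' A' \<and> A \<subseteq> A' \<longrightarrow> c' j A \<le> c' j A')"
      using Suc.hyps(1)[of "map ?Q us" C', OF _ oC' Qus] us(2) by auto
    \<comment> \<open>The prefactor r times norm u shifts the coefficients of the projected sum by
      one, hence \<open>j - 1\<close>.\<close>
    define d where "d j A = (if j \<le> n then c j A else 0) + (if j = 0 then 0 else norm u * c' (j - 1) (?Q ` A))" for j A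
    have QA: "convex_body C' (?Q ` A)" if "convex_body C A" for A
      using convex_body_proj[OF oD D'(2)] that cb D' by auto
    show ?thesis
    proof (intro exI[of _ d] allI impI conjI)
      fix A assume A: "convex_body C A"
      fix r :: real assume r: "r \<ge> 0"
      have Z: "convex_body C (minkowski_sum A r (zonotope us))"
        by (intro convex_body_minkowski_sum A convex_body_zonotope u)
      have "measure (span_lborel C) (minkowski_sum A r (zonotope vs)) =
          measure (span_lborel C) (minkowski_sum A r (zonotope us)) +
          (r * norm u) * measure (span_lborel C') (?Q ` (minkowski_sum A r (zonotope us)))"
        unfolding split leb D'(1) using Z[unfolded cb D'(1)] r
        by (intro measure_add_segment oD D') auto
      also have "?Q ` (minkowski_sum A r (zonotope us)) = minkowski_sum (?Q ` A) r (zonotope (map ?Q us))"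
        by (simp only: minkowski_sum_linear_image[OF linear_proj] zonotope_linear_image[OF linear_proj])
      also have "measure (span_lborel C) (minkowski_sum A r (zonotope us)) = (\<Sum>j\<le>n. c j A * r ^ j)"
        using c[OF A] r by blast
      also have "measure (span_lborel C') (minkowski_sum (?Q ` A) r (zonotope (map ?Q us))) = (\<Sum>j\<le>n. c' j (?Q ` A) * r ^ j)"
        using c'[OF QA[OF A]] r by blast
      also have "(\<Sum>j\<le>n. c j A * r ^ j) + (r * norm u) * (\<Sum>j\<le>n. c' j (?Q ` A) * r ^ j) = (\<Sum>j\<le>Suc n. d j A * r ^ j)"
      proof -
        have "(\<Sum>j\<le>Suc n. d j A * r ^ j) = (\<Sum>j\<le>Suc n. (if j \<le> n then c j A else 0) * r ^ j) +
           (\<Sum>j\<le>Suc n. (if j = 0 then 0 else norm u * c' (j - 1) (?Q ` A)) * r ^ j)"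
          unfolding d_def by (simp only: distrib_right sum.distrib)
        also have "(\<Sum>j\<le>Suc n. (if j = 0 then 0 else norm u * c' (j - 1) (?Q ` A)) * r ^ j) = (r * norm u) * (\<Sum>j\<le>n. c' j (?Q ` A) * r ^ j)"
          unfolding sum.atMost_Suc_shift by (simp add: sum_distrib_left mult_ac)
        finally show ?thesis by simp
      qed
      finally show "measure (span_lborel C) (minkowski_sum A r (zonotope vs)) = (\<Sum>j\<le>length vs. d j A * r ^ j)"
        using us by simp
    next
      fix A j assume A: "convex_body C A"
      show "d j A \<ge> 0" using c[OF A] c'[OF QA[OF A]] by (auto simp: d_def)
    next
      fix A A' j assume A: "convex_body C A" and A': "convex_body C A' \<and> A \<subseteq> A'"
      have "c' (j - 1) (?Q ` A) \<le> c' (j - 1) (?Q ` A')"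
        using c'[OF QA[OF A]] QA A' image_mono[of A A' ?Q] by blast
      then show "d j A \<le> d j A'" using c[OF A] A' unfolding d_def
        by (intro add_mono) (auto intro: mult_left_mono)
    qed
  qed
qed

section \<open>Approximation of the ball by zonotopes\<close>

lemma cball_borel_measurable [measurable]: "cball x r \<in> sets borel"
  by simp

text \<open>The support function of \<open>zonotope us\<close>: the segment from 0 to u contributes
  the positive part of \<open>inner u x\<close>.\<close>

definition zonotope_support :: "'a::real_inner list \<Rightarrow> 'a \<Rightarrow> real" where
  "zonotope_support us x = (\<Sum>u\<leftarrow>us. max 0 (inner u x))"

lemma inner_le_zonotope_support: "z \<in> zonotope us \<Longrightarrow> inner z x \<le> zonotope_support us x"
proof (induction us arbitrary: z)
  case Nil
  then show ?case by (simp add: zonotope_support_def)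
next
  case (Cons u us)
  then obtain z' s where z: "z = z' + s *\<^sub>R u" "z' \<in> zonotope us" "0 \<le> s" "s \<le> 1"
    by (auto simp: minkowski_sum_def)
  have "s * inner u x \<le> max 0 (inner u x)"
    using z(3,4) by (cases "inner u x \<ge> 0") (auto simp: mult_left_le_one_le mult_nonneg_nonpos max_def)
  then show ?case using Cons.IH[OF z(2)] z(1) by (simp add: zonotope_support_def inner_add_left)
qed

lemma zonotope_support_attained: "\<exists>z\<in>zonotope us. inner z x = zonotope_support us x"
proof (induction us)
  case Nil
  then show ?case by (simp add: zonotope_support_def)
next
  case (Cons u us)
  then obtain z where z: "z \<in> zonotope us" "inner z x = zonotope_support us x" by blast
  define s :: real where "s = (if inner u x \<ge> 0 then 1 else 0)"
  have "s *\<^sub>R u \<in> (\<lambda>s. s *\<^sub>R u) ` {0..1}" by (rule imageI) (simp add: s_def)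
  then have "z + 1 *\<^sub>R (s *\<^sub>R u) \<in> zonotope (u # us)"
    unfolding zonotope.simps minkowski_sum_def using z(1) by blast
  moreover have "inner (z + 1 *\<^sub>R (s *\<^sub>R u)) x = zonotope_support (u # us) x"
    using z(2) by (simp add: zonotope_support_def inner_add_left s_def)
  ultimately show ?case by blast
qed

text \<open>The upper inclusion tests z in its own direction. For the lower one, a point y of the
  ball outside the zonotope is separated from it by the unit vector x that points from the nearest
  point p to y; then \<open>inner p x\<close> is the value of the support function, at least 1,
  although \<open>inner y x\<close> is at most 1 and larger than \<open>inner p x\<close>.\<close>

lemma zonotope_between_balls:
  fixes C :: "'a::{real_inner,polish_space} set"
  assumes us: "set us \<subseteq> span C"
    and supp: "\<And>x. x \<in> span C \<Longrightarrow> norm x = 1 \<Longrightarrow> 1 \<le> zonotope_support us x \<and> zonotope_support us x \<le> R"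
    and R: "R \<ge> 0"
  shows "cball 0 1 \<inter> span C \<subseteq> zonotope us" "zonotope us \<subseteq> cball 0 R"
proof -
  have Z: "convex_body C (zonotope us)" by (rule convex_body_zonotope[OF us])
  have ne: "zonotope us \<noteq> {}" using zonotope_support_attained by blast
  show "zonotope us \<subseteq> cball 0 R"
  proof
    fix z assume z: "z \<in> zonotope us"
    show "z \<in> cball 0 R"
    proof (cases "z = 0")
      case False
      have "z /\<^sub>R norm z \<in> span C" using z convex_bodyD(3)[OF Z] by (auto intro: span_scale)
      then have "zonotope_support us (z /\<^sub>R norm z) \<le> R" using supp False by simp
      moreover have "inner z (z /\<^sub>R norm z) = norm z"
        using False by (simp add: power2_norm_eq_inner[symmetric] power2_eq_square)
      ultimately show ?thesis using inner_le_zonotope_support[OF z, of "z /\<^sub>R norm z"] by simp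
    qed (use R in simp)
  qed
  show "cball 0 1 \<inter> span C \<subseteq> zonotope us"
  proof (rule subsetI, rule ccontr)
    fix y assume y: "y \<in> cball 0 1 \<inter> span C" "y \<notin> zonotope us"
    have "\<exists>p\<in>zonotope us. \<forall>z\<in>zonotope us. dist y p \<le> dist y z"
      by (intro continuous_attains_inf convex_bodyD(1)[OF Z] ne continuous_intros)
    then obtain p where p: "p \<in> zonotope us" "\<forall>z\<in>zonotope us. dist y p \<le> dist y z" by blast
    define x where "x = (y - p) /\<^sub>R norm (y - p)"
    have yp: "norm (y - p) > 0" using y p by auto
    have xs: "x \<in> span C" unfolding x_def using y p convex_bodyD(3)[OF Z] by (auto intro!: span_scale span_diff)
    obtain z where z: "z \<in> zonotope us" "inner z x = zonotope_support us x"
      using zonotope_support_attained by blast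
    have "inner (y - p) (z - p) \<le> 0"
      by (rule any_closest_point_dot[OF convex_bodyD(2,5)[OF Z] p(1) z(1) p(2)])
    then have "inner (z - p) x \<le> 0" using yp unfolding x_def
      by (simp add: inner_commute zero_le_divide_iff divide_le_0_iff mult_le_0_iff)
    then have "inner z x \<le> inner p x" by (simp add: inner_diff_left)
    moreover have "1 \<le> zonotope_support us x" using supp[OF xs] yp by (simp add: x_def)
    ultimately have "1 \<le> inner p x" using z(2) by linarith
    moreover have "inner (y - p) x = norm (y - p)"
      using yp unfolding x_def by (simp add: power2_norm_eq_inner[symmetric] power2_eq_square)
    moreover have "inner y x \<le> 1"
    proof -
      have "inner y x \<le> norm y * norm x" by (rule norm_cauchy_schwarz)
      then show ?thesis using y yp by (simp add: x_def)
    qed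
    ultimately show False using yp by (simp add: inner_diff_left)
  qed
qed

lemma norm_add_orthogonal_squared:
  assumes "inner x y = 0" "norm x = 1"
  shows "(norm (s *\<^sub>R x + y))\<^sup>2 = s\<^sup>2 + (norm y)\<^sup>2"
  using assms unfolding power2_norm_eq_inner
  by (simp add: inner_add_left inner_add_right inner_commute norm_eq_1 power2_eq_square)

lemma norm_add_orthogonal:
  assumes "inner x y = 0" "norm x = 1" "r \<ge> 0"
  shows "norm (s *\<^sub>R x + y) \<le> r \<longleftrightarrow> \<bar>s\<bar> \<le> r \<and> norm y \<le> sqrt (r\<^sup>2 - s\<^sup>2)"
proof -
  have "norm (s *\<^sub>R x + y) \<le> r \<longleftrightarrow> (norm (s *\<^sub>R x + y))\<^sup>2 \<le> r\<^sup>2"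
    using assms(3) by (simp add: power2_le_iff_abs_le)
  also have "\<dots> \<longleftrightarrow> s\<^sup>2 + (norm y)\<^sup>2 \<le> r\<^sup>2" unfolding norm_add_orthogonal_squared[OF assms(1,2)] ..
  also have "\<dots> \<longleftrightarrow> \<bar>s\<bar> \<le> r \<and> norm y \<le> sqrt (r\<^sup>2 - s\<^sup>2)"
  proof
    assume a: "s\<^sup>2 + (norm y)\<^sup>2 \<le> r\<^sup>2"
    then have "s\<^sup>2 \<le> r\<^sup>2" using zero_le_power2[of "norm y"] by linarith
    then show "\<bar>s\<bar> \<le> r \<and> norm y \<le> sqrt (r\<^sup>2 - s\<^sup>2)"
      using a assms(3) by (auto simp: power2_le_iff_abs_le intro!: real_le_rsqrt)
  next
    assume a: "\<bar>s\<bar> \<le> r \<and> norm y \<le> sqrt (r\<^sup>2 - s\<^sup>2)"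
    then have "(norm y)\<^sup>2 \<le> (sqrt (r\<^sup>2 - s\<^sup>2))\<^sup>2" by (intro power_mono) auto
    also have "\<dots> = r\<^sup>2 - s\<^sup>2" using a assms(3) by (simp add: power2_le_iff_abs_le)
    finally show "s\<^sup>2 + (norm y)\<^sup>2 \<le> r\<^sup>2" by simp
  qed
  finally show ?thesis .
qed

text \<open>Slice the ball perpendicular to x. The right side no longer mentions x: this is rotation
  invariance, obtained by changing the orthonormal basis instead of rotating.\<close>

lemma ball_abs_inner_integral:
  fixes C :: "'a::{real_inner,polish_space} set"
  assumes C: "orthonormal_set C" and x: "x \<in> span C" "norm x = 1"
  shows "(\<integral>\<^sup>+u. ennreal \<bar>inner u x\<bar> * indicator (cball 0 1) u \<partial>span_lborel C) =
     (\<integral>\<^sup>+s. ennreal \<bar>s\<bar> * indicator {-1..1} s * ennreal (unit_ball_vol (real (card C - 1)) * sqrt (1 - s\<^sup>2) ^ (card C - 1)) \<partial>lborel)"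
proof -
  obtain D where D: "orthonormal_set D" "{x} \<subseteq> D" "span D = span ({x} \<union> C)"
    using orthonormal_extension_span[of "{x}" C] x orthonormal_setD(1)[OF C]
    by (auto simp: orthonormal_set_def)
  have spn: "span D = span C" using D(3) x by (simp add: span_redundant)
  define D' where "D' = D - {x}"
  have D': "D = insert x D'" "x \<notin> D'" "orthonormal_set D'" "finite D'"
    using D orthonormal_set_subset[of D D'] orthonormal_setD(1)[OF D(1)] by (auto simp: D'_def)
  have card: "card D' = card C - 1"
    using orthonormal_card_eq[OF D(1) C spn] D' by simp
  have ortho: "inner x y = 0" if "y \<in> span D'" for y
    using D'(1,2) orthonormal_setD(3)[OF D(1), of x] by (intro inner_span_orthogonal[of D' x y] that) auto
  have "(\<integral>\<^sup>+u. ennreal \<bar>inner u x\<bar> * indicator (cball 0 1) u \<partial>span_lborel C) =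
      (\<integral>\<^sup>+s. (\<integral>\<^sup>+y. ennreal \<bar>inner (s *\<^sub>R x + y) x\<bar> * indicator (cball 0 1) (s *\<^sub>R x + y) \<partial>span_lborel D') \<partial>lborel)"
    unfolding span_lborel_eq[OF C D(1) spn[symmetric]] D'(1)
    by (rule nn_integral_span_lborel_insert'[OF D'(4,2)]) measurable
  also have "\<dots> = (\<integral>\<^sup>+s. ennreal \<bar>s\<bar> * indicator {-1..1} s * ennreal (unit_ball_vol (real (card C - 1)) * sqrt (1 - s\<^sup>2) ^ (card C - 1)) \<partial>lborel)"
  proof (rule nn_integral_cong)
    fix s :: real
    have "(\<integral>\<^sup>+y. ennreal \<bar>inner (s *\<^sub>R x + y) x\<bar> * indicator (cball 0 1) (s *\<^sub>R x + y) \<partial>span_lborel D') =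
      (\<integral>\<^sup>+y. ennreal \<bar>s\<bar> * indicator {-1..1} s * indicator (cball 0 (sqrt (1 - s\<^sup>2))) y \<partial>span_lborel D')"
    proof (rule nn_integral_cong_AE, use AE_span_lborel[OF D'(3)] in eventually_elim)
      case (elim y)
      have "inner (s *\<^sub>R x + y) x = s"
        using ortho[OF elim] x by (simp add: inner_add_left inner_commute[of y x] norm_eq_1)
      then show ?case using norm_add_orthogonal[OF ortho[OF elim] x(2), of 1 s]
        by (auto simp: indicator_def)
    qed
    also have "\<dots> = ennreal \<bar>s\<bar> * indicator {-1..1} s * emeasure (span_lborel D') (cball 0 (sqrt (1 - s\<^sup>2)))"
      by (subst nn_integral_cmult_indicator) auto
    also have "\<dots> = ennreal \<bar>s\<bar> * indicator {-1..1} s * ennreal (unit_ball_vol (real (card C - 1)) * sqrt (1 - s\<^sup>2) ^ (card C - 1))"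
    proof (cases "s \<in> {-1..1}")
      case True
      then have "0 \<le> sqrt (1 - s\<^sup>2)" by (auto simp: abs_square_le_1)
      then show ?thesis using emeasure_span_lborel_cball[OF D'(3)] card by simp
    qed simp
    finally show "(\<integral>\<^sup>+y. ennreal \<bar>inner (s *\<^sub>R x + y) x\<bar> * indicator (cball 0 1) (s *\<^sub>R x + y) \<partial>span_lborel D') =
       ennreal \<bar>s\<bar> * indicator {-1..1} s * ennreal (unit_ball_vol (real (card C - 1)) * sqrt (1 - s\<^sup>2) ^ (card C - 1))" .
  qed
  finally show ?thesis .
qed

text \<open>On [1/4, 1/2] one has s at least 1/4 and sqrt (1 - s^2) at least 1/2, which bounds the
  integrand from below on an interval of length 1/4.\<close>

lemma ball_abs_inner_integral_pos:
  "(\<integral>\<^sup>+s. ennreal \<bar>s\<bar> * indicator {-1..1} s * ennreal (unit_ball_vol (real n) * sqrt (1 - s\<^sup>2) ^ n) \<partial>lborel) > 0"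
proof -
  have "0 < ennreal (1/4 * (unit_ball_vol (real n) * (1/2) ^ n)) * ennreal (1/4)"
    by (auto simp: ennreal_mult[symmetric] ennreal_zero_less_mult_iff)
  also have "\<dots> = (\<integral>\<^sup>+s. ennreal (1/4 * (unit_ball_vol (real n) * (1/2) ^ n)) * indicator {1/4..1/2::real} s \<partial>lborel)"
    by (subst nn_integral_cmult_indicator) auto
  also have "\<dots> \<le> (\<integral>\<^sup>+s. ennreal \<bar>s\<bar> * indicator {-1..1} s * ennreal (unit_ball_vol (real n) * sqrt (1 - s\<^sup>2) ^ n) \<partial>lborel)"
  proof (rule nn_integral_mono)
    fix s :: real
    show "ennreal (1/4 * (unit_ball_vol (real n) * (1/2) ^ n)) * indicator {1/4..1/2} s
        \<le> ennreal \<bar>s\<bar> * indicator {-1..1} s * ennreal (unit_ball_vol (real n) * sqrt (1 - s\<^sup>2) ^ n)"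
    proof (cases "s \<in> {1/4..1/2}")
      case True
      then have "s\<^sup>2 \<le> (1/2)\<^sup>2" by (intro power_mono) auto
      then have "1/2 \<le> sqrt (1 - s\<^sup>2)" by (intro real_le_rsqrt) (simp add: power2_eq_square)
      then have "1/4 * (unit_ball_vol (real n) * (1/2) ^ n) \<le> \<bar>s\<bar> * (unit_ball_vol (real n) * sqrt (1 - s\<^sup>2) ^ n)"
        using True by (intro mult_mono power_mono) auto
      moreover have "0 \<le> unit_ball_vol (real n) * sqrt (1 - s\<^sup>2) ^ n"
      proof (intro mult_nonneg_nonneg zero_le_power)
        show "0 \<le> sqrt (1 - s\<^sup>2)" using \<open>1/2 \<le> sqrt (1 - s\<^sup>2)\<close> by linarith
      qed simp
      ultimately have "ennreal (1/4 * (unit_ball_vol (real n) * (1/2) ^ n)) \<le> ennreal \<bar>s\<bar> * ennreal (unit_ball_vol (real n) * sqrt (1 - s\<^sup>2) ^ n)"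
        by (subst ennreal_mult[symmetric]) (auto intro: ennreal_leI)
      then show ?thesis using True by simp
    qed simp
  qed
  finally show ?thesis .
qed

lemma ball_abs_inner_mean:
  fixes C :: "'a::{real_inner,polish_space} set"
  assumes C: "orthonormal_set C"
  shows "\<exists>J>0. \<forall>x\<in>span C. norm x = 1 \<longrightarrow>
    integrable (span_lborel C) (\<lambda>u. \<bar>inner u x\<bar> * indicator (cball 0 1) u) \<and>
    (\<integral>u. \<bar>inner u x\<bar> * indicator (cball 0 1) u \<partial>span_lborel C) = J"
proof -
  define I where "I = (\<integral>\<^sup>+s. ennreal \<bar>s\<bar> * indicator {-1..1} s * ennreal (unit_ball_vol (real (card C - 1)) * sqrt (1 - s\<^sup>2) ^ (card C - 1)) \<partial>lborel)"
  have nn: "(\<integral>\<^sup>+u. ennreal (\<bar>inner u x\<bar> * indicator (cball 0 1) u) \<partial>span_lborel C) = I" if "x \<in> span C" "norm x = 1" for x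
    using ball_abs_inner_integral[OF C that] unfolding I_def by (simp add: ennreal_mult' ennreal_indicator)
  have fin: "I < \<infinity>" if "x \<in> span C" "norm x = 1" for x
  proof -
    have "I \<le> (\<integral>\<^sup>+u. indicator (cball 0 1) u \<partial>span_lborel C)"
      unfolding nn[OF that, symmetric]
    proof (rule nn_integral_mono)
      fix u
      have "\<bar>inner u x\<bar> \<le> norm u" using Cauchy_Schwarz_ineq2[of u x] that by simp
      then show "ennreal (\<bar>inner u x\<bar> * indicator (cball 0 1) u) \<le> indicator (cball 0 1) u"
        by (auto simp: indicator_def ennreal_le_1)
    qed
    also have "\<dots> < \<infinity>" using emeasure_span_lborel_bounded[OF C, of "cball 0 1"] by simp
    finally show ?thesis .
  qed
  show ?thesis
  proof (cases "\<exists>x\<in>span C. norm x = 1")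
    case False
    \<comment> \<open>Without unit vectors, in the trivial span, any positive J serves.\<close>
    then show ?thesis by (intro exI[of _ 1]) auto
  next
    case True
    then have I: "I < \<infinity>" "I > 0" using fin ball_abs_inner_integral_pos[of "card C - 1"] unfolding I_def by auto
    show ?thesis
    proof (intro exI[of _ "enn2real I"] conjI ballI impI)
      show "enn2real I > 0" using I by (simp add: enn2real_positive_iff)
      fix x assume x: "x \<in> span C" "norm x = 1"
      have [measurable]: "(\<lambda>u. \<bar>inner u x\<bar> * indicator (cball 0 1) u) \<in> borel_measurable borel"
        by (intro borel_measurable_times borel_measurable_abs borel_measurable_inner borel_measurable_indicator) auto
      show "integrable (span_lborel C) (\<lambda>u. \<bar>inner u x\<bar> * indicator (cball 0 1) u)"
        by (rule integrableI_nonneg) (use nn[OF x] I in auto)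
      show "(\<integral>u. \<bar>inner u x\<bar> * indicator (cball 0 1) u \<partial>span_lborel C) = enn2real I"
        by (subst integral_eq_nn_integral) (use nn[OF x] in auto)
    qed
  qed
qed

text \<open>Coordinates of points of the ball lie in [-r, r], so this closed set is contained in a
  continuous image of a product of intervals, compact by Tychonoff. The coordinates outside C are
  frozen at 0 to have a product over the whole type.\<close>

lemma compact_ball_span:
  fixes C :: "'a::{real_inner,polish_space} set"
  assumes "orthonormal_set C"
  shows "compact (cball 0 r \<inter> span C)"
proof -
  let ?P = "PiE UNIV (\<lambda>b. if b \<in> C then {-r..r::real} else {0})" and ?f = "\<lambda>x. \<Sum>b\<in>C. x b *\<^sub>R b"
  have "compactin (product_topology (\<lambda>_. euclidean) UNIV) ?P"
    by (subst compactin_PiE) auto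
  then have "compact ?P" by (simp add: euclidean_product_topology)
  then have "compact (?f ` ?P)"
    by (rule compact_continuous_image[rotated]) (intro continuous_intros continuous_on_subset[OF continuous_on_product_coordinates], auto)
  then have "compact ((cball 0 r \<inter> span C) \<inter> ?f ` ?P)"
    by (intro closed_Int_compact closed_Int closed_cball closed_span_orthonormal[OF assms])
  moreover have "cball 0 r \<inter> span C = cball 0 r \<inter> span C \<inter> ?f ` ?P"
  proof -
    have "y \<in> ?f ` ?P" if "y \<in> cball 0 r" "y \<in> span C" for y
    proof (rule image_eqI)
      show "y = ?f (\<lambda>b. if b \<in> C then inner y b else 0)" using orthonormal_expansion[OF assms that(2)] by simp
      have "\<bar>inner y b\<bar> \<le> r" if "b \<in> C" for b
        using Cauchy_Schwarz_ineq2[of y b] orthonormal_setD(2)[OF assms that] \<open>y \<in> cball 0 r\<close> by simp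
      then show "(\<lambda>b. if b \<in> C then inner y b else 0) \<in> ?P" by (auto simp: abs_le_iff minus_le_iff)
    qed
    then show ?thesis by blast
  qed
  ultimately show ?thesis by simp
qed

lemma zonotope_approximates_ball:
  fixes C :: "'a::{real_inner,polish_space} set"
  assumes C: "orthonormal_set C" and e: "e > 0"
  shows "\<exists>us. set us \<subseteq> span C \<and> cball 0 1 \<inter> span C \<subseteq> zonotope us \<and> zonotope us \<subseteq> cball 0 (1 + e)"
proof -
  \<comment> \<open>Riemann sums of \<open>\<integral> \<bar>inner u x\<bar> du\<close> over the ball are support functions of zonotopes, and the integral is \<open>J * norm x\<close>\<close>
  obtain J where J: "J > 0" "\<And>x. x \<in> span C \<Longrightarrow> norm x = 1 \<Longrightarrow>
    integrable (span_lborel C) (\<lambda>u. \<bar>inner u x\<bar> * indicator (cball 0 1) u)"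
    "\<And>x. x \<in> span C \<Longrightarrow> norm x = 1 \<Longrightarrow> (\<integral>u. \<bar>inner u x\<bar> * indicator (cball 0 1) u \<partial>span_lborel C) = J"
    using ball_abs_inner_mean[OF C] by blast
  define m where "m = unit_ball_vol (real (card C))"
  have m: "m > 0" by (simp add: m_def)
  \<comment> \<open>\<eta> is the relative error for which (1 + \<eta>) / (1 - \<eta>) = 1 + e. The
    mesh \<delta> is chosen so that the error of the Riemann sum, at most \<delta> times the volume
    m of the ball, is at most J \<eta>.\<close>
  define \<eta> where "\<eta> = e / (2 + e)"
  have \<eta>: "0 < \<eta>" "\<eta> < 1" "(1 + \<eta>) / (1 - \<eta>) = 1 + e" using e by (auto simp: \<eta>_def field_simps)
  define \<delta> where "\<delta> = J * \<eta> / m"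
  have \<delta>: "\<delta> > 0" "\<delta> * m = J * \<eta>" using J \<eta> m by (auto simp: \<delta>_def)
  let ?X = "cball 0 1 \<inter> span C"
  have cover: "?X \<subseteq> (\<Union>p\<in>?X. ball p \<delta>)" using \<delta>(1) by (intro subsetI UN_I) auto
  have "\<And>p. p \<in> ?X \<Longrightarrow> open (ball p \<delta>)" by simp
  then obtain P where "P \<subseteq> ?X" "finite P" "?X \<subseteq> (\<Union>p\<in>P. ball p \<delta>)"
    by (rule compactE_image[OF compact_ball_span[OF C, of 1] _ cover])
  then have P: "finite P" "P \<subseteq> ?X" "?X \<subseteq> (\<Union>p\<in>P. ball p \<delta>)" by simp_all
  obtain ps where ps: "set ps = P" using finite_list[OF P(1)] by blast
  define n where "n = length ps"
  \<comment> \<open>The cover made disjoint: A i collects the points of the ball whose first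
    covering index is i.\<close>
  define A where "A i = cball 0 1 \<inter> ball (ps ! i) \<delta> - (\<Union>j<i. ball (ps ! j) \<delta>)" for i
  have Ameas [measurable]: "A i \<in> sets borel" for i unfolding A_def by measurable
  have Abd: "bounded (A i)" for i by (rule bounded_subset[OF bounded_cball[of 0 1]]) (auto simp: A_def)
  let ?M = "span_lborel C"
  have Aem: "emeasure ?M (A i) < \<infinity>" for i by (rule emeasure_span_lborel_bounded[OF C Abd])
  have Aint: "integrable ?M (\<lambda>u. indicator (A i) u * k)" for i and k :: real
    using Aem[of i] by (intro integrable_mult_left integrable_real_indicator) auto
  have bint: "integrable ?M (\<lambda>u. \<delta> * indicator (cball 0 1) u :: real)"
    using emeasure_span_lborel_bounded[OF C, of "cball 0 1"]
    by (intro integrable_mult_right integrable_real_indicator) auto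
  have bval: "(\<integral>u. \<delta> * indicator (cball 0 1) u \<partial>?M) = \<delta> * m"
    using emeasure_span_lborel_cball[OF C, of 1] by (simp add: measure_def m_def)
  define t where "t i = measure ?M (A i)" for i
  define S where "S x = (\<Sum>i<n. t i * \<bar>inner (ps ! i) x\<bar>)" for x
  have ind: "\<exists>k<n. u \<in> ball (ps ! k) \<delta> \<and> (\<forall>i<n. u \<in> A i \<longleftrightarrow> i = k)" if u: "u \<in> ?X" for u
  proof -
    have ex: "\<exists>k. k < n \<and> u \<in> ball (ps ! k) \<delta>"
      using u P(3) ps unfolding n_def by (metis (no_types, lifting) UN_E in_set_conv_nth subsetD)
    define k where "k = (LEAST k. k < n \<and> u \<in> ball (ps ! k) \<delta>)"
    have k: "k < n" "u \<in> ball (ps ! k) \<delta>" using LeastI_ex[OF ex] unfolding k_def by auto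
    have least: "\<not> (j < n \<and> u \<in> ball (ps ! j) \<delta>)" if "j < k" for j
      using not_less_Least[OF that[unfolded k_def]] .
    have "u \<in> A i \<longleftrightarrow> i = k" if "i < n" for i
    proof
      assume "u \<in> A i"
      then have "\<not> k < i" "u \<in> ball (ps ! i) \<delta>" using k unfolding A_def by auto
      then show "i = k" using least[of i] that linorder_neqE_nat by blast
    next
      assume "i = k"
      then show "u \<in> A i" using k least u unfolding A_def by auto
    qed
    then show ?thesis using k by blast
  qed
  have approx: "\<bar>J - S x\<bar> \<le> J * \<eta>" if x: "x \<in> span C" "norm x = 1" for x
  proof -
    let ?f = "\<lambda>u. \<bar>inner u x\<bar> * indicator (cball 0 1) u" and ?g = "\<lambda>u. \<Sum>i<n. indicator (A i) u * \<bar>inner (ps ! i) x\<bar>"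
    have gint: "integrable ?M ?g" by (intro Bochner_Integration.integrable_sum Aint)
    have "(\<integral>u. ?g u \<partial>?M) = S x"
      unfolding S_def t_def using Aem
      by (subst Bochner_Integration.integral_sum[OF Aint]) (auto intro!: sum.cong simp: measure_def)
    then have "J - S x = (\<integral>u. ?f u - ?g u \<partial>?M)"
      using Bochner_Integration.integral_diff[OF J(2)[OF x] gint] J(3)[OF x] by simp
    also have "\<bar>\<dots>\<bar> \<le> (\<integral>u. \<bar>?f u - ?g u\<bar> \<partial>?M)"
      by (rule integral_abs_bound)
    also have "\<dots> \<le> (\<integral>u. \<delta> * indicator (cball 0 1) u \<partial>?M)"
    proof (rule integral_mono_AE)
      show "integrable ?M (\<lambda>u. \<bar>?f u - ?g u\<bar>)" using J(2)[OF x] gint by auto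
      show "AE u in ?M. \<bar>?f u - ?g u\<bar> \<le> \<delta> * indicator (cball 0 1) u"
        using AE_span_lborel[OF C]
      proof eventually_elim
        case (elim u)
        show ?case
        proof (cases "u \<in> cball 0 1")
          case True
          then obtain k where k: "k < n" "u \<in> ball (ps ! k) \<delta>" "\<And>i. i < n \<Longrightarrow> u \<in> A i \<longleftrightarrow> i = k"
            using ind elim by blast
          have "?g u = (\<Sum>i<n. if i = k then \<bar>inner (ps ! k) x\<bar> else 0)"
            using k(3) by (intro sum.cong) (auto simp: indicator_def)
          then have "?g u = \<bar>inner (ps ! k) x\<bar>" using k(1) by simp
          moreover have "\<bar>inner (u - ps ! k) x\<bar> \<le> \<delta>"
            using Cauchy_Schwarz_ineq2[of "u - ps ! k" x] x k(2) by (simp add: dist_norm norm_minus_commute)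
          ultimately show ?thesis using True by (simp add: inner_diff_left) 
        next
          case False
          then show ?thesis by (auto simp: A_def)
        qed
      qed
    qed (rule bint)
    finally show ?thesis using bval \<delta>(2) by simp
  qed
  \<comment> \<open>Division by J (1 - \<eta>) turns the lower bound of the support function into 1
    and the upper one into (1 + \<eta>) / (1 - \<eta>).\<close>
  define k where "k = 1 / (J * (1 - \<eta>))"
  have k: "k > 0" using J \<eta> by (simp add: k_def)
  define ws where "ws = map (\<lambda>i. (k * t i) *\<^sub>R (ps ! i)) [0..<n]"
  \<comment> \<open>Every vector occurs with both signs, since the positive parts belonging to u and
    -u add up to an absolute value.\<close>
  define us where "us = ws @ map uminus ws"
  have supp: "zonotope_support us x = k * S x" for x
  proof -
    have "zonotope_support us x = (\<Sum>i<n. max 0 (k * t i * inner (ps ! i) x) + max 0 (- (k * t i * inner (ps ! i) x)))"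
      unfolding zonotope_support_def us_def ws_def
      by (simp add: comp_def interv_sum_list_conv_sum_set_nat sum.distrib atLeast0LessThan)
    also have "\<dots> = (\<Sum>i<n. k * (t i * \<bar>inner (ps ! i) x\<bar>))"
    proof (rule sum.cong)
      fix i
      have "max 0 (k * t i * inner (ps ! i) x) + max 0 (- (k * t i * inner (ps ! i) x)) = \<bar>k * t i * inner (ps ! i) x\<bar>"
        by (auto simp: max_def)
      then show "max 0 (k * t i * inner (ps ! i) x) + max 0 (- (k * t i * inner (ps ! i) x)) = k * (t i * \<bar>inner (ps ! i) x\<bar>)"
        using k by (simp add: abs_mult t_def)
    qed simp
    finally show ?thesis by (simp add: S_def sum_distrib_left)
  qed
  have us_span: "set us \<subseteq> span C"
  proof -
    have "ps ! i \<in> span C" if "i < n" for i using P(2) ps that nth_mem unfolding n_def by blast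
    then show ?thesis unfolding us_def ws_def by (auto intro!: span_scale span_neg)
  qed
  have bounds: "1 \<le> zonotope_support us x \<and> zonotope_support us x \<le> 1 + e" if "x \<in> span C" "norm x = 1" for x
  proof -
    have "J * (1 - \<eta>) \<le> S x" "S x \<le> J * (1 + \<eta>)" using approx[OF that] by (auto simp: algebra_simps abs_le_iff)
    then have "k * (J * (1 - \<eta>)) \<le> k * S x" "k * S x \<le> k * (J * (1 + \<eta>))" using k by auto
    moreover have "k * (J * (1 - \<eta>)) = 1" using J \<eta> by (simp add: k_def)
    moreover have "k * (J * (1 + \<eta>)) = 1 + e" using J \<eta>(1,2) unfolding \<eta>(3)[symmetric] by (simp add: k_def)
    ultimately show ?thesis unfolding supp by simp
  qed
  show ?thesis
    using zonotope_between_balls[OF us_span bounds] e us_span by (intro exI[of _ us]) auto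
qed

section \<open>The Steiner formula\<close>

lemma polynomial_coeffs_convergent:
  fixes c :: "nat \<Rightarrow> nat \<Rightarrow> real"
  assumes "\<And>r. r > 0 \<Longrightarrow> convergent (\<lambda>m. \<Sum>j\<le>d. c m j * r ^ j)" "j \<le> d"
  shows "convergent (\<lambda>m. c m j)"
  using assms
proof (induction d arbitrary: c j)
  case 0
  then show ?case using 0(1)[of 1] by simp
next
  case (Suc d)
  \<comment> \<open>the combination p(2r) - 2^(d+1) p(r) lowers the degree\<close>
  have low: "convergent (\<lambda>m. c m j)" if j: "j \<le> d" for j
  proof -
    define e where "e m i = c m i * (2 ^ i - 2 ^ Suc d)" for m i
    have "convergent (\<lambda>m. e m j)"
    proof (rule Suc.IH[OF _ j])
      fix r :: real assume r: "r > 0"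
      have "(\<Sum>i\<le>d. e m i * r ^ i) = (\<Sum>i\<le>Suc d. c m i * (2 * r) ^ i) - 2 ^ Suc d * (\<Sum>i\<le>Suc d. c m i * r ^ i)" for m
      proof -
        have "(\<Sum>i\<le>d. e m i * r ^ i) = (\<Sum>i\<le>Suc d. e m i * r ^ i)" by (simp add: e_def)
        also have "\<dots> = (\<Sum>i\<le>Suc d. c m i * (2 * r) ^ i - 2 ^ Suc d * (c m i * r ^ i))"
          by (rule sum.cong) (auto simp: e_def power_mult_distrib algebra_simps)
        finally show ?thesis by (simp only: sum_subtractf sum_distrib_left)
      qed
      then show "convergent (\<lambda>m. \<Sum>i\<le>d. e m i * r ^ i)"
        using Suc.prems(1)[of r] Suc.prems(1)[of "2 * r"] r
        by (simp only:) (intro convergent_diff convergent_mult convergent_const; simp)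
    qed
    moreover have "(2::real) ^ j - 2 ^ Suc d \<noteq> 0" using j power_strict_increasing[of j "Suc d" "2::real"] by simp
    ultimately have "convergent (\<lambda>m. e m j * (1 / (2 ^ j - 2 ^ Suc d)))"
      by (intro convergent_mult convergent_const)
    then show ?thesis using \<open>(2::real) ^ j - 2 ^ Suc d \<noteq> 0\<close> by (simp add: e_def)
  qed
  show ?case
  proof (cases "j = Suc d")
    case False
    then show ?thesis using low Suc.prems by simp
  next
    case True
    have "convergent (\<lambda>m. (\<Sum>i\<le>Suc d. c m i * 1 ^ i) - (\<Sum>i\<le>d. c m i))"
      by (intro convergent_diff Suc.prems(1) convergent_sum low) auto
    then show ?thesis using True by simp
  qed
qed

lemma polynomial_coeffs_unique:
  fixes a b :: "nat \<Rightarrow> real"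
  assumes "\<And>r. r > 0 \<Longrightarrow> (\<Sum>j\<le>d. a j * r ^ j) = (\<Sum>j\<le>d. b j * r ^ j)" "j \<le> d"
  shows "a j = b j"
proof (rule ccontr)
  assume "a j \<noteq> b j"
  then have "finite {z::real. (\<Sum>i\<le>d. (a i - b i) * z ^ i) = 0}"
    using assms(2) by (intro conjunct1[OF polyfun_rootbound]) auto
  moreover have "{0<..} \<subseteq> {z::real. (\<Sum>i\<le>d. (a i - b i) * z ^ i) = 0}"
    using assms(1) by (auto simp: left_diff_distrib sum_subtractf)
  ultimately show False using infinite_Ioi finite_subset by blast
qed

text \<open>As all terms are non-negative, each is dominated by the sum, and growth of order d then
  kills every higher coefficient. This brings the degree down from the number of generators of a
  zonotope to the dimension.\<close>

lemma polynomial_degree_bound: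
  fixes c :: "nat \<Rightarrow> real"
  assumes nn: "\<And>j. c j \<ge> 0" and bd: "\<And>r. r > 0 \<Longrightarrow> (\<Sum>j\<le>N. c j * r ^ j) \<le> K * (1 + r) ^ d"
    and j: "d < j" "j \<le> N"
  shows "c j = 0"
proof -
  have "c j \<le> K * 2 ^ d * (1 / r)" if r: "r \<ge> 1" for r
  proof -
    have "c j * r ^ j \<le> (\<Sum>j\<le>N. c j * r ^ j)"
      using j nn r by (intro member_le_sum) auto
    also have "\<dots> \<le> K * (1 + r) ^ d" using bd r by simp
    also have "\<dots> \<le> K * (2 * r) ^ d"
    proof (intro mult_left_mono power_mono)
      have "0 \<le> (\<Sum>j\<le>N. c j * 1 ^ j)" using nn by (intro sum_nonneg) auto
      then have "0 \<le> K * 2 ^ d" using bd[of 1] by simp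
      then show "K \<ge> 0" using mult_neg_pos[of K "2 ^ d"] by force
    qed (use r in auto)
    finally have "c j \<le> K * 2 ^ d * (r ^ d / r ^ j)"
      using r by (simp add: field_simps power_mult_distrib)
    also have "r ^ d / r ^ j = 1 / r ^ (j - d)" using r j by (simp add: power_diff field_simps)
    finally have 1: "c j \<le> K * 2 ^ d * (1 / r ^ (j - d))" .
    have "r ^ 1 \<le> r ^ (j - d)" using r j by (intro power_increasing) auto
    then have "1 / r ^ (j - d) \<le> 1 / r" using r by (simp add: frac_le)
    moreover have "K * 2 ^ d \<ge> 0"
    proof -
      have "0 \<le> (\<Sum>j\<le>N. c j * 1 ^ j)" using nn by (intro sum_nonneg) auto
      then show ?thesis using bd[of 1] by simp
    qed
    ultimately have "K * 2 ^ d * (1 / r ^ (j - d)) \<le> K * 2 ^ d * (1 / r)" by (intro mult_left_mono)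
    then show ?thesis using 1 by linarith
  qed
  moreover have "((\<lambda>r::real. K * 2 ^ d * (1 / r)) \<longlongrightarrow> K * 2 ^ d * 0) at_top"
    by (intro tendsto_intros tendsto_divide_0[OF tendsto_const] filterlim_at_top_imp_at_infinity filterlim_ident)
  ultimately have "c j \<le> K * 2 ^ d * 0"
    by (intro tendsto_lowerbound[where f = "\<lambda>r. K * 2 ^ d * (1 / r)" and F = at_top])
       (auto intro: eventually_mono[OF eventually_ge_at_top[of 1]])
  then show ?thesis using nn[of j] by simp
qed

section \<open>Distance functions and parallel bodies\<close>

lemma infdist_attained:
  fixes A :: "'a::metric_space set"
  assumes "compact A" "A \<noteq> {}"
  shows "\<exists>a\<in>A. infdist x A = dist x a"
proof -
  have "\<exists>a\<in>A. \<forall>y\<in>A. dist x a \<le> dist x y"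
    by (intro continuous_attains_inf assms continuous_intros)
  then obtain a where a: "a \<in> A" "\<forall>y\<in>A. dist x a \<le> dist x y" by blast
  have "dist x a \<le> infdist x A" unfolding infdist_notempty[OF assms(2)] using assms a by (intro cINF_greatest) auto
  then show ?thesis using a infdist_le[OF a(1), of x] by (intro bexI[of _ a]) auto
qed

lemma mem_parallel_body_iff:
  assumes "A \<subseteq> span C" "x \<in> span C" "\<rho> \<ge> 0"
  shows "x \<in> parallel_body C A \<rho> \<longleftrightarrow> (\<exists>a\<in>A. norm (x - a) \<le> \<rho>)"
proof
  assume "x \<in> parallel_body C A \<rho>"
  then show "\<exists>a\<in>A. norm (x - a) \<le> \<rho>"
    using assms(3) by (force simp: parallel_body_def mult_left_le)
next
  assume "\<exists>a\<in>A. norm (x - a) \<le> \<rho>"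
  then obtain a where a: "a \<in> A" "norm (x - a) \<le> \<rho>" by blast
  show "x \<in> parallel_body C A \<rho>"
  proof (cases "\<rho> = 0")
    case True
    then show ?thesis using a by (auto simp: parallel_body_def intro!: exI[of _ a] exI[of _ 0] span_zero)
  next
    case False
    then have "x = a + \<rho> *\<^sub>R ((x - a) /\<^sub>R \<rho>)" by simp
    moreover have "(x - a) /\<^sub>R \<rho> \<in> span C" using assms a by (auto intro!: span_scale span_diff)
    moreover have "norm ((x - a) /\<^sub>R \<rho>) \<le> 1"
      using a assms(3) False by (simp add: divide_inverse[symmetric] mult.commute[of "inverse \<rho>"])
    ultimately show ?thesis using a unfolding parallel_body_def by blast
  qed
qed

lemma parallel_body_infdist:
  assumes K: "convex_body B K" "K \<noteq> {}" and r: "r \<ge> 0"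
  shows "parallel_body B K r = {x \<in> span B. infdist x K \<le> r}"
proof -
  have "parallel_body B K r \<subseteq> span B"
    using convex_bodyD(3)[OF K(1)] by (auto simp: parallel_body_def intro!: span_add span_scale)
  moreover have "(\<exists>a\<in>K. norm (x - a) \<le> r) \<longleftrightarrow> infdist x K \<le> r" for x
    using infdist_attained[OF convex_bodyD(1)[OF K(1)] K(2), of x]
    by (metis dist_norm infdist_le order_trans)
  ultimately show ?thesis using mem_parallel_body_iff[OF convex_bodyD(3)[OF K(1)] _ r] by blast
qed

lemma convex_body_ball:
  fixes B :: "'a::{real_inner,polish_space} set"
  shows "orthonormal_set B \<Longrightarrow> convex_body B (cball 0 r \<inter> span B)"
  unfolding convex_body_def
  by (auto intro!: compact_ball_span convex_Int convex_cball subspace_imp_convex[OF subspace_span])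

lemma convex_body_parallel_body:
  fixes B :: "'a::{real_inner,polish_space} set"
  shows "orthonormal_set B \<Longrightarrow> convex_body B K \<Longrightarrow> convex_body B (parallel_body B K r)"
  unfolding parallel_body_eq by (intro convex_body_minkowski_sum convex_body_ball)

lemma measure_span_lborel_le:
  fixes B :: "'a::{real_inner,polish_space} set"
  assumes "orthonormal_set B" "A \<in> sets borel" "A \<subseteq> cball 0 r" "r \<ge> 0"
  shows "measure (span_lborel B) A \<le> unit_ball_vol (card B) * r ^ card B"
proof -
  have "measure (span_lborel B) A \<le> measure (span_lborel B) (cball 0 r)"
    using assms by (intro measure_span_lborel_mono) auto
  also have "\<dots> = unit_ball_vol (card B) * r ^ card B"
    using emeasure_span_lborel_cball[OF assms(1,4)] assms(4) by (simp add: measure_def)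
  finally show ?thesis .
qed

text \<open>For zonotopes Z that shrink to the ball, the volumes of A + r Z converge to the parallel
  volume for every r. Their degrees are at most card B, so convergence of the values gives
  convergence of the coefficients, and positivity and monotonicity in A pass to the limit.\<close>

lemma steiner_polynomial:
  fixes B :: "'a::{real_inner,polish_space} set"
  assumes B: "orthonormal_set B"
  shows "\<exists>c. \<forall>A. convex_body B A \<and> A \<noteq> {} \<longrightarrow>
    (\<forall>r\<ge>0. measure (span_lborel B) (parallel_body B A r) = (\<Sum>j\<le>card B. c j A * r ^ j)) \<and>
    (\<forall>j. c j A \<ge> (0::real)) \<and> (\<forall>A' j. convex_body B A' \<and> A \<subseteq> A' \<longrightarrow> c j A \<le> c j A')"
proof -
  let ?d = "card B" and ?M = "span_lborel B"
  define e where "e m = 1 / real (Suc m)" for m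
  have e: "e m > 0" "e m \<le> 1" for m by (auto simp: e_def)
  have "\<exists>us. set us \<subseteq> span B \<and> cball 0 1 \<inter> span B \<subseteq> zonotope us \<and> zonotope us \<subseteq> cball 0 (1 + e m)" for m
    by (rule zonotope_approximates_ball[OF B e(1)])
  then obtain us where us: "\<And>m. set (us m) \<subseteq> span B" "\<And>m. cball 0 1 \<inter> span B \<subseteq> zonotope (us m)"
    "\<And>m. zonotope (us m) \<subseteq> cball 0 (1 + e m)" by metis
  define N where "N m = length (us m)" for m
  have "\<forall>m. \<exists>c. \<forall>A. convex_body B A \<longrightarrow>
    (\<forall>r\<ge>0. measure ?M (minkowski_sum A r (zonotope (us m))) = (\<Sum>j\<le>N m. c j A * r ^ j)) \<and>
    (\<forall>j. c j A \<ge> (0::real)) \<and> (\<forall>A' j. convex_body B A' \<and> A \<subseteq> A' \<longrightarrow> c j A \<le> c j A')"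
    unfolding N_def using zonotope_polynomial[OF B us(1)] by blast
  then obtain c where c': "\<And>m A. convex_body B A \<Longrightarrow>
    (\<forall>r\<ge>0. measure ?M (minkowski_sum A r (zonotope (us m))) = (\<Sum>j\<le>N m. c m j A * r ^ j)) \<and>
    (\<forall>j. c m j A \<ge> 0) \<and> (\<forall>A' j. convex_body B A' \<and> A \<subseteq> A' \<longrightarrow> c m j A \<le> c m j A')"
    by metis
  \<comment> \<open>The polynomial identity says nothing about \<open>c m j\<close> beyond N m.
    Padding by zeros allows N m to be compared with the dimension.\<close>
  define b where "b m j A = (if j \<le> N m then c m j A else 0)" for m j A
  have Z: "convex_body B (zonotope (us m))" for m by (rule convex_body_zonotope[OF us(1)])
  have b_pos: "b m j A \<ge> 0" if "convex_body B A" for m j A using c'[OF that] by (auto simp: b_def)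
  have b_mono: "b m j A \<le> b m j A'" if "convex_body B A" "convex_body B A'" "A \<subseteq> A'" for m j A A'
    using c'[OF that(1)] that by (auto simp: b_def)
  have sub1: "parallel_body B A r \<subseteq> minkowski_sum A r (zonotope (us m))" for A r m
    unfolding parallel_body_eq by (intro minkowski_sum_mono us) auto
  have sub2: "minkowski_sum A r (zonotope (us m)) \<subseteq> parallel_body B A (r * (1 + e m))" for A r m
  proof
    fix x assume "x \<in> minkowski_sum A r (zonotope (us m))"
    then obtain a z where x: "x = a + r *\<^sub>R z" "a \<in> A" "z \<in> zonotope (us m)" by (auto simp: minkowski_sum_def)
    have "norm z \<le> 1 + e m" using us(3) x(3) by force
    then have "norm (z /\<^sub>R (1 + e m)) \<le> 1" using e(1)[of m] by (simp add: field_simps)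
    moreover have "z /\<^sub>R (1 + e m) \<in> span B" using x(3) convex_bodyD(3)[OF Z] by (auto intro: span_scale)
    moreover have "x = a + (r * (1 + e m)) *\<^sub>R (z /\<^sub>R (1 + e m))" using x e(1)[of m] by simp
    ultimately show "x \<in> parallel_body B A (r * (1 + e m))" using x unfolding parallel_body_def by blast
  qed
  have val: "measure ?M (minkowski_sum A r (zonotope (us m))) = (\<Sum>j\<le>?d. b m j A * r ^ j)"
    if A: "convex_body B A" and r: "r \<ge> 0" for m A r
  proof -
    obtain R where R: "R > 0" "A \<subseteq> cball 0 R"
      using convex_bodyD(4)[OF A] by (auto simp: bounded_pos subset_iff)
    have zero: "b m j A = 0" if "?d < j" for j
    proof (cases "j \<le> N m")
      case True
      have "c m j A = 0"
      \<comment> \<open>A lies in the ball of radius R and the zonotope in the ball of radius 2, so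
        the sum lies in the ball of radius R + 2 r, at most max R 2 times 1 + r: the volume grows
        with order card B.\<close>
      proof (rule polynomial_degree_bound[where d = ?d and N = "N m" and K = "unit_ball_vol ?d * max R 2 ^ ?d"])
        fix r :: real assume r: "r > 0"
        have "(\<Sum>j\<le>N m. c m j A * r ^ j) = measure ?M (minkowski_sum A r (zonotope (us m)))"
          using c'[OF A] r by auto
        also have "\<dots> \<le> unit_ball_vol ?d * (max R 2 * (1 + r)) ^ ?d"
        proof (rule measure_span_lborel_le[OF B])
          show "minkowski_sum A r (zonotope (us m)) \<subseteq> cball 0 (max R 2 * (1 + r))"
          proof
            fix x assume "x \<in> minkowski_sum A r (zonotope (us m))"
            then obtain a z where x: "x = a + r *\<^sub>R z" "a \<in> A" "z \<in> zonotope (us m)" by (auto simp: minkowski_sum_def)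
            have "norm z \<le> 2" using us(3)[of m] x(3) e(2)[of m] by force
            then have "norm x \<le> R + r * 2"
              unfolding x(1) using x(2) R(2) r by (intro norm_triangle_mono) (auto simp: mult_left_mono)
            also have "\<dots> \<le> max R 2 * 1 + max R 2 * r"
              using r by (intro add_mono) (auto simp: mult.commute[of r] intro: mult_right_mono)
            also have "\<dots> = max R 2 * (1 + r)" by (simp add: distrib_left)
            finally show "x \<in> cball 0 (max R 2 * (1 + r))" by simp
          qed
        qed (use convex_bodyD(6)[OF convex_body_minkowski_sum[OF A Z]] r in auto)
        finally show "(\<Sum>j\<le>N m. c m j A * r ^ j) \<le> unit_ball_vol ?d * max R 2 ^ ?d * (1 + r) ^ ?d"
          by (simp add: power_mult_distrib mult_ac)
      qed (use c'[OF A] that True in auto)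
      then show ?thesis by (simp add: b_def)
    qed (simp add: b_def)
    have "measure ?M (minkowski_sum A r (zonotope (us m))) = (\<Sum>j\<le>N m. b m j A * r ^ j)"
      using c'[OF A] r by (simp add: b_def)
    also have "\<dots> = (\<Sum>j\<le>max (N m) ?d. b m j A * r ^ j)"
      by (rule sum.mono_neutral_left) (auto simp: b_def)
    also have "\<dots> = (\<Sum>j\<le>?d. b m j A * r ^ j)"
      by (rule sum.mono_neutral_right) (auto simp: zero)
    finally show ?thesis .
  qed
  have lim: "(\<lambda>m. \<Sum>j\<le>?d. b m j A * r ^ j) \<longlonglongrightarrow> measure ?M (parallel_body B A r)"
    if A: "convex_body B A" "A \<noteq> {}" and r: "r \<ge> 0" for A r
  proof -
    let ?P = "\<lambda>m. parallel_body B A (r * (1 + e m))"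
    have P: "convex_body B (parallel_body B A s)" for s by (rule convex_body_parallel_body[OF B A(1)])
    have Pe: "?P m = {x \<in> span B. infdist x A \<le> r * (1 + e m)}" for m
      using parallel_body_infdist[OF A] r e(1)[of m] by simp
    \<comment> \<open>Continuity of the measure from above: the upper bounds are parallel bodies
      whose radii decrease to r, and their intersection is the parallel body of radius r.\<close>
    have "(\<lambda>m. measure ?M (?P m)) \<longlonglongrightarrow> measure ?M (\<Inter>m. ?P m)"
    proof (rule Lim_measure_decseq)
      show "range ?P \<subseteq> sets ?M" using convex_bodyD(6)[OF P] by auto
      show "decseq ?P" unfolding Pe decseq_def
      proof (intro allI impI subsetI)
        fix m n x assume mn: "m \<le> n" and x: "x \<in> {x \<in> span B. infdist x A \<le> r * (1 + e n)}"
        have "r * (1 + e n) \<le> r * (1 + e m)" using mn r by (intro mult_left_mono) (auto simp: e_def frac_le)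
        then show "x \<in> {x \<in> span B. infdist x A \<le> r * (1 + e m)}" using x by auto
      qed
      show "emeasure ?M (?P m) \<noteq> \<infinity>" for m
        using emeasure_span_lborel_bounded[OF B convex_bodyD(4)[OF P]] by (simp add: less_top[symmetric])
    qed
    also have "(\<Inter>m. ?P m) = parallel_body B A r"
    proof -
      have "infdist x A \<le> r" if "\<And>m. infdist x A \<le> r * (1 + e m)" for x
      proof (rule LIMSEQ_le_const)
        have "(\<lambda>m. r * (1 + e m)) \<longlonglongrightarrow> r * (1 + 0)"
          unfolding e_def by (intro tendsto_intros LIMSEQ_Suc[OF lim_1_over_n])
        then show "(\<lambda>m. r * (1 + e m)) \<longlonglongrightarrow> r" by simp
      qed (use that in blast)
      moreover have "r \<le> r * (1 + e m)" for m using r e(1)[of m] by (simp add: distrib_left)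
      ultimately show ?thesis unfolding Pe parallel_body_infdist[OF A r] by (auto intro: order_trans)
    qed
    finally have up: "(\<lambda>m. measure ?M (?P m)) \<longlonglongrightarrow> measure ?M (parallel_body B A r)" .
    show ?thesis
    proof (rule tendsto_sandwich[OF _ _ tendsto_const up])
      show "\<forall>\<^sub>F m in sequentially. measure ?M (parallel_body B A r) \<le> (\<Sum>j\<le>?d. b m j A * r ^ j)"
        unfolding val[OF A(1) r, symmetric] using sub1 convex_bodyD(4,6)[OF P] convex_bodyD(4,6)[OF convex_body_minkowski_sum[OF A(1) Z]]
        by (intro always_eventually allI measure_span_lborel_mono[OF B]) auto
      show "\<forall>\<^sub>F m in sequentially. (\<Sum>j\<le>?d. b m j A * r ^ j) \<le> measure ?M (?P m)"
        unfolding val[OF A(1) r, symmetric] using sub2 convex_bodyD(4,6)[OF P] convex_bodyD(4,6)[OF convex_body_minkowski_sum[OF A(1) Z]]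
        by (intro always_eventually allI measure_span_lborel_mono[OF B]) auto
    qed
  qed
  have conv: "(\<lambda>m. b m j A) \<longlonglongrightarrow> lim (\<lambda>m. b m j A)" if "convex_body B A" "A \<noteq> {}" "j \<le> ?d" for j A
  proof -
    have "convergent (\<lambda>m. b m j A)"
      by (rule polynomial_coeffs_convergent[where c = "\<lambda>m j. b m j A" and d = ?d])
         (use lim[OF that(1,2), THEN convergentI, OF less_imp_le] that(3) in auto)
    then show ?thesis by (simp add: convergent_LIMSEQ_iff)
  qed
  define a where "a j A = (if j \<le> ?d then lim (\<lambda>m. b m j A) else 0)" for j A
  show ?thesis
  proof (intro exI[of _ a] allI impI conjI)
    fix A r assume A: "convex_body B A \<and> A \<noteq> {}" and r: "(0::real) \<le> r"
    have "(\<lambda>m. \<Sum>j\<le>?d. b m j A * r ^ j) \<longlonglongrightarrow> (\<Sum>j\<le>?d. a j A * r ^ j)"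
      using A conv by (intro tendsto_intros) (auto simp: a_def)
    then show "measure ?M (parallel_body B A r) = (\<Sum>j\<le>?d. a j A * r ^ j)"
      using lim A r LIMSEQ_unique by blast
  next
    fix A j assume A: "convex_body B A \<and> A \<noteq> {}"
    then show "a j A \<ge> 0" using conv[of A j] b_pos[of A]
      by (auto simp: a_def intro!: LIMSEQ_le_const)
  next
    fix A A' j assume A: "convex_body B A \<and> A \<noteq> {}" "convex_body B A' \<and> A \<subseteq> A'"
    then have "A' \<noteq> {}" by auto
    then show "a j A \<le> a j A'" using conv[of A j] conv[of A' j] b_mono[of A A'] A
      by (auto simp: a_def intro!: LIMSEQ_le)
  qed
qed

section \<open>Normalised coefficients: existence and uniqueness\<close>

lemma steiner_formula_iff:
  fixes B :: "'a::{real_inner,polish_space} set"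
  assumes "orthonormal_set B" "convex_body B K"
  shows "steiner_formula B K V \<longleftrightarrow>
     (\<forall>r\<ge>0. measure (span_lborel B) (parallel_body B K r) =
        (\<Sum>k\<le>card B. unit_ball_vol (real (card B - k)) * V k * r ^ (card B - k))) \<and>
     (\<forall>k>card B. V k = 0)"
  unfolding steiner_formula_def
  using span_volume_eq[OF convex_bodyD(6)[OF convex_body_parallel_body[OF assms]]] by simp

lemma sum_reverse_atMost: "(\<Sum>k\<le>d. f (d - k) k) = (\<Sum>j\<le>d. f j (d - j))" for d :: nat
  by (rule sum.reindex_bij_witness[of _ "\<lambda>j. d - j" "\<lambda>k. d - k"]) auto

lemma steiner_formula_unique:
  fixes B :: "'a::{real_inner,polish_space} set"
  assumes "orthonormal_set B" "convex_body B K" "steiner_formula B K V" "steiner_formula B K V'"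
  shows "V = V'"
proof
  fix k
  show "V k = V' k"
  proof (cases "k \<le> card B")
    case False
    then show ?thesis using assms(3,4) unfolding steiner_formula_def by simp
  next
    case True
    let ?d = "card B"
    have "unit_ball_vol (real j) * V (?d - j) = unit_ball_vol (real j) * V' (?d - j)" if "j \<le> ?d" for j
    proof (rule polynomial_coeffs_unique[OF _ that])
      fix r :: real assume "r > 0"
      have "span_volume B (parallel_body B K r) = (\<Sum>k\<le>?d. unit_ball_vol (real (?d - k)) * V k * r ^ (?d - k))"
        "span_volume B (parallel_body B K r) = (\<Sum>k\<le>?d. unit_ball_vol (real (?d - k)) * V' k * r ^ (?d - k))"
        using assms(3,4) less_imp_le[OF \<open>r > 0\<close>] unfolding steiner_formula_def by blast+
      then have "(\<Sum>k\<le>?d. unit_ball_vol (real (?d - k)) * V k * r ^ (?d - k)) = (\<Sum>k\<le>?d. unit_ball_vol (real (?d - k)) * V' k * r ^ (?d - k))"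
        by (simp only:)
      then show "(\<Sum>j\<le>?d. unit_ball_vol (real j) * V (?d - j) * r ^ j) = (\<Sum>j\<le>?d. unit_ball_vol (real j) * V' (?d - j) * r ^ j)"
        unfolding sum_reverse_atMost[where f = "\<lambda>j k. unit_ball_vol (real j) * V k * r ^ j"]
          sum_reverse_atMost[where f = "\<lambda>j k. unit_ball_vol (real j) * V' k * r ^ j"] .
    qed
    from this[of "?d - k"] show ?thesis using True unit_ball_vol_pos[of "real (?d - k)"]
      by (auto simp: less_imp_neq[THEN not_sym])
  qed
qed

lemma steiner_formula_exists:
  fixes B :: "'a::{real_inner,polish_space} set"
  assumes B: "orthonormal_set B"
  shows "\<exists>V. \<forall>K. convex_body B K \<and> K \<noteq> {} \<longrightarrow> steiner_formula B K (\<lambda>k. V k K) \<and>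
     (\<forall>k. V k K \<ge> 0) \<and> (\<forall>K' k. convex_body B K' \<and> K \<subseteq> K' \<longrightarrow> V k K \<le> V k K')"
proof -
  let ?d = "card B"
  obtain c where c: "\<forall>A. convex_body B A \<and> A \<noteq> {} \<longrightarrow>
    (\<forall>r\<ge>0. measure (span_lborel B) (parallel_body B A r) = (\<Sum>j\<le>?d. c j A * r ^ j)) \<and>
    (\<forall>j. c j A \<ge> (0::real)) \<and> (\<forall>A' j. convex_body B A' \<and> A \<subseteq> A' \<longrightarrow> c j A \<le> c j A')"
    using steiner_polynomial[OF B] by (rule exE)
  have pos: "unit_ball_vol (real n) > 0" for n by simp
  have ne: "unit_ball_vol (real n) \<noteq> 0" for n using pos[of n] by linarith
  define V where "V k A = (if k \<le> ?d then c (?d - k) A / unit_ball_vol (real (?d - k)) else 0)" for k A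
  show ?thesis
  proof (intro exI[of _ V] allI impI conjI)
    fix K assume K: "convex_body B K \<and> K \<noteq> {}"
    have "(\<Sum>k\<le>?d. unit_ball_vol (real (?d - k)) * V k K * r ^ (?d - k)) = (\<Sum>j\<le>?d. c j K * r ^ j)" for r
      unfolding sum_reverse_atMost[where f = "\<lambda>j k. unit_ball_vol (real j) * V k K * r ^ j"]
      using ne by (intro sum.cong) (auto simp: V_def)
    then show "steiner_formula B K (\<lambda>k. V k K)"
      using K c[rule_format, of K] steiner_formula_iff[OF B, of K] by (auto simp: V_def)
  next
    fix K k assume K: "convex_body B K \<and> K \<noteq> {}"
    then show "V k K \<ge> 0" using c[rule_format, of K] pos by (auto simp: V_def intro!: divide_nonneg_pos)
  next
    fix K K' k assume K: "convex_body B K \<and> K \<noteq> {}" "convex_body B K' \<and> K \<subseteq> K'"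
    then show "V k K \<le> V k K'" using c[rule_format, of K] pos by (auto simp: V_def intro!: divide_right_mono)
  qed
qed

section \<open>Passage to larger ambient spaces\<close>

lemma ball_slices:
  assumes r: "r \<ge> 0"
  shows "(\<integral>\<^sup>+s. indicator {-r..r} s * ennreal (unit_ball_vol (real j) * sqrt (r\<^sup>2 - s\<^sup>2) ^ j) \<partial>lborel) =
     ennreal (unit_ball_vol (real (Suc j)) * r ^ Suc j)"
proof (cases "r = 0")
  case True
  have "(\<integral>\<^sup>+s. indicator {-r..r} s * ennreal (unit_ball_vol (real j) * sqrt (r\<^sup>2 - s\<^sup>2) ^ j) \<partial>lborel) =
    (\<integral>\<^sup>+s. ennreal (unit_ball_vol (real j) * 0 ^ j) * indicator {0::real} s \<partial>lborel)"
    by (rule nn_integral_cong) (auto simp: True indicator_def)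
  also have "\<dots> = 0" by (subst nn_integral_cmult_indicator) auto
  finally show ?thesis using True by simp
next
  case False
  then have r: "r > 0" using r by simp
  have pos: "unit_ball_vol (real j) \<ge> 0" by simp
  have "(\<integral>\<^sup>+s. indicator {-r..r} s * ennreal (unit_ball_vol (real j) * sqrt (r\<^sup>2 - s\<^sup>2) ^ j) \<partial>lborel) =
     ennreal \<bar>r\<bar> * (\<integral>\<^sup>+t. indicator {-r..r} (0 + r * t) * ennreal (unit_ball_vol (real j) * sqrt (r\<^sup>2 - (0 + r * t)\<^sup>2) ^ j) \<partial>lborel)"
    using False by (intro nn_integral_real_affine) measurable
  also have "(\<integral>\<^sup>+t. indicator {-r..r} (0 + r * t) * ennreal (unit_ball_vol (real j) * sqrt (r\<^sup>2 - (0 + r * t)\<^sup>2) ^ j) \<partial>lborel)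
     = (\<integral>\<^sup>+t. ennreal (unit_ball_vol (real j) * r ^ j) * (indicator {-1..1} t * sqrt (1 - t\<^sup>2) ^ j) \<partial>lborel)"
  proof (rule nn_integral_cong)
    fix t :: real
    have "\<bar>r * t\<bar> \<le> r \<longleftrightarrow> \<bar>t\<bar> \<le> 1"
      using r mult_le_cancel_left_pos[of r "\<bar>t\<bar>" 1] by (simp add: abs_mult)
    then have 1: "0 + r * t \<in> {-r..r} \<longleftrightarrow> t \<in> {-1..1}" by (auto simp: abs_le_iff)
    have "r\<^sup>2 - (0 + r * t)\<^sup>2 = r\<^sup>2 * (1 - t\<^sup>2)" by (simp add: algebra_simps power_mult_distrib)
    then have 2: "sqrt (r\<^sup>2 - (0 + r * t)\<^sup>2) = r * sqrt (1 - t\<^sup>2)"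
      using r by (simp add: real_sqrt_mult)
    show "indicator {-r..r} (0 + r * t) * ennreal (unit_ball_vol (real j) * sqrt (r\<^sup>2 - (0 + r * t)\<^sup>2) ^ j)
      = ennreal (unit_ball_vol (real j) * r ^ j) * ennreal (indicator {-1..1} t * sqrt (1 - t\<^sup>2) ^ j)"
    proof (cases "t \<in> {-1..1}")
      case True
      then have "sqrt (1 - t\<^sup>2) ^ j \<ge> 0" by (intro zero_le_power) (simp add: abs_square_le_1 abs_le_iff)
      then show ?thesis unfolding indicator_def 1 2
        using True r pos by (simp add: ennreal_mult[symmetric] power_mult_distrib mult_ac del: unit_ball_vol_nonneg)
    next
      case False
      then have *: "0 + r * t \<notin> {-r..r}" using 1 by simp
      show ?thesis unfolding indicator_simps(2)[OF False] indicator_simps(2)[OF *] by simp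
    qed
  qed
  also have "\<dots> = ennreal (unit_ball_vol (real j) * r ^ j) * ennreal (Beta (1 / 2) (real j / 2 + 1))"
    unfolding emeasure_cball_aux_integral[symmetric] by (rule nn_integral_cmult) measurable
  also have "ennreal \<bar>r\<bar> * \<dots> = ennreal (unit_ball_vol (real j) * Beta (1/2) (real j / 2 + 1) * r ^ Suc j)"
    using r pos by (simp add: ennreal_mult'[symmetric] mult_ac)
  \<comment> \<open>The recursion for the volumes of unit balls, read off from the Gamma form of the
    Beta function.\<close>
  also have "unit_ball_vol (real j) * Beta (1/2) (real j / 2 + 1) = unit_ball_vol (real (Suc j))"
    by (auto simp: unit_ball_vol_def Beta_def Gamma_eq_zero_iff field_simps
          Gamma_one_half_real powr_half_sqrt [symmetric] powr_add [symmetric])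
  finally show ?thesis .
qed

text \<open>The slice of the larger parallel body at height s along b is the parallel body of A at
  distance sqrt (r^2 - s^2). Integrating the Steiner polynomial of the slices term by term raises
  each ball volume by one dimension and leaves the V k unchanged. Their positivity allows the sum to
  be moved through the non-negative integral.\<close>

lemma steiner_formula_insert:
  fixes B :: "'a::{real_inner,polish_space} set"
  assumes o: "orthonormal_set (insert b B)" and b: "b \<notin> B" and A: "convex_body B A"
    and S: "steiner_formula B A V" and V: "\<And>k. V k \<ge> 0"
  shows "steiner_formula (insert b B) A V"
proof -
  let ?d = "card B" and ?B = "insert b B"
  have oB: "orthonormal_set B" using orthonormal_set_subset[OF o] by blast
  have fin: "finite B" using orthonormal_setD[OF oB] by simp
  have nb: "norm b = 1" using orthonormal_setD[OF o] by simp
  have card: "card ?B = Suc ?d" using fin b by simp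
  have A': "convex_body ?B A" using A span_mono[of B ?B] unfolding convex_body_def by blast
  have ortho: "inner b y = 0" if "y \<in> span B" for y
    using b orthonormal_setD(3)[OF o, of b] by (intro inner_span_orthogonal[of B b y] that) auto
  have P: "convex_body ?B (parallel_body ?B A r)" for r by (rule convex_body_parallel_body[OF o A'])
  have P': "convex_body B (parallel_body B A r)" for r by (rule convex_body_parallel_body[OF oB A])
  have mem: "s *\<^sub>R b + y \<in> parallel_body ?B A r \<longleftrightarrow> \<bar>s\<bar> \<le> r \<and> y \<in> parallel_body B A (sqrt (r\<^sup>2 - s\<^sup>2))"
    if y: "y \<in> span B" and r: "r \<ge> 0" for s y r
  proof -
    have sp: "s *\<^sub>R b + y \<in> span ?B"
      by (rule span_add[OF span_scale[OF span_base[OF insertI1]] span_insert_superset[OF y]])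
    have "s *\<^sub>R b + y \<in> parallel_body ?B A r \<longleftrightarrow> (\<exists>a\<in>A. norm (s *\<^sub>R b + (y - a)) \<le> r)"
      using mem_parallel_body_iff[OF convex_bodyD(3)[OF A'] sp r] by (simp add: algebra_simps)
    also have "\<dots> \<longleftrightarrow> (\<exists>a\<in>A. \<bar>s\<bar> \<le> r \<and> norm (y - a) \<le> sqrt (r\<^sup>2 - s\<^sup>2))"
    proof (intro bex_cong refl)
      fix a assume "a \<in> A"
      then have "y - a \<in> span B" using y convex_bodyD(3)[OF A] by (auto intro: span_diff)
      then show "norm (s *\<^sub>R b + (y - a)) \<le> r \<longleftrightarrow> \<bar>s\<bar> \<le> r \<and> norm (y - a) \<le> sqrt (r\<^sup>2 - s\<^sup>2)"
        by (intro norm_add_orthogonal ortho nb r)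
    qed
    also have "\<dots> \<longleftrightarrow> \<bar>s\<bar> \<le> r \<and> y \<in> parallel_body B A (sqrt (r\<^sup>2 - s\<^sup>2))"
    proof (cases "\<bar>s\<bar> \<le> r")
      case True
      then have "sqrt (r\<^sup>2 - s\<^sup>2) \<ge> 0" using r by (simp add: power2_le_iff_abs_le)
      then show ?thesis using mem_parallel_body_iff[OF convex_bodyD(3)[OF A] y] by auto
    qed auto
    finally show ?thesis .
  qed
  have main: "measure (span_lborel ?B) (parallel_body ?B A r) =
        (\<Sum>k\<le>card ?B. unit_ball_vol (real (card ?B - k)) * V k * r ^ (card ?B - k))" if r: "r \<ge> 0" for r
  proof -
    note [measurable] = convex_bodyD(6)[OF P]
    have "emeasure (span_lborel ?B) (parallel_body ?B A r) =
      (\<integral>\<^sup>+s. (\<integral>\<^sup>+y. indicator (parallel_body ?B A r) (s *\<^sub>R b + y) \<partial>span_lborel B) \<partial>lborel)"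
      by (subst nn_integral_span_lborel_insert'[OF fin b, symmetric]) auto
    also have "\<dots> = (\<integral>\<^sup>+s. (\<Sum>k\<le>?d. ennreal (V k) * (indicator {-r..r} s * ennreal (unit_ball_vol (real (?d - k)) * sqrt (r\<^sup>2 - s\<^sup>2) ^ (?d - k)))) \<partial>lborel)"
    proof (rule nn_integral_cong)
      fix s :: real
      have "(\<integral>\<^sup>+y. indicator (parallel_body ?B A r) (s *\<^sub>R b + y) \<partial>span_lborel B)
        = (\<integral>\<^sup>+y. indicator {-r..r} s * indicator (parallel_body B A (sqrt (r\<^sup>2 - s\<^sup>2))) y \<partial>span_lborel B)"
        by (rule nn_integral_cong_AE, use AE_span_lborel[OF oB] in eventually_elim)
           (use mem r in \<open>auto simp: indicator_def abs_le_iff\<close>)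
      also have "\<dots> = indicator {-r..r} s * emeasure (span_lborel B) (parallel_body B A (sqrt (r\<^sup>2 - s\<^sup>2)))"
        using convex_bodyD(6)[OF P'] by (subst nn_integral_cmult_indicator) auto
      also have "\<dots> = (\<Sum>k\<le>?d. ennreal (V k) * (indicator {-r..r} s * ennreal (unit_ball_vol (real (?d - k)) * sqrt (r\<^sup>2 - s\<^sup>2) ^ (?d - k))))"
      proof (cases "s \<in> {-r..r}")
        case True
        then have q: "sqrt (r\<^sup>2 - s\<^sup>2) \<ge> 0" using r by (simp add: power2_le_iff_abs_le abs_le_iff)
        have "emeasure (span_lborel B) (parallel_body B A (sqrt (r\<^sup>2 - s\<^sup>2))) =
          ennreal (\<Sum>k\<le>?d. unit_ball_vol (real (?d - k)) * V k * sqrt (r\<^sup>2 - s\<^sup>2) ^ (?d - k))"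
          using S[unfolded steiner_formula_iff[OF oB A]] q
          by (subst emeasure_span_lborel_eq_measure[OF oB convex_bodyD(4)[OF P']]) simp
        also have "\<dots> = (\<Sum>k\<le>?d. ennreal (unit_ball_vol (real (?d - k)) * V k * sqrt (r\<^sup>2 - s\<^sup>2) ^ (?d - k)))"
          using V q by (intro sum_ennreal[symmetric] mult_nonneg_nonneg zero_le_power) auto
        also have "\<dots> = (\<Sum>k\<le>?d. ennreal (V k) * ennreal (unit_ball_vol (real (?d - k)) * sqrt (r\<^sup>2 - s\<^sup>2) ^ (?d - k)))"
          using V q by (intro sum.cong refl) (subst ennreal_mult[symmetric], auto simp: mult_ac intro!: mult_nonneg_nonneg zero_le_power)
        finally show ?thesis using True by simp
      qed simp
      finally show "(\<integral>\<^sup>+y. indicator (parallel_body ?B A r) (s *\<^sub>R b + y) \<partial>span_lborel B) =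
        (\<Sum>k\<le>?d. ennreal (V k) * (indicator {-r..r} s * ennreal (unit_ball_vol (real (?d - k)) * sqrt (r\<^sup>2 - s\<^sup>2) ^ (?d - k))))" .
    qed
    also have "\<dots> = (\<Sum>k\<le>?d. (\<integral>\<^sup>+s. ennreal (V k) * (indicator {-r..r} s * ennreal (unit_ball_vol (real (?d - k)) * sqrt (r\<^sup>2 - s\<^sup>2) ^ (?d - k))) \<partial>lborel))"
      by (rule nn_integral_sum) measurable
    also have "\<dots> = (\<Sum>k\<le>?d. ennreal (V k) * ennreal (unit_ball_vol (real (Suc (?d - k))) * r ^ Suc (?d - k)))"
    proof (intro sum.cong refl)
      fix k
      have "(\<integral>\<^sup>+s. ennreal (V k) * (indicator {-r..r} s * ennreal (unit_ball_vol (real (?d - k)) * sqrt (r\<^sup>2 - s\<^sup>2) ^ (?d - k))) \<partial>lborel)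
        = ennreal (V k) * (\<integral>\<^sup>+s. indicator {-r..r} s * ennreal (unit_ball_vol (real (?d - k)) * sqrt (r\<^sup>2 - s\<^sup>2) ^ (?d - k)) \<partial>lborel)"
        by (rule nn_integral_cmult) measurable
      then show "(\<integral>\<^sup>+s. ennreal (V k) * (indicator {-r..r} s * ennreal (unit_ball_vol (real (?d - k)) * sqrt (r\<^sup>2 - s\<^sup>2) ^ (?d - k))) \<partial>lborel)
        = ennreal (V k) * ennreal (unit_ball_vol (real (Suc (?d - k))) * r ^ Suc (?d - k))"
        by (simp only: ball_slices[OF r])
    qed
    also have "\<dots> = (\<Sum>k\<le>?d. ennreal (unit_ball_vol (real (Suc ?d - k)) * V k * r ^ (Suc ?d - k)))"
      using V r by (intro sum.cong refl) (subst ennreal_mult[symmetric], auto simp: mult_ac Suc_diff_le)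
    also have "\<dots> = ennreal (\<Sum>k\<le>?d. unit_ball_vol (real (Suc ?d - k)) * V k * r ^ (Suc ?d - k))"
      using V r by (intro sum_ennreal mult_nonneg_nonneg zero_le_power) auto
    \<comment> \<open>The sum gains the index k = d + 1, whose coefficient vanishes by the second
      clause of the Steiner formula.\<close>
    also have "(\<Sum>k\<le>?d. unit_ball_vol (real (Suc ?d - k)) * V k * r ^ (Suc ?d - k)) =
       (\<Sum>k\<le>card ?B. unit_ball_vol (real (card ?B - k)) * V k * r ^ (card ?B - k))"
      using S unfolding card steiner_formula_def by simp
    finally show ?thesis
      unfolding measure_def using V r
      by (simp only:) (intro enn2real_ennreal sum_nonneg mult_nonneg_nonneg zero_le_power, auto)
  qed
  have "V k = 0" if "k > card ?B" for k using S that card unfolding steiner_formula_def by simp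
  then show ?thesis unfolding steiner_formula_iff[OF o A'] using main by blast
qed

lemma steiner_formula_nonneg:
  fixes B :: "'a::{real_inner,polish_space} set"
  assumes "orthonormal_set B" "convex_body B A" "A \<noteq> {}" "steiner_formula B A V"
  shows "V k \<ge> 0"
proof -
  obtain W where W: "\<forall>K. convex_body B K \<and> K \<noteq> {} \<longrightarrow> steiner_formula B K (\<lambda>k. W k K) \<and>
     (\<forall>k. W k K \<ge> 0) \<and> (\<forall>K' k. convex_body B K' \<and> K \<subseteq> K' \<longrightarrow> W k K \<le> W k K')"
    using steiner_formula_exists[OF assms(1)] by (rule exE)
  have "V = (\<lambda>k. W k A)"
    using steiner_formula_unique[OF assms(1,2,4)] W assms by blast
  then show ?thesis using W assms by simp
qed

text \<open>C is extended to an orthonormal basis D of span B, one vector at a time. Replacing D by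
  B is harmless, as the formula depends on the basis only through its span.\<close>

lemma steiner_formula_span_mono:
  fixes B C :: "'a::{real_inner,polish_space} set"
  assumes C: "orthonormal_set C" and B: "orthonormal_set B" and sub: "span C \<subseteq> span B"
    and A: "convex_body C A" "A \<noteq> {}" and S: "steiner_formula C A V"
  shows "steiner_formula B A V"
proof -
  obtain D where D: "orthonormal_set D" "C \<subseteq> D" "span D = span (C \<union> B)"
    using orthonormal_extension_span[OF C] orthonormal_setD(1)[OF B] by blast
  have spn: "span D = span B"
  proof -
    have "C \<subseteq> span B" using sub span_superset by blast
    then show ?thesis unfolding D(3) by (intro span_eq[THEN iffD2]) (auto intro: span_base)
  qed
  have "steiner_formula (C \<union> F) A V" if "finite F" "F \<subseteq> D - C" for F
    using that
  proof (induction F rule: finite_induct)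
    case empty
    then show ?case using S by simp
  next
    case (insert b F)
    have o: "orthonormal_set (insert b (C \<union> F))"
      using insert by (intro orthonormal_set_subset[OF D(1)]) (use D in auto)
    have "convex_body (C \<union> F) A" using A span_mono[of C "C \<union> F"] unfolding convex_body_def by blast
    moreover have "V k \<ge> 0" for k by (rule steiner_formula_nonneg[OF C A S])
    ultimately have "steiner_formula (insert b (C \<union> F)) A V"
      using insert by (intro steiner_formula_insert[OF o]) auto
    then show ?case by simp
  qed
  then have "steiner_formula (C \<union> (D - C)) A V" using orthonormal_setD(1)[OF D(1)] by blast
  then have "steiner_formula D A V" using D(2) by (simp add: Un_absorb1)
  moreover have "convex_body D A" "convex_body B A"
    using A(1) sub spn unfolding convex_body_def by auto
  moreover have "parallel_body D A r = parallel_body B A r" for r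
    unfolding parallel_body_def spn ..
  ultimately show ?thesis
    using span_lborel_eq[OF D(1) B spn] orthonormal_card_eq[OF D(1) B spn]
    by (simp add: steiner_formula_iff D(1) B)
qed

lemma orthonormal_basis_of_finite_dimensional:
  assumes "finite_dimensional L"
  shows "\<exists>C. orthonormal_set C \<and> span C = span L"
proof -
  obtain F where F: "finite F" "L \<subseteq> span F" using assms by (auto simp: finite_dimensional_def)
  obtain I where I: "I \<subseteq> L" "independent I" "L \<subseteq> span I" by (rule maximal_independent_subset)
  have "finite I" using independent_span_bound[OF F(1) I(2)] I F by auto
  moreover have "span I = span L"
    using I by (intro span_eq[THEN iffD2]) (auto intro: span_base)
  ultimately show ?thesis using orthonormal_basis_span by metis
qed

text \<open>This justifies the definite description. The span of L is the smallest ambient space: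
  there the coefficients are unique, and from there the formula spreads to every larger one.\<close>

lemma steiner_formula_fin_intrinsic_volume:
  fixes B :: "'a::{real_inner,polish_space} set"
  assumes B: "orthonormal_set B" and L: "convex_body B L" "L \<noteq> {}"
  shows "steiner_formula B L (\<lambda>k. fin_intrinsic_volume k L)"
proof -
  let ?P = "\<lambda>V. \<forall>B. orthonormal_set B \<and> L \<subseteq> span B \<longrightarrow> steiner_formula B L V"
  have fd: "finite_dimensional L"
    using L orthonormal_setD(1)[OF B] by (auto simp: finite_dimensional_def convex_body_def)
  obtain C where C: "orthonormal_set C" "span C = span L"
    using orthonormal_basis_of_finite_dimensional[OF fd] by blast
  have LC: "convex_body C L"
    using L C unfolding convex_body_def by (simp add: span_superset)
  obtain W where "\<forall>K. convex_body C K \<and> K \<noteq> {} \<longrightarrow> steiner_formula C K (\<lambda>k. W k K) \<and>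
     (\<forall>k. W k K \<ge> 0) \<and> (\<forall>K' k. convex_body C K' \<and> K \<subseteq> K' \<longrightarrow> W k K \<le> W k K')"
    using steiner_formula_exists[OF C(1)] by (rule exE)
  then have W: "steiner_formula C L (\<lambda>k. W k L)" using LC L by blast
  have "\<exists>!V. ?P V"
  proof (rule ex1I[of _ "\<lambda>k. W k L"])
    show "?P (\<lambda>k. W k L)"
    proof (intro allI impI)
      fix D assume D: "orthonormal_set D \<and> L \<subseteq> span D"
      then have "span C \<subseteq> span D" unfolding C by (simp add: span_minimal)
      then show "steiner_formula D L (\<lambda>k. W k L)"
        using steiner_formula_span_mono[OF C(1) _ _ LC L(2) W] D by blast
    qed
    fix V assume "?P V"
    then show "V = (\<lambda>k. W k L)"
      using steiner_formula_unique[OF C(1) LC _ W] C convex_bodyD(3)[OF LC] by blast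
  qed
  then have "?P (THE V. ?P V)" by (rule theI')
  then show ?thesis using B convex_bodyD(3)[OF L(1)] unfolding fin_intrinsic_volume_def by blast
qed

lemma fin_intrinsic_volume_eqI:
  fixes B :: "'a::{real_inner,polish_space} set"
  assumes "orthonormal_set B" "convex_body B L" "L \<noteq> {}" "steiner_formula B L V"
  shows "fin_intrinsic_volume k L = V k"
  using steiner_formula_unique[OF assms(1,2) steiner_formula_fin_intrinsic_volume[OF assms(1-3)] assms(4)]
  by (rule fun_cong)

section \<open>Properties of the intrinsic volumes\<close>

lemma fin_intrinsic_volume_mono:
  fixes B :: "'a::{real_inner,polish_space} set"
  assumes B: "orthonormal_set B" and L: "convex_body B L" "L \<noteq> {}" "convex_body B L'" "L \<subseteq> L'"
  shows "fin_intrinsic_volume k L \<le> fin_intrinsic_volume k L'"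
proof -
  obtain W where W: "\<forall>K. convex_body B K \<and> K \<noteq> {} \<longrightarrow> steiner_formula B K (\<lambda>k. W k K) \<and>
     (\<forall>k. W k K \<ge> 0) \<and> (\<forall>K' k. convex_body B K' \<and> K \<subseteq> K' \<longrightarrow> W k K \<le> W k K')"
    using steiner_formula_exists[OF B] by (rule exE)
  have "L' \<noteq> {}" using L by auto
  have "fin_intrinsic_volume k L = W k L" using W L by (intro fin_intrinsic_volume_eqI[OF B L(1,2)]) blast
  moreover have "fin_intrinsic_volume k L' = W k L'"
    using W L \<open>L' \<noteq> {}\<close> by (intro fin_intrinsic_volume_eqI[OF B L(3)]) blast+
  ultimately show ?thesis using W L by simp
qed

lemma fin_intrinsic_volume_nonneg:
  fixes B :: "'a::{real_inner,polish_space} set"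
  assumes "orthonormal_set B" "convex_body B L" "L \<noteq> {}"
  shows "0 \<le> fin_intrinsic_volume k L"
  by (rule steiner_formula_nonneg[OF assms steiner_formula_fin_intrinsic_volume[OF assms]])

lemma fin_intrinsic_volume_eq_0:
  fixes B :: "'a::{real_inner,polish_space} set"
  assumes "orthonormal_set B" "convex_body B L" "L \<noteq> {}" "k > card B"
  shows "fin_intrinsic_volume k L = 0"
  using steiner_formula_fin_intrinsic_volume[OF assms(1-3)] assms(4) unfolding steiner_formula_def by blast

lemma steiner_formula_measure:
  fixes B :: "'a::{real_inner,polish_space} set"
  assumes "orthonormal_set B" "convex_body B L" "L \<noteq> {}" "r \<ge> 0"
  shows "measure (span_lborel B) (parallel_body B L r) =
    (\<Sum>k\<le>card B. unit_ball_vol (real (card B - k)) * fin_intrinsic_volume k L * r ^ (card B - k))"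
  using steiner_formula_fin_intrinsic_volume[OF assms(1-3)] assms(4)
  unfolding steiner_formula_iff[OF assms(1,2)] by blast

lemma fin_intrinsic_volume_top:
  fixes B :: "'a::{real_inner,polish_space} set"
  assumes "orthonormal_set B" "convex_body B L" "L \<noteq> {}"
  shows "fin_intrinsic_volume (card B) L = measure (span_lborel B) L"
proof -
  have "parallel_body B L 0 = L" by (auto simp: parallel_body_def intro!: exI[of _ 0] span_zero)
  moreover have "(\<Sum>k\<le>card B. unit_ball_vol (real (card B - k)) * fin_intrinsic_volume k L * 0 ^ (card B - k))
     = (\<Sum>k\<le>card B. if k = card B then fin_intrinsic_volume k L else 0)"
    by (rule sum.cong) auto
  ultimately show ?thesis using steiner_formula_measure[OF assms, of 0] by simp
qed

text \<open>V_0 belongs to the highest power of r. The parallel body lies in a ball of radius R + r;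
  divide by \<open>r ^ d\<close> and let r grow. The bound supplies the constant term of the
  exponential estimate.\<close>

lemma fin_intrinsic_volume_0_le_1:
  fixes B :: "'a::{real_inner,polish_space} set"
  assumes B: "orthonormal_set B" and L: "convex_body B L" "L \<noteq> {}"
  shows "fin_intrinsic_volume 0 L \<le> 1"
proof -
  let ?d = "card B"
  obtain R where R: "R > 0" "L \<subseteq> cball 0 R"
    using convex_bodyD(4)[OF L(1)] by (auto simp: bounded_pos subset_iff)
  have "fin_intrinsic_volume 0 L \<le> (R * (1 / r) + 1) ^ ?d" if r: "r > 0" for r
  proof -
    have "unit_ball_vol (real ?d) * fin_intrinsic_volume 0 L * r ^ ?d \<le>
      (\<Sum>k\<le>?d. unit_ball_vol (real (?d - k)) * fin_intrinsic_volume k L * r ^ (?d - k))"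
      using member_le_sum[of 0 "{..?d}" "\<lambda>k. unit_ball_vol (real (?d - k)) * fin_intrinsic_volume k L * r ^ (?d - k)"]
        fin_intrinsic_volume_nonneg[OF B L] r by simp
    also have "\<dots> = measure (span_lborel B) (parallel_body B L r)"
      using steiner_formula_measure[OF B L] r by simp
    also have "\<dots> \<le> unit_ball_vol ?d * (R + r) ^ ?d"
    proof (rule measure_span_lborel_le[OF B])
      show "parallel_body B L r \<subseteq> cball 0 (R + r)"
      proof
        fix x assume "x \<in> parallel_body B L r"
        then obtain a u where x: "x = a + r *\<^sub>R u" "a \<in> L" "norm u \<le> 1" by (auto simp: parallel_body_def)
        then have "norm x \<le> R + r"
          unfolding x(1) using x(2) R(2) r by (intro norm_triangle_mono) (auto simp: mult_left_le)
        then show "x \<in> cball 0 (R + r)" by simp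
      qed
    qed (use convex_bodyD(6)[OF convex_body_parallel_body[OF B L(1)]] R r in auto)
    finally have "fin_intrinsic_volume 0 L * r ^ ?d \<le> (R + r) ^ ?d"
      using unit_ball_vol_pos[of "real ?d"] by (simp only: mult.assoc mult_le_cancel_left_pos of_nat_0_le_iff)
    also have "(R + r) ^ ?d = (R * (1 / r) + 1) ^ ?d * r ^ ?d"
      using r by (simp add: power_mult_distrib[symmetric] distrib_right)
    finally show ?thesis using r by simp
  qed
  moreover have "((\<lambda>r::real. (R * (1 / r) + 1) ^ ?d) \<longlongrightarrow> (R * 0 + 1) ^ ?d) at_top"
    by (intro tendsto_intros tendsto_divide_0[OF tendsto_const] filterlim_at_top_imp_at_infinity filterlim_ident)
  ultimately have "fin_intrinsic_volume 0 L \<le> (R * 0 + 1) ^ ?d"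
    by (intro tendsto_lowerbound[where f = "\<lambda>r. (R * (1 / r) + 1) ^ ?d" and F = at_top])
       (auto intro: eventually_mono[OF eventually_gt_at_top[of 0]])
  then show ?thesis by simp
qed

section \<open>Translations and dilations\<close>

lemma measure_span_lborel_translate:
  fixes B :: "'a::{real_inner,polish_space} set"
  assumes B: "orthonormal_set B" and a: "a \<in> span B" and A: "A \<in> sets borel" "(+) a ` A \<in> sets borel"
  shows "measure (span_lborel B) ((+) a ` A) = measure (span_lborel B) A"
proof -
  have "emeasure (span_lborel B) ((+) a ` A) = (\<integral>\<^sup>+x. indicator ((+) a ` A) x \<partial>span_lborel B)"
    using A by simp
  also have "\<dots> = (\<integral>\<^sup>+x. indicator ((+) a ` A) (a + x) \<partial>span_lborel B)"
    using A a orthonormal_setD(1)[OF B] by (intro nn_integral_span_lborel_translate[symmetric]) auto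
  also have "\<dots> = (\<integral>\<^sup>+x. indicator A x \<partial>span_lborel B)"
    by (rule nn_integral_cong) (auto simp: indicator_def)
  also have "\<dots> = emeasure (span_lborel B) A" using A by simp
  finally show ?thesis by (simp add: measure_def)
qed

lemma convex_body_translate:
  assumes "convex_body B L" "a \<in> span B" shows "convex_body B ((+) a ` L)"
  using assms unfolding convex_body_def
  by (auto intro!: compact_translation convex_translation span_add)

lemma fin_intrinsic_volume_translate:
  fixes B :: "'a::{real_inner,polish_space} set"
  assumes B: "orthonormal_set B" and L: "convex_body B L" "L \<noteq> {}" and a: "a \<in> span B"
  shows "fin_intrinsic_volume k ((+) a ` L) = fin_intrinsic_volume k L"
proof (rule fin_intrinsic_volume_eqI[OF B convex_body_translate[OF L(1) a]])
  have eq: "parallel_body B ((+) a ` L) r = (+) a ` parallel_body B L r" for r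
    unfolding parallel_body_def by (force simp: add.assoc image_iff)
  have P: "convex_body B (parallel_body B L r)" for r by (rule convex_body_parallel_body[OF B L(1)])
  have "measure (span_lborel B) (parallel_body B ((+) a ` L) r) = measure (span_lborel B) (parallel_body B L r)" for r
    unfolding eq using convex_bodyD(6)[OF P] convex_bodyD(6)[OF convex_body_translate[OF P a]]
    by (intro measure_span_lborel_translate[OF B a])
  then show "steiner_formula B ((+) a ` L) (\<lambda>k. fin_intrinsic_volume k L)"
    using steiner_formula_fin_intrinsic_volume[OF B L]
    by (simp add: steiner_formula_iff B L convex_body_translate a)
qed (use L in simp)

lemma nn_integral_span_lborel_scale:
  fixes f :: "'a::{real_inner,polish_space} \<Rightarrow> ennreal"
  assumes "finite B" "f \<in> borel_measurable borel" "s > 0"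
  shows "(\<integral>\<^sup>+x. f x \<partial>span_lborel B) = ennreal (s ^ card B) * (\<integral>\<^sup>+x. f (s *\<^sub>R x) \<partial>span_lborel B)"
  using assms
proof (induction B arbitrary: f rule: finite_induct)
  case empty
  then show ?case by (simp add: nn_integral_span_lborel_empty)
next
  case (insert b B)
  note [measurable] = insert.prems(1)
  have "(\<integral>\<^sup>+x. f x \<partial>span_lborel (insert b B)) = (\<integral>\<^sup>+y. (\<integral>\<^sup>+t. f (t *\<^sub>R b + y) \<partial>lborel) \<partial>span_lborel B)"
    by (rule nn_integral_span_lborel_insert[OF insert.hyps]) measurable
  also have "\<dots> = (\<integral>\<^sup>+y. ennreal s * (\<integral>\<^sup>+t. f ((s * t) *\<^sub>R b + y) \<partial>lborel) \<partial>span_lborel B)"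
    using insert.prems(2)
    by (intro nn_integral_cong, subst nn_integral_real_affine[where c = s and t = 0]) auto
  also have "\<dots> = ennreal s * (\<integral>\<^sup>+y. (\<integral>\<^sup>+t. f ((s * t) *\<^sub>R b + y) \<partial>lborel) \<partial>span_lborel B)"
    by (rule nn_integral_cmult) measurable
  also have "(\<integral>\<^sup>+y. (\<integral>\<^sup>+t. f ((s * t) *\<^sub>R b + y) \<partial>lborel) \<partial>span_lborel B)
    = ennreal (s ^ card B) * (\<integral>\<^sup>+y. (\<integral>\<^sup>+t. f ((s * t) *\<^sub>R b + s *\<^sub>R y) \<partial>lborel) \<partial>span_lborel B)"
    by (rule insert.IH[OF _ insert.prems(2)]) measurable
  also have "(\<integral>\<^sup>+y. (\<integral>\<^sup>+t. f ((s * t) *\<^sub>R b + s *\<^sub>R y) \<partial>lborel) \<partial>span_lborel B) = (\<integral>\<^sup>+x. f (s *\<^sub>R x) \<partial>span_lborel (insert b B))"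
    by (subst nn_integral_span_lborel_insert[OF insert.hyps]) (measurable, simp add: scaleR_add_right)
  finally show ?case using insert by (simp add: ennreal_mult mult.assoc)
qed

lemma convex_body_scale:
  assumes "convex_body B L" shows "convex_body B ((*\<^sub>R) s ` L)"
  using assms unfolding convex_body_def
  by (auto intro!: compact_scaling convex_scaling span_scale)

lemma measure_span_lborel_scale:
  fixes B :: "'a::{real_inner,polish_space} set"
  assumes B: "orthonormal_set B" and A: "convex_body B A" and s: "s > 0"
  shows "measure (span_lborel B) ((*\<^sub>R) s ` A) = s ^ card B * measure (span_lborel B) A"
proof -
  note sA = convex_body_scale[OF A, of s]
  have "emeasure (span_lborel B) ((*\<^sub>R) s ` A) = (\<integral>\<^sup>+x. indicator ((*\<^sub>R) s ` A) x \<partial>span_lborel B)"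
    using convex_bodyD(6)[OF sA] by simp
  also have "\<dots> = ennreal (s ^ card B) * (\<integral>\<^sup>+x. indicator ((*\<^sub>R) s ` A) (s *\<^sub>R x) \<partial>span_lborel B)"
    using convex_bodyD(6)[OF sA] s orthonormal_setD(1)[OF B] by (intro nn_integral_span_lborel_scale) auto
  also have "(\<integral>\<^sup>+x. indicator ((*\<^sub>R) s ` A) (s *\<^sub>R x) \<partial>span_lborel B) = (\<integral>\<^sup>+x. indicator A x \<partial>span_lborel B)"
    using s by (intro nn_integral_cong) (auto simp: indicator_def)
  also have "\<dots> = emeasure (span_lborel B) A" using convex_bodyD(6)[OF A] by simp
  finally show ?thesis using s by (simp add: measure_def enn2real_mult)
qed

text \<open>The parallel body of s L at distance r is s times that of L at distance r / s. Of the
  Jacobian \<open>s ^ d\<close> the part \<open>s ^ (d - k)\<close> cancels against the power of r /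
  s, and \<open>s ^ k\<close> remains.\<close>

lemma fin_intrinsic_volume_scale:
  fixes B :: "'a::{real_inner,polish_space} set"
  assumes B: "orthonormal_set B" and L: "convex_body B L" "L \<noteq> {}" and s: "s > 0"
  shows "fin_intrinsic_volume k ((*\<^sub>R) s ` L) = s ^ k * fin_intrinsic_volume k L"
proof (rule fin_intrinsic_volume_eqI[OF B convex_body_scale[OF L(1)]])
  let ?d = "card B"
  have eq: "parallel_body B ((*\<^sub>R) s ` L) r = (*\<^sub>R) s ` parallel_body B L (r / s)" for r
  proof -
    have "s *\<^sub>R l + r *\<^sub>R u = s *\<^sub>R (l + (r / s) *\<^sub>R u)" for l u :: 'a
      using s by (simp add: algebra_simps)
    then show ?thesis unfolding parallel_body_def by (auto simp: image_iff) metis+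
  qed
  have "measure (span_lborel B) (parallel_body B ((*\<^sub>R) s ` L) r) =
     (\<Sum>k\<le>?d. unit_ball_vol (real (?d - k)) * (s ^ k * fin_intrinsic_volume k L) * r ^ (?d - k))" if "r \<ge> 0" for r
  proof -
    have "measure (span_lborel B) (parallel_body B ((*\<^sub>R) s ` L) r) =
       s ^ ?d * (\<Sum>k\<le>?d. unit_ball_vol (real (?d - k)) * fin_intrinsic_volume k L * (r / s) ^ (?d - k))"
      unfolding eq measure_span_lborel_scale[OF B convex_body_parallel_body[OF B L(1)] s]
      using steiner_formula_measure[OF B L, of "r / s"] s that by simp
    also have "\<dots> = (\<Sum>k\<le>?d. unit_ball_vol (real (?d - k)) * (s ^ k * fin_intrinsic_volume k L) * r ^ (?d - k))"
      unfolding sum_distrib_left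
    proof (rule sum.cong)
      fix k assume "k \<in> {..?d}"
      then have "s ^ ?d = s ^ k * s ^ (?d - k)" by (simp add: power_add[symmetric])
      then show "s ^ ?d * (unit_ball_vol (real (?d - k)) * fin_intrinsic_volume k L * (r / s) ^ (?d - k)) =
         unit_ball_vol (real (?d - k)) * (s ^ k * fin_intrinsic_volume k L) * r ^ (?d - k)"
        using s by (simp add: power_divide)
    qed simp
    finally show ?thesis .
  qed
  then show "steiner_formula B ((*\<^sub>R) s ` L) (\<lambda>k. s ^ k * fin_intrinsic_volume k L)"
    using fin_intrinsic_volume_eq_0[OF B L]
    by (simp add: steiner_formula_iff B L convex_body_scale)
qed (use L in simp)

section \<open>The Wills functional\<close>

lemma span_lborel_Fubini:
  fixes f :: "'a::{real_inner,polish_space} \<Rightarrow> real \<Rightarrow> ennreal"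
  assumes "finite B" and [measurable]: "case_prod f \<in> borel_measurable (borel \<Otimes>\<^sub>M borel)"
  shows "(\<integral>\<^sup>+x. (\<integral>\<^sup>+r. f x r \<partial>lborel) \<partial>span_lborel B) = (\<integral>\<^sup>+r. (\<integral>\<^sup>+x. f x r \<partial>span_lborel B) \<partial>lborel)"
proof -
  interpret product_sigma_finite "\<lambda>_::'a. lborel :: real measure" by standard
  interpret P: sigma_finite_measure "\<Pi>\<^sub>M c\<in>B. (lborel :: real measure)"
    by (rule sigma_finite) fact
  interpret pair_sigma_finite lborel "\<Pi>\<^sub>M c\<in>B. (lborel :: real measure)" by standard
  have 1: "(\<lambda>x. \<integral>\<^sup>+r. f x r \<partial>lborel) \<in> borel_measurable borel" by measurable
  have 2: "(\<lambda>x. f x r) \<in> borel_measurable borel" for r by measurable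
  show ?thesis
    unfolding nn_integral_span_lborel[OF 1] nn_integral_span_lborel[OF 2]
    by (rule Fubini') measurable
qed

text \<open>The weight is minus the derivative of the Gaussian, so its tail integral is the value at
  \<rho>. Thus a Gaussian weight in the distance is a superposition of indicators of parallel
  bodies.\<close>

lemma exp_layer_cake:
  assumes "\<rho> \<ge> 0"
  shows "ennreal (exp (- pi * \<rho>\<^sup>2)) = (\<integral>\<^sup>+r. ennreal (2 * pi * r * exp (- pi * r\<^sup>2)) * indicator {\<rho>..} r \<partial>lborel)"
proof -
  have "filterlim (\<lambda>r::real. - pi * r\<^sup>2) at_bot at_top" by real_asymp
  then have lim: "((\<lambda>r::real. - exp (- pi * r\<^sup>2)) \<longlongrightarrow> - 0) at_top"
    by (intro tendsto_minus filterlim_compose[OF exp_at_bot])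
  have "(\<integral>\<^sup>+r. ennreal (2 * pi * r * exp (- pi * r\<^sup>2)) * indicator {\<rho>..} r \<partial>lborel) = ennreal (0 - - exp (- pi * \<rho>\<^sup>2))"
    by (rule nn_integral_FTC_atLeast[where F = "\<lambda>r. - exp (- pi * r\<^sup>2)"])
       (use assms lim in \<open>auto intro!: derivative_eq_intros simp: algebra_simps\<close>)
  then show ?thesis by simp
qed

lemma infdist_borel_measurable [measurable]: "(\<lambda>x. infdist x L) \<in> borel_measurable borel"
  by (intro borel_measurable_continuous_onI continuous_intros)

text \<open>The factor pi makes the Gaussian integrate to 1 in every direction orthogonal to the
  span of L, so that the value does not change with the ambient B
  (\<open>wills_ambient\<close>).\<close>

definition wills :: "'a::{real_inner,polish_space} set \<Rightarrow> 'a set \<Rightarrow> ennreal" where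
  "wills B L = (\<integral>\<^sup>+x. ennreal (exp (- pi * (infdist x L)\<^sup>2)) \<partial>span_lborel B)"

lemma wills_layer_cake:
  fixes B :: "'a::{real_inner,polish_space} set"
  assumes B: "orthonormal_set B" and L: "convex_body B L" "L \<noteq> {}"
  shows "wills B L = (\<integral>\<^sup>+r. ennreal (2 * pi * r * exp (- pi * r\<^sup>2)) * indicator {0..} r *
     emeasure (span_lborel B) (parallel_body B L r) \<partial>lborel)"
proof -
  let ?g = "\<lambda>r. ennreal (2 * pi * r * exp (- pi * r\<^sup>2))"
  have "wills B L = (\<integral>\<^sup>+x. (\<integral>\<^sup>+r. ?g r * indicator {r. infdist x L \<le> r} r \<partial>lborel) \<partial>span_lborel B)"
    unfolding wills_def by (subst exp_layer_cake) (auto simp: infdist_nonneg atLeast_def)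
  also have "\<dots> = (\<integral>\<^sup>+r. (\<integral>\<^sup>+x. ?g r * indicator {r. infdist x L \<le> r} r \<partial>span_lborel B) \<partial>lborel)"
  proof (rule span_lborel_Fubini)
    show "finite B" using orthonormal_setD[OF B] by simp
    show "(\<lambda>(x, r). ?g r * indicator {r. infdist x L \<le> r} r) \<in> borel_measurable (borel \<Otimes>\<^sub>M borel)"
      unfolding indicator_def by measurable
  qed
  also have "\<dots> = (\<integral>\<^sup>+r. ?g r * indicator {0..} r * emeasure (span_lborel B) (parallel_body B L r) \<partial>lborel)"
  proof (rule nn_integral_cong)
    fix r :: real
    show "(\<integral>\<^sup>+x. ?g r * indicator {r. infdist x L \<le> r} r \<partial>span_lborel B) = ?g r * indicator {0..} r * emeasure (span_lborel B) (parallel_body B L r)"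
    proof (cases "r \<ge> 0")
      case True
      have "(\<integral>\<^sup>+x. ?g r * indicator {r. infdist x L \<le> r} r \<partial>span_lborel B) = (\<integral>\<^sup>+x. ?g r * indicator (parallel_body B L r) x \<partial>span_lborel B)"
        by (rule nn_integral_cong_AE, use AE_span_lborel[OF B] in eventually_elim)
           (auto simp: parallel_body_infdist[OF L True] indicator_def)
      then show ?thesis
        using True convex_bodyD(6)[OF convex_body_parallel_body[OF B L(1)]] by (simp add: nn_integral_cmult_indicator)
    next
      case False
      then have "\<not> infdist x L \<le> r" for x using infdist_nonneg[of x L] by linarith
      then show ?thesis using False by simp
    qed
  qed
  finally show ?thesis .
qed

lemma nn_integral_exp_pi_square: "(\<integral>\<^sup>+s. ennreal (exp (- pi * s\<^sup>2)) \<partial>lborel) = 1"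
proof -
  \<comment> \<open>The integrand is the normal density of variance 1 / (2 pi).\<close>
  define \<sigma> where "\<sigma> = 1 / sqrt (2 * pi)"
  have s: "\<sigma> > 0" "\<sigma>\<^sup>2 = 1 / (2 * pi)" by (auto simp: \<sigma>_def power_divide)
  have "normal_density 0 \<sigma> x = exp (- pi * x\<^sup>2)" for x
    unfolding normal_density_def s(2) by (simp add: field_simps)
  then show ?thesis
    using nn_integral_eq_integral[OF integrable_normal_density[OF s(1), of 0]] integral_normal_density[OF s(1), of 0]
    by simp
qed

text \<open>Pythagoras: squared distances split, so the two components of a nearest point can be
  chosen independently.\<close>

lemma infdist_orthogonal_sum:
  fixes A :: "'a::real_inner set"
  assumes I: "compact I" "I \<noteq> {}" and A: "compact A" "A \<noteq> {}"
    and v: "norm v = 1" "\<And>z. z \<in> A \<Longrightarrow> inner v z = 0" "inner v y = 0"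
  shows "(infdist (s *\<^sub>R v + y) {t *\<^sub>R v + z |t z. t \<in> I \<and> z \<in> A})\<^sup>2 = (infdist s I)\<^sup>2 + (infdist y A)\<^sup>2"
proof -
  let ?S = "{t *\<^sub>R v + z |t z. t \<in> I \<and> z \<in> A}"
  have d: "(dist (s *\<^sub>R v + y) (t *\<^sub>R v + z))\<^sup>2 = (dist s t)\<^sup>2 + (dist y z)\<^sup>2" if "z \<in> A" for t z
  proof -
    have "s *\<^sub>R v + y - (t *\<^sub>R v + z) = (s - t) *\<^sub>R v + (y - z)" by (simp add: algebra_simps)
    moreover have "inner v (y - z) = 0" using v that by (simp add: inner_diff_right)
    then have "(norm ((s - t) *\<^sub>R v + (y - z)))\<^sup>2 = (s - t)\<^sup>2 + (norm (y - z))\<^sup>2"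
      by (rule norm_add_orthogonal_squared[OF _ v(1)])
    ultimately show ?thesis by (simp only: dist_norm real_norm_def power2_abs)
  qed
  have S: "compact ?S" "?S \<noteq> {}"
  proof -
    have "?S = (\<lambda>(t, z). t *\<^sub>R v + z) ` (I \<times> A)" by auto
    then show "compact ?S"
      using I A by (auto intro!: compact_continuous_image compact_Times continuous_intros simp: case_prod_unfold)
    show "?S \<noteq> {}" using I A by blast
  qed
  obtain t0 where t0: "t0 \<in> I" "infdist s I = dist s t0" using infdist_attained[OF I] by blast
  obtain z0 where z0: "z0 \<in> A" "infdist y A = dist y z0" using infdist_attained[OF A] by blast
  obtain p where p: "p \<in> ?S" "infdist (s *\<^sub>R v + y) ?S = dist (s *\<^sub>R v + y) p" using infdist_attained[OF S] by blast
  then obtain t z where tz: "p = t *\<^sub>R v + z" "t \<in> I" "z \<in> A" by blast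
  show ?thesis
  proof (rule antisym)
    have "t0 *\<^sub>R v + z0 \<in> ?S" using t0 z0 by blast
    then have "infdist (s *\<^sub>R v + y) ?S \<le> dist (s *\<^sub>R v + y) (t0 *\<^sub>R v + z0)" by (rule infdist_le)
    then have "(infdist (s *\<^sub>R v + y) ?S)\<^sup>2 \<le> (dist (s *\<^sub>R v + y) (t0 *\<^sub>R v + z0))\<^sup>2"
      by (intro power_mono infdist_nonneg)
    then show "(infdist (s *\<^sub>R v + y) ?S)\<^sup>2 \<le> (infdist s I)\<^sup>2 + (infdist y A)\<^sup>2"
      unfolding d[OF z0(1)] t0 z0 .
    have "(infdist s I)\<^sup>2 \<le> (dist s t)\<^sup>2" "(infdist y A)\<^sup>2 \<le> (dist y z)\<^sup>2"
      using tz by (auto intro!: power_mono infdist_le infdist_nonneg)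
    then show "(infdist s I)\<^sup>2 + (infdist y A)\<^sup>2 \<le> (infdist (s *\<^sub>R v + y) ?S)\<^sup>2"
      unfolding p(2) tz(1) d[OF tz(3)] by linarith
  qed
qed

lemma infdist_interval:
  fixes a s :: real
  assumes "a \<ge> 0"
  shows "infdist s {0..a} = (if s < 0 then - s else if s \<le> a then 0 else s - a)"
proof -
  obtain t where t: "t \<in> {0..a}" "infdist s {0..a} = dist s t"
    using infdist_attained[of "{0..a}" s] assms by auto
  have "infdist s {0..a} \<le> dist s u" if "u \<in> {0..a}" for u using that by (rule infdist_le)
  from this[of 0] this[of s] this[of a] t assms show ?thesis by (auto simp: dist_real_def)
qed

text \<open>The integrand is a Gaussian cut at 0 whose halves are moved apart by a: the halves
  recombine to 1, and the gap contributes its length.\<close>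

lemma nn_integral_exp_infdist_interval:
  fixes a :: real
  assumes a: "a \<ge> 0"
  shows "(\<integral>\<^sup>+s. ennreal (exp (- pi * (infdist s {0..a})\<^sup>2)) \<partial>lborel) = ennreal (1 + a)"
proof -
  let ?g = "\<lambda>s::real. ennreal (exp (- pi * s\<^sup>2))"
  have "(\<integral>\<^sup>+s. ennreal (exp (- pi * (infdist s {0..a})\<^sup>2)) \<partial>lborel) =
     (\<integral>\<^sup>+s. ?g s * indicator {..<0} s + indicator {0..a} s + ?g (s - a) * indicator {a<..} s \<partial>lborel)"
    by (intro nn_integral_cong) (use a in \<open>auto simp: infdist_interval indicator_def\<close>)
  also have "\<dots> = (\<integral>\<^sup>+s. ?g s * indicator {..<0} s \<partial>lborel) + ennreal a + (\<integral>\<^sup>+s. ?g (s - a) * indicator {a<..} s \<partial>lborel)"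
    using a by (simp add: nn_integral_add)
  also have "(\<integral>\<^sup>+s. ?g (s - a) * indicator {a<..} s \<partial>lborel) = (\<integral>\<^sup>+s. ?g s * indicator {0<..} s \<partial>lborel)"
    by (subst nn_integral_real_affine[where c = 1 and t = a]) (auto intro!: nn_integral_cong simp: indicator_def)
  also have "(\<integral>\<^sup>+s. ?g s * indicator {..<0} s \<partial>lborel) + ennreal a + (\<integral>\<^sup>+s. ?g s * indicator {0<..} s \<partial>lborel)
     = ((\<integral>\<^sup>+s. ?g s * indicator {..<0} s \<partial>lborel) + (\<integral>\<^sup>+s. ?g s * indicator {0<..} s \<partial>lborel)) + ennreal a" by (simp add: add_ac)
  also have "(\<integral>\<^sup>+s. ?g s * indicator {..<0} s \<partial>lborel) + (\<integral>\<^sup>+s. ?g s * indicator {0<..} s \<partial>lborel) =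
     (\<integral>\<^sup>+s. ?g s * indicator {..<0} s + ?g s * indicator {0<..} s \<partial>lborel)" by (rule nn_integral_add[symmetric]) auto
  also have "\<dots> = (\<integral>\<^sup>+s. ?g s \<partial>lborel)"
    by (rule nn_integral_cong_AE, use AE_lborel_singleton[of "0::real"] in eventually_elim) (auto simp: indicator_def)
  also have "\<dots> = 1" by (rule nn_integral_exp_pi_square)
  finally show ?thesis using a by (simp add: ennreal_plus)
qed

text \<open>Since the squared distance splits, the Gaussian weight is a product and Fubini separates
  the two integrals. This is the source of the product formula for boxes.\<close>

lemma wills_orthogonal_sum:
  fixes B :: "'a::{real_inner,polish_space} set"
  assumes o: "orthonormal_set (insert v B)" and v: "v \<notin> B" and A: "convex_body B A" "A \<noteq> {}" and a: "a \<ge> 0"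
  shows "wills (insert v B) {t *\<^sub>R v + z |t z. t \<in> {0..a} \<and> z \<in> A} = ennreal (1 + a) * wills B A"
proof -
  let ?S = "{t *\<^sub>R v + z |t z. t \<in> {0..a} \<and> z \<in> A}"
  have oB: "orthonormal_set B" using orthonormal_set_subset[OF o] by blast
  have ortho: "inner v y = 0" if "y \<in> span B" for y
    using v orthonormal_setD(3)[OF o, of v] by (intro inner_span_orthogonal[of B v y] that) auto
  have "wills (insert v B) ?S = (\<integral>\<^sup>+y. (\<integral>\<^sup>+s. ennreal (exp (- pi * (infdist (s *\<^sub>R v + y) ?S)\<^sup>2)) \<partial>lborel) \<partial>span_lborel B)"
    unfolding wills_def using orthonormal_setD(1)[OF oB] v by (intro nn_integral_span_lborel_insert) measurable
  also have "\<dots> = (\<integral>\<^sup>+y. (\<integral>\<^sup>+s. ennreal (exp (- pi * (infdist s {0..a})\<^sup>2)) * ennreal (exp (- pi * (infdist y A)\<^sup>2)) \<partial>lborel) \<partial>span_lborel B)"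
  proof (rule nn_integral_cong_AE, use AE_span_lborel[OF oB] in eventually_elim)
    case (elim y)
    have "(infdist (s *\<^sub>R v + y) ?S)\<^sup>2 = (infdist s {0..a})\<^sup>2 + (infdist y A)\<^sup>2" for s
      by (rule infdist_orthogonal_sum)
         (use a A convex_bodyD[OF A(1)] orthonormal_setD(2)[OF o] ortho elim in auto)
    then show ?case by (simp add: ennreal_mult[symmetric] exp_add[symmetric] algebra_simps)
  qed
  also have "\<dots> = (\<integral>\<^sup>+y. ennreal (1 + a) * ennreal (exp (- pi * (infdist y A)\<^sup>2)) \<partial>span_lborel B)"
    unfolding nn_integral_exp_infdist_interval[OF a, symmetric]
    by (intro nn_integral_cong nn_integral_multc) measurable
  also have "\<dots> = ennreal (1 + a) * wills B A"
    unfolding wills_def by (rule nn_integral_cmult) measurable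
  finally show ?thesis .
qed

text \<open>The point is treated as a degenerate box: each basis vector adds a segment of length 0,
  that is, a factor 1.\<close>

lemma wills_origin:
  fixes B :: "'a::{real_inner,polish_space} set"
  assumes "orthonormal_set B"
  shows "wills B {0} = 1"
proof -
  have "finite B" using orthonormal_setD(1)[OF assms] .
  then show ?thesis
    using assms
  proof (induction B rule: finite_induct)
    case empty
    then show ?case by (simp add: wills_def nn_integral_span_lborel_empty)
  next
    case (insert b B)
    have "{t *\<^sub>R b + z |t z. t \<in> {0..0::real} \<and> z \<in> {0}} = {0}" by auto
    moreover have "convex_body B {0}" by (simp add: convex_body_def span_zero)
    moreover have "orthonormal_set B" using orthonormal_set_subset[OF insert.prems] by blast
    ultimately show ?case
      using wills_orthogonal_sum[OF insert.prems insert.hyps(2), of "{0}" 0] insert.IH by simp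
  qed
qed

text \<open>\<open>wills B {0}\<close> evaluated in two ways: its value is 1, and the layer cake
  formula turns it into this moment.\<close>

lemma ball_volume_moment:
  fixes B :: "'a::{real_inner,polish_space} set"
  assumes B: "orthonormal_set B"
  shows "(\<integral>\<^sup>+r. ennreal (2 * pi * r * exp (- pi * r\<^sup>2)) * indicator {0..} r *
     ennreal (unit_ball_vol (real (card B)) * r ^ card B) \<partial>lborel) = 1"
proof -
  have L: "convex_body B {0}" by (simp add: convex_body_def span_zero)
  have "emeasure (span_lborel B) (parallel_body B {0} r) = ennreal (unit_ball_vol (real (card B)) * r ^ card B)" if r: "r \<ge> 0" for r
  proof -
    have "emeasure (span_lborel B) (parallel_body B {0} r) = emeasure (span_lborel B) (cball 0 r)"
    proof (rule emeasure_eq_AE)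
      show "AE x in span_lborel B. x \<in> parallel_body B {0} r \<longleftrightarrow> x \<in> cball 0 r"
        using AE_span_lborel[OF B] by eventually_elim (simp add: parallel_body_infdist[OF L _ r] infdist_def)
      show "parallel_body B {0} r \<in> sets (span_lborel B)"
        using convex_bodyD(6)[OF convex_body_parallel_body[OF B L]] by simp
    qed simp
    then show ?thesis using emeasure_span_lborel_cball[OF B r] by simp
  qed
  then have "wills B {0} = (\<integral>\<^sup>+r. ennreal (2 * pi * r * exp (- pi * r\<^sup>2)) * indicator {0..} r *
     ennreal (unit_ball_vol (real (card B)) * r ^ card B) \<partial>lborel)"
    unfolding wills_layer_cake[OF B L insert_not_empty] by (intro nn_integral_cong) (auto simp: indicator_def)
  then show ?thesis using wills_origin[OF B] by simp
qed

text \<open>Insert the Steiner polynomial into the layer cake formula. The ball volume in each term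
  has moment 1, so only the intrinsic volumes remain.\<close>

lemma wills_eq_sum:
  fixes B :: "'a::{real_inner,polish_space} set"
  assumes B: "orthonormal_set B" and L: "convex_body B L" "L \<noteq> {}"
  shows "wills B L = ennreal (\<Sum>k\<le>card B. fin_intrinsic_volume k L)"
proof -
  let ?d = "card B" and ?V = "\<lambda>k. fin_intrinsic_volume k L"
  let ?g = "\<lambda>r. ennreal (2 * pi * r * exp (- pi * r\<^sup>2)) * indicator {0..} r"
  note V = fin_intrinsic_volume_nonneg[OF B L]
  have "wills B L = (\<integral>\<^sup>+r. (\<Sum>k\<le>?d. ennreal (?V k) * (?g r * ennreal (unit_ball_vol (real (?d - k)) * r ^ (?d - k)))) \<partial>lborel)"
    unfolding wills_layer_cake[OF B L]
  proof (rule nn_integral_cong)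
    fix r :: real
    show "?g r * emeasure (span_lborel B) (parallel_body B L r) = (\<Sum>k\<le>?d. ennreal (?V k) * (?g r * ennreal (unit_ball_vol (real (?d - k)) * r ^ (?d - k))))"
    proof (cases "r \<ge> 0")
      case True
      have "emeasure (span_lborel B) (parallel_body B L r) = ennreal (\<Sum>k\<le>?d. unit_ball_vol (real (?d - k)) * ?V k * r ^ (?d - k))"
        using steiner_formula_measure[OF B L True]
          emeasure_span_lborel_eq_measure[OF B convex_bodyD(4)[OF convex_body_parallel_body[OF B L(1)]]] by simp
      also have "\<dots> = (\<Sum>k\<le>?d. ennreal (unit_ball_vol (real (?d - k)) * ?V k * r ^ (?d - k)))"
        using V True by (intro sum_ennreal[symmetric] mult_nonneg_nonneg zero_le_power) auto
      also have "\<dots> = (\<Sum>k\<le>?d. ennreal (?V k) * ennreal (unit_ball_vol (real (?d - k)) * r ^ (?d - k)))"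
        using V True by (intro sum.cong refl) (subst ennreal_mult[symmetric], auto simp: mult_ac)
      finally show ?thesis by (simp add: sum_distrib_left mult_ac)
    qed simp
  qed
  also have "\<dots> = (\<Sum>k\<le>?d. (\<integral>\<^sup>+r. ennreal (?V k) * (?g r * ennreal (unit_ball_vol (real (?d - k)) * r ^ (?d - k))) \<partial>lborel))"
    by (rule nn_integral_sum) measurable
  also have "\<dots> = (\<Sum>k\<le>?d. ennreal (?V k))"
  proof (rule sum.cong)
    fix k assume "k \<in> {..?d}"
    \<comment> \<open>The moment formula speaks of a dimension realised by an orthonormal set; a
      subset of B with d - k elements realises the one at hand.\<close>
    obtain C where C: "C \<subseteq> B" "card C = ?d - k"
      by (rule obtain_subset_with_card_n[OF diff_le_self])
    have "(\<integral>\<^sup>+r. ennreal (?V k) * (?g r * ennreal (unit_ball_vol (real (?d - k)) * r ^ (?d - k))) \<partial>lborel)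
      = ennreal (?V k) * (\<integral>\<^sup>+r. ?g r * ennreal (unit_ball_vol (real (?d - k)) * r ^ (?d - k)) \<partial>lborel)"
      by (rule nn_integral_cmult) measurable
    then show "(\<integral>\<^sup>+r. ennreal (?V k) * (?g r * ennreal (unit_ball_vol (real (?d - k)) * r ^ (?d - k))) \<partial>lborel) = ennreal (?V k)"
      using ball_volume_moment[OF orthonormal_set_subset[OF B C(1)]] C(2) by simp
  qed simp
  also have "\<dots> = ennreal (\<Sum>k\<le>?d. ?V k)" using V by (intro sum_ennreal) auto
  finally show ?thesis .
qed

section \<open>The Prekopa--Leindler inequality for midpoints\<close>

lemma brunn_minkowski_bounded:
  fixes A B D :: "real set"
  assumes [measurable]: "A \<in> sets borel" "B \<in> sets borel" "D \<in> sets borel"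
    and ne: "A \<noteq> {}" "B \<noteq> {}" and bd: "bounded A" "bounded B"
    and D: "\<And>x y. x \<in> A \<Longrightarrow> y \<in> B \<Longrightarrow> x + y \<in> D"
  shows "emeasure lborel A + emeasure lborel B \<le> emeasure lborel D"
proof (rule ennreal_le_epsilon)
  fix e :: real assume e: "e > 0"
  have bdd: "bdd_above A" "bdd_below B" using bd bounded_imp_bdd_above bounded_imp_bdd_below by auto
  \<comment> \<open>up to \<open>e / 2\<close>, the set \<open>A + b\<close> lies to the left and \<open>a + B\<close> to the right of \<open>a + b\<close>\<close>
  obtain a where a: "a \<in> A" "Sup A - e / 2 < a" using less_cSupD[OF ne(1), of "Sup A - e / 2"] e by auto
  obtain b where b: "b \<in> B" "b < Inf B + e / 2" using cInf_lessD[OF ne(2), of "Inf B + e / 2"] e by auto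
  have upA: "x \<le> Sup A" if "x \<in> A" for x using cSup_upper[OF that bdd(1)] .
  have loB: "Inf B \<le> x" if "x \<in> B" for x using cInf_lower[OF that bdd(2)] .
  have "emeasure lborel A \<le> emeasure lborel ((A \<inter> {..<a}) \<union> {a..Sup A})"
    using upA by (intro emeasure_mono) auto
  also have "\<dots> \<le> emeasure lborel (A \<inter> {..<a}) + emeasure lborel {a..Sup A}"
    by (intro emeasure_subadditive) auto
  also have "emeasure lborel {a..Sup A} \<le> ennreal (e / 2)"
    using upA[OF a(1)] a(2) by (simp add: ennreal_leI)
  finally have 1: "emeasure lborel A \<le> emeasure lborel (A \<inter> {..<a}) + ennreal (e / 2)" by simp
  have "emeasure lborel B \<le> emeasure lborel ((B \<inter> {b..}) \<union> {Inf B..b})"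
    using loB by (intro emeasure_mono) auto
  also have "\<dots> \<le> emeasure lborel (B \<inter> {b..}) + emeasure lborel {Inf B..b}"
    by (intro emeasure_subadditive) auto
  also have "emeasure lborel {Inf B..b} \<le> ennreal (e / 2)"
    using loB[OF b(1)] b(2) by (simp add: ennreal_leI)
  finally have 2: "emeasure lborel B \<le> emeasure lborel (B \<inter> {b..}) + ennreal (e / 2)" by simp
  have vimage: "(\<lambda>x. c + x) -` X \<in> sets borel" if "X \<in> sets borel" for X and c :: real
    by (rule measurable_sets_borel[OF _ that]) measurable
  have shift: "emeasure lborel X = emeasure lborel ((\<lambda>x. c + x) -` X)" if [measurable]: "X \<in> sets borel" for X and c :: real
  proof -
    note [measurable] = vimage[OF that]
    have "emeasure lborel X = (\<integral>\<^sup>+x. indicator X (c + 1 * x) \<partial>lborel)"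
      by (subst nn_integral_indicator[symmetric], simp, subst nn_integral_real_affine[where c = 1 and t = c]) auto
    also have "\<dots> = (\<integral>\<^sup>+x. indicator ((\<lambda>x. c + x) -` X) x \<partial>lborel)"
      by (rule nn_integral_cong) (simp add: indicator_def)
    also have "\<dots> = emeasure lborel ((\<lambda>x. c + x) -` X)" by simp
    finally show ?thesis .
  qed
  have "emeasure lborel (A \<inter> {..<a}) \<le> emeasure lborel ((\<lambda>x. b + x) -` (D \<inter> {..<a + b}))"
  proof (rule emeasure_mono)
    show "A \<inter> {..<a} \<subseteq> (\<lambda>x. b + x) -` (D \<inter> {..<a + b})" using D[OF _ b(1)] by (auto simp: add.commute)
    show "(\<lambda>x. b + x) -` (D \<inter> {..<a + b}) \<in> sets lborel"
      unfolding sets_lborel by (rule vimage) measurable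
  qed
  then have 3: "emeasure lborel (A \<inter> {..<a}) \<le> emeasure lborel (D \<inter> {..<a + b})"
    by (subst shift[of _ b]) auto
  have "emeasure lborel (B \<inter> {b..}) \<le> emeasure lborel ((\<lambda>x. a + x) -` (D \<inter> {a + b..}))"
  proof (rule emeasure_mono)
    show "B \<inter> {b..} \<subseteq> (\<lambda>x. a + x) -` (D \<inter> {a + b..})" using D[OF a(1)] by auto
    show "(\<lambda>x. a + x) -` (D \<inter> {a + b..}) \<in> sets lborel"
      unfolding sets_lborel by (rule vimage) measurable
  qed
  then have 4: "emeasure lborel (B \<inter> {b..}) \<le> emeasure lborel (D \<inter> {a + b..})"
    by (subst shift[of _ a]) auto
  have "emeasure lborel (D \<inter> {..<a + b}) + emeasure lborel (D \<inter> {a + b..}) = emeasure lborel ((D \<inter> {..<a + b}) \<union> (D \<inter> {a + b..}))"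
    by (rule plus_emeasure) auto
  also have "(D \<inter> {..<a + b}) \<union> (D \<inter> {a + b..}) = D" by auto
  finally have 5: "emeasure lborel (D \<inter> {..<a + b}) + emeasure lborel (D \<inter> {a + b..}) = emeasure lborel D" .
  have "emeasure lborel A + emeasure lborel B \<le> (emeasure lborel (D \<inter> {..<a + b}) + ennreal (e / 2)) + (emeasure lborel (D \<inter> {a + b..}) + ennreal (e / 2))"
    by (intro add_mono order_trans[OF 1] order_trans[OF 2] 3 4 order_refl)
  also have "\<dots> = emeasure lborel D + (ennreal (e / 2) + ennreal (e / 2))" unfolding 5[symmetric] by (simp add: add_ac)
  also have "ennreal (e / 2) + ennreal (e / 2) = ennreal e" using e by (simp flip: ennreal_plus)
  finally show "emeasure lborel A + emeasure lborel B \<le> emeasure lborel D + ennreal e" .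
qed

lemma emeasure_SUP_truncate:
  fixes A :: "real set"
  assumes [measurable]: "A \<in> sets borel"
  shows "emeasure lborel A = (SUP n. emeasure lborel (A \<inter> {- real n..real n}))"
proof -
  have "(SUP n. emeasure lborel (A \<inter> {- real n..real n})) = emeasure lborel (\<Union>n. A \<inter> {- real n..real n})"
    by (rule SUP_emeasure_incseq) (auto simp: incseq_def)
  also have "(\<Union>n. A \<inter> {- real n..real n}) = A"
  proof -
    have "\<exists>n. x \<in> {- real n..real n}" for x
      using real_arch_simple[of "\<bar>x\<bar>"] by (auto simp: abs_le_iff minus_le_iff)
    then show ?thesis by auto
  qed
  finally show ?thesis by simp
qed

text \<open>C doubled contains A + B. The bounded case applies to truncations of A and B, which
  increase to the full sets.\<close>

lemma brunn_minkowski_midpoint: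
  fixes A B C :: "real set"
  assumes [measurable]: "A \<in> sets borel" "B \<in> sets borel" "C \<in> sets borel"
    and ne: "A \<noteq> {}" "B \<noteq> {}"
    and C: "\<And>x y. x \<in> A \<Longrightarrow> y \<in> B \<Longrightarrow> (x + y) / 2 \<in> C"
  shows "emeasure lborel A + emeasure lborel B \<le> 2 * emeasure lborel C"
proof -
  define D where "D = (\<lambda>z. z / 2) -` C"
  have D [measurable]: "D \<in> sets borel" unfolding D_def by (rule measurable_sets_borel[of _ borel]) measurable
  have "emeasure lborel D = (\<integral>\<^sup>+z. indicator D z \<partial>lborel)" by simp
  also have "\<dots> = ennreal \<bar>2\<bar> * (\<integral>\<^sup>+z. indicator D (0 + 2 * z) \<partial>lborel)"
    by (rule nn_integral_real_affine) auto
  also have "(\<integral>\<^sup>+z. indicator D (0 + 2 * z) \<partial>lborel) = (\<integral>\<^sup>+z. indicator C z \<partial>lborel)"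
    by (rule nn_integral_cong) (simp add: D_def indicator_def)
  finally have eD: "emeasure lborel D = 2 * emeasure lborel C" by simp
  obtain a b where ab: "a \<in> A" "b \<in> B" using ne by auto
  define A' where "A' n = A \<inter> {- real n..real n}" for n
  define B' where "B' n = B \<inter> {- real n..real n}" for n
  have [measurable]: "A' n \<in> sets borel" "B' n \<in> sets borel" for n by (auto simp: A'_def B'_def)
  obtain N where N: "\<bar>a\<bar> \<le> real N" "\<bar>b\<bar> \<le> real N"
    using real_arch_simple[of "max \<bar>a\<bar> \<bar>b\<bar>"] by auto
  have inc: "incseq (\<lambda>n. emeasure lborel (A' n))" "incseq (\<lambda>n. emeasure lborel (B' n))"
    by (auto intro!: incseq_SucI emeasure_mono simp: A'_def B'_def)
  have bound: "emeasure lborel (A' n) + emeasure lborel (B' n) \<le> emeasure lborel D" for n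
  proof -
    \<comment> \<open>Truncation at N or later keeps the chosen points a and b, so that both pieces
      are nonempty.\<close>
    let ?m = "max n N"
    have "emeasure lborel (A' n) + emeasure lborel (B' n) \<le> emeasure lborel (A' ?m) + emeasure lborel (B' ?m)"
      using inc by (intro add_mono) (auto simp: incseq_def)
    also have "\<dots> \<le> emeasure lborel D"
    proof (rule brunn_minkowski_bounded)
      show "A' ?m \<noteq> {}" "B' ?m \<noteq> {}"
      proof -
        have "a \<in> A' ?m" "b \<in> B' ?m" using ab N by (auto simp: A'_def B'_def abs_le_iff max_def)
        then show "A' ?m \<noteq> {}" "B' ?m \<noteq> {}" by auto
      qed
      show "bounded (A' ?m)" "bounded (B' ?m)" by (auto simp: A'_def B'_def intro: bounded_subset[OF bounded_closed_interval])
      show "x + y \<in> D" if "x \<in> A' ?m" "y \<in> B' ?m" for x y using C that by (auto simp: D_def A'_def B'_def)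
    qed auto
    finally show ?thesis .
  qed
  have "emeasure lborel A + emeasure lborel B = (SUP n. emeasure lborel (A' n) + emeasure lborel (B' n))"
    unfolding emeasure_SUP_truncate[of A, simplified] emeasure_SUP_truncate[of B, simplified]
    using inc unfolding A'_def B'_def by (subst ennreal_SUP_add) auto
  also have "\<dots> \<le> emeasure lborel D" using bound by (rule SUP_least)
  finally show ?thesis unfolding eD .
qed

text \<open>Levels are confined to (0, 1). A function bounded by 1 loses no mass this way, whereas
  one that exceeds 1, as h may below, loses some; hence an equality for the former and an inequality
  in general.\<close>

lemma layer_cake_unit:
  fixes f :: "real \<Rightarrow> real"
  assumes [measurable]: "f \<in> borel_measurable borel"
  shows "(\<integral>\<^sup>+t. indicator {0<..<1} t * emeasure lborel {x. t < f x} \<partial>lborel) \<le> (\<integral>\<^sup>+x. ennreal (f x) \<partial>lborel)"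
    and "(\<And>x. f x \<le> 1) \<Longrightarrow> (\<integral>\<^sup>+x. ennreal (f x) \<partial>lborel) = (\<integral>\<^sup>+t. indicator {0<..<1} t * emeasure lborel {x. t < f x} \<partial>lborel)"
proof -
  have "(\<integral>\<^sup>+t. indicator {0<..<1} t * emeasure lborel {x. t < f x} \<partial>lborel) =
     (\<integral>\<^sup>+t. (\<integral>\<^sup>+x. indicator {0<..<1} t * indicator {x. t < f x} x \<partial>lborel) \<partial>lborel)"
    by (intro nn_integral_cong) (simp add: nn_integral_cmult_indicator)
  also have "\<dots> = (\<integral>\<^sup>+x. (\<integral>\<^sup>+t. indicator {0<..<1} t * indicator {x. t < f x} x \<partial>lborel) \<partial>lborel)"
  proof (rule lborel_pair.Fubini')
    show "(\<lambda>(x, t). indicator {0<..<1} t * indicator {x. t < f x} x :: ennreal) \<in> borel_measurable (lborel \<Otimes>\<^sub>M lborel)"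
      unfolding indicator_def by measurable
  qed
  also have "\<dots> = (\<integral>\<^sup>+x. emeasure lborel {0<..<min 1 (f x)} \<partial>lborel)"
  proof (rule nn_integral_cong)
    fix x
    have "(\<integral>\<^sup>+t. indicator {0<..<1} t * indicator {x. t < f x} x \<partial>lborel) = (\<integral>\<^sup>+t. indicator {0<..<min 1 (f x)} t \<partial>lborel)"
      by (rule nn_integral_cong) (auto simp: indicator_def)
    then show "(\<integral>\<^sup>+t. indicator {0<..<1} t * indicator {x. t < f x} x \<partial>lborel) = emeasure lborel {0<..<min 1 (f x)}" by simp
  qed
  finally have eq: "(\<integral>\<^sup>+t. indicator {0<..<1} t * emeasure lborel {x. t < f x} \<partial>lborel) = (\<integral>\<^sup>+x. emeasure lborel {0<..<min 1 (f x)} \<partial>lborel)" .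
  have em: "emeasure lborel {0<..<min 1 (f x)} = ennreal (min 1 (f x))" for x
    by (cases "0 \<le> min 1 (f x)") (auto simp: ennreal_neg)
  show "(\<integral>\<^sup>+t. indicator {0<..<1} t * emeasure lborel {x. t < f x} \<partial>lborel) \<le> (\<integral>\<^sup>+x. ennreal (f x) \<partial>lborel)"
    unfolding eq em by (intro nn_integral_mono ennreal_leI) simp
  assume "\<And>x. f x \<le> 1"
  then show "(\<integral>\<^sup>+x. ennreal (f x) \<partial>lborel) = (\<integral>\<^sup>+t. indicator {0<..<1} t * emeasure lborel {x. t < f x} \<partial>lborel)"
    unfolding eq em by (intro nn_integral_cong) (simp add: min_absorb2)
qed

text \<open>With suprema equal to 1, the superlevel sets of f and g at each t < 1 are nonempty, as
  Brunn-Minkowski demands, and their midpoints lie in the superlevel set of h. Integrating over t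
  gives an additive inequality.\<close>

lemma prekopa_leindler_normalised:
  fixes f g h :: "real \<Rightarrow> real"
  assumes [measurable]: "f \<in> borel_measurable borel" "g \<in> borel_measurable borel" "h \<in> borel_measurable borel"
    and le: "\<And>x. f x \<le> 1" "\<And>x. g x \<le> 1" and h: "\<And>x. h x \<ge> 0"
    and sup: "\<And>t. t < 1 \<Longrightarrow> \<exists>x. t < f x" "\<And>t. t < 1 \<Longrightarrow> \<exists>x. t < g x"
    and fgh: "\<And>x y. f x * g y \<le> (h ((x + y) / 2))\<^sup>2"
  shows "(\<integral>\<^sup>+x. ennreal (f x) \<partial>lborel) + (\<integral>\<^sup>+x. ennreal (g x) \<partial>lborel) \<le> 2 * (\<integral>\<^sup>+x. ennreal (h x) \<partial>lborel)"
proof -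
  have "(\<integral>\<^sup>+x. ennreal (f x) \<partial>lborel) + (\<integral>\<^sup>+x. ennreal (g x) \<partial>lborel) =
     (\<integral>\<^sup>+t. indicator {0<..<1} t * emeasure lborel {x. t < f x} + indicator {0<..<1} t * emeasure lborel {x. t < g x} \<partial>lborel)"
    by (subst (1 2) layer_cake_unit(2)) (use le in \<open>auto simp: nn_integral_add\<close>)
  also have "\<dots> \<le> (\<integral>\<^sup>+t. 2 * (indicator {0<..<1} t * emeasure lborel {x. t < h x}) \<partial>lborel)"
  proof (rule nn_integral_mono)
    fix t :: real
    show "indicator {0<..<1} t * emeasure lborel {x. t < f x} + indicator {0<..<1} t * emeasure lborel {x. t < g x}
       \<le> 2 * (indicator {0<..<1} t * emeasure lborel {x. t < h x})"
    proof (cases "t \<in> {0<..<1}")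
      case True
      have "emeasure lborel {x. t < f x} + emeasure lborel {x. t < g x} \<le> 2 * emeasure lborel {x. t < h x}"
      proof (rule brunn_minkowski_midpoint)
        show "{x. t < f x} \<noteq> {}" "{x. t < g x} \<noteq> {}" using sup[of t] True by auto
        fix x y assume xy: "x \<in> {x. t < f x}" "y \<in> {x. t < g x}"
        have "t\<^sup>2 < f x * g y" unfolding power2_eq_square using xy True by (intro mult_strict_mono) auto
        then have "t\<^sup>2 < (h ((x + y) / 2))\<^sup>2" using fgh[of x y] by linarith
        then show "(x + y) / 2 \<in> {x. t < h x}" using power2_less_imp_less h by blast
      qed measurable
      then show ?thesis using True by simp
    qed simp
  qed
  also have "\<dots> = 2 * (\<integral>\<^sup>+t. indicator {0<..<1} t * emeasure lborel {x. t < h x} \<partial>lborel)"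
    by (rule nn_integral_cmult) measurable
  also have "\<dots> \<le> 2 * (\<integral>\<^sup>+x. ennreal (h x) \<partial>lborel)"
    by (intro mult_left_mono layer_cake_unit(1)) auto
  finally show ?thesis .
qed

lemma ennreal_am_gm: "4 * (a * b) \<le> (a + b)\<^sup>2" for a b :: ennreal
proof (cases "a = \<infinity> \<or> b = \<infinity>")
  case True
  then show ?thesis by (auto simp: power2_eq_square ennreal_top_mult ennreal_mult_top)
next
  case False
  then obtain x y where xy: "a = ennreal x" "b = ennreal y" "x \<ge> 0" "y \<ge> 0"
    by (metis ennreal_cases infinity_ennreal_def)
  have "4 * (x * y) \<le> (x + y)\<^sup>2"
    using zero_le_power2[of "x - y"] by (simp add: power2_eq_square algebra_simps)
  then have "ennreal (4 * (x * y)) \<le> ennreal ((x + y)\<^sup>2)" by (rule ennreal_leI)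
  then show ?thesis using xy by (simp add: ennreal_mult ennreal_power[symmetric] ennreal_plus[symmetric] del: ennreal_plus)
qed

text \<open>Divide f and g by their suprema p and q, and h by sqrt (p q). The arithmetic-geometric
  mean inequality turns the additive bound into a bound for the product, in which the normalising
  factors cancel.\<close>

lemma prekopa_leindler_bounded:
  fixes f g h :: "real \<Rightarrow> real"
  assumes [measurable]: "f \<in> borel_measurable borel" "g \<in> borel_measurable borel" "h \<in> borel_measurable borel"
    and nn: "\<And>x. f x \<ge> 0" "\<And>x. g x \<ge> 0" "\<And>x. h x \<ge> 0" and bd: "\<And>x. f x \<le> M" "\<And>x. g x \<le> M"
    and fgh: "\<And>x y. f x * g y \<le> (h ((x + y) / 2))\<^sup>2"
  shows "(\<integral>\<^sup>+x. ennreal (f x) \<partial>lborel) * (\<integral>\<^sup>+x. ennreal (g x) \<partial>lborel) \<le> (\<integral>\<^sup>+x. ennreal (h x) \<partial>lborel)\<^sup>2"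
proof -
  define p q where "p = (SUP x. f x)" and "q = (SUP x. g x)"
  have bdd: "bdd_above (range f)" "bdd_above (range g)" using bd by (auto simp: bdd_above_def)
  have up: "f x \<le> p" "g x \<le> q" for x unfolding p_def q_def by (auto intro: cSUP_upper bdd)
  show ?thesis
  proof (cases "p > 0 \<and> q > 0")
    case False
    then have "(\<forall>x. f x = 0) \<or> (\<forall>x. g x = 0)" using up nn by (meson antisym linorder_not_less order_trans)
    then show ?thesis by auto
  next
    case True
    define s where "s = sqrt (p * q)"
    have s: "s > 0" "s\<^sup>2 = p * q" using True by (auto simp: s_def)
    let ?F = "\<integral>\<^sup>+x. ennreal (f x) \<partial>lborel" and ?G = "\<integral>\<^sup>+x. ennreal (g x) \<partial>lborel" and ?H = "\<integral>\<^sup>+x. ennreal (h x) \<partial>lborel"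
    have scale: "(\<integral>\<^sup>+x. ennreal (u x / c) \<partial>lborel) = ennreal (1 / c) * (\<integral>\<^sup>+x. ennreal (u x) \<partial>lborel)"
      if c: "c > 0" and [measurable]: "u \<in> borel_measurable borel" for u :: "real \<Rightarrow> real" and c
    proof -
      have "(\<integral>\<^sup>+x. ennreal (u x / c) \<partial>lborel) = (\<integral>\<^sup>+x. ennreal (1 / c) * ennreal (u x) \<partial>lborel)"
        using c by (intro nn_integral_cong) (simp add: ennreal_mult'[symmetric])
      also have "\<dots> = ennreal (1 / c) * (\<integral>\<^sup>+x. ennreal (u x) \<partial>lborel)" by (rule nn_integral_cmult) measurable
      finally show ?thesis .
    qed
    have "(\<integral>\<^sup>+x. ennreal (f x / p) \<partial>lborel) + (\<integral>\<^sup>+x. ennreal (g x / q) \<partial>lborel) \<le> 2 * (\<integral>\<^sup>+x. ennreal (h x / s) \<partial>lborel)"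
    proof (rule prekopa_leindler_normalised)
      show "\<exists>x. t < f x / p" if "t < 1" for t
        using less_cSUP_iff[OF _ bdd(1), of "t * p"] that True unfolding p_def[symmetric] by (auto simp: pos_less_divide_eq)
      show "\<exists>x. t < g x / q" if "t < 1" for t
        using less_cSUP_iff[OF _ bdd(2), of "t * q"] that True unfolding q_def[symmetric] by (auto simp: pos_less_divide_eq)
      show "f x / p * (g y / q) \<le> (h ((x + y) / 2) / s)\<^sup>2" for x y
      proof -
        have "f x / p * (g y / q) = f x * g y / s\<^sup>2" by (simp add: s)
        also have "\<dots> \<le> (h ((x + y) / 2))\<^sup>2 / s\<^sup>2" using fgh by (intro divide_right_mono) auto
        finally show ?thesis by (simp add: power_divide)
      qed
    qed (use up True nn s in \<open>auto simp: divide_le_eq_1\<close>)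
    then have le: "ennreal (1 / p) * ?F + ennreal (1 / q) * ?G \<le> 2 * (ennreal (1 / s) * ?H)"
      using True s by (simp add: scale)
    have "4 * (ennreal (1 / p) * ?F * (ennreal (1 / q) * ?G)) \<le> (ennreal (1 / p) * ?F + ennreal (1 / q) * ?G)\<^sup>2"
      by (rule ennreal_am_gm)
    also have "\<dots> \<le> (2 * (ennreal (1 / s) * ?H))\<^sup>2" using le by (intro power_mono) auto
    finally have "4 * (ennreal (1 / p) * ennreal (1 / q) * (?F * ?G)) \<le> 4 * (ennreal (1 / s) * ennreal (1 / s) * ?H\<^sup>2)"
      by (simp add: power2_eq_square mult_ac)
    moreover have "ennreal (1 / p) * ennreal (1 / q) = ennreal (1 / s\<^sup>2)" "ennreal (1 / s) * ennreal (1 / s) = ennreal (1 / s\<^sup>2)"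
      using True s(1) by (simp_all add: ennreal_mult[symmetric] s(2)[symmetric] power2_eq_square)
    ultimately have "4 * ennreal (1 / s\<^sup>2) * (?F * ?G) \<le> 4 * ennreal (1 / s\<^sup>2) * ?H\<^sup>2" by (simp add: mult.assoc)
    then have "ennreal (s\<^sup>2 / 4) * (4 * ennreal (1 / s\<^sup>2) * (?F * ?G)) \<le> ennreal (s\<^sup>2 / 4) * (4 * ennreal (1 / s\<^sup>2) * ?H\<^sup>2)"
      by (rule mult_left_mono) simp
    moreover have "ennreal (s\<^sup>2 / 4) * (4 * ennreal (1 / s\<^sup>2)) = 1"
    proof -
      have "4 * ennreal (1 / s\<^sup>2) = ennreal (4 * (1 / s\<^sup>2))"
        by (subst ennreal_mult') simp_all
      then have "ennreal (s\<^sup>2 / 4) * (4 * ennreal (1 / s\<^sup>2)) = ennreal (s\<^sup>2 / 4 * (4 * (1 / s\<^sup>2)))"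
        by (simp only:) (rule ennreal_mult'[symmetric], simp)
      then show ?thesis using s(1) by simp
    qed
    ultimately show ?thesis by (simp add: mult.assoc[symmetric])
  qed
qed

lemma prekopa_leindler_1d:
  fixes f g h :: "real \<Rightarrow> ennreal"
  assumes [measurable]: "f \<in> borel_measurable borel" "g \<in> borel_measurable borel" "h \<in> borel_measurable borel"
    and fgh: "\<And>x y. f x * g y \<le> (h ((x + y) / 2))\<^sup>2"
  shows "(\<integral>\<^sup>+x. f x \<partial>lborel) * (\<integral>\<^sup>+x. g x \<partial>lborel) \<le> (\<integral>\<^sup>+x. h x \<partial>lborel)\<^sup>2"
proof -
  define T where "T u n x = enn2real (min (u x) (of_nat n))" for u :: "real \<Rightarrow> ennreal" and n x
  have T: "ennreal (T u n x) = min (u x) (of_nat n)" for u n x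
    unfolding T_def by (intro ennreal_enn2real) (rule le_less_trans[OF min.cobounded2 of_nat_less_top])
  have T0: "T u n x \<ge> 0" "T u n x \<le> real n" for u n x
  proof -
    show "T u n x \<ge> 0" by (simp add: T_def)
    have "ennreal (T u n x) \<le> ennreal (real n)" unfolding T by (simp add: ennreal_of_nat_eq_real_of_nat)
    then show "T u n x \<le> real n" by simp
  qed
  have Tm [measurable]: "T u n \<in> borel_measurable borel" if [measurable]: "u \<in> borel_measurable borel" for u n
    unfolding T_def by measurable
  have trunc: "(\<integral>\<^sup>+x. ennreal (T f n x) \<partial>lborel) * (\<integral>\<^sup>+x. ennreal (T g n x) \<partial>lborel) \<le> (\<integral>\<^sup>+x. h x \<partial>lborel)\<^sup>2" for n
  proof -
    have "(\<integral>\<^sup>+x. ennreal (T f n x) \<partial>lborel) * (\<integral>\<^sup>+x. ennreal (T g n x) \<partial>lborel) \<le> (\<integral>\<^sup>+x. ennreal (T h n x) \<partial>lborel)\<^sup>2"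
    proof (rule prekopa_leindler_bounded[where M = "real n"])
      fix x y
      have "ennreal (T f n x * T g n y) \<le> (min (h ((x + y) / 2)) (of_nat n))\<^sup>2"
      \<comment> \<open>If h is at most n at the midpoint, truncating f and g only lowers the left
        side; otherwise both truncations are at most n and the right side is the square of
        n.\<close>
      proof (cases "h ((x + y) / 2) \<le> of_nat n")
        case True
        have "ennreal (T f n x * T g n y) \<le> f x * g y"
          unfolding ennreal_mult[OF T0(1) T0(1)] T by (intro mult_mono) auto
        then show ?thesis using True fgh[of x y] by (simp add: min_absorb1)
      next
        case False
        have "ennreal (T f n x * T g n y) \<le> of_nat n * of_nat n"
          unfolding ennreal_mult[OF T0(1) T0(1)] T by (intro mult_mono) auto
        then show ?thesis using False by (simp add: min_absorb2 power2_eq_square)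
      qed
      also have "\<dots> = ennreal ((T h n ((x + y) / 2))\<^sup>2)" unfolding T[symmetric] by (simp add: ennreal_power T0)
      finally show "T f n x * T g n y \<le> (T h n ((x + y) / 2))\<^sup>2" by simp
    qed (use T0 in auto)
    also have "\<dots> \<le> (\<integral>\<^sup>+x. h x \<partial>lborel)\<^sup>2"
      unfolding T by (intro power_mono nn_integral_mono) auto
    finally show ?thesis .
  qed
  have inc: "incseq (\<lambda>n x. ennreal (T u n x))" for u
    unfolding T by (auto simp: incseq_def le_fun_def intro: min.coboundedI2 of_nat_mono)
  have lim: "(\<integral>\<^sup>+x. u x \<partial>lborel) = (SUP n. \<integral>\<^sup>+x. ennreal (T u n x) \<partial>lborel)" if [measurable]: "u \<in> borel_measurable borel" for u
  proof -
    have "(SUP n. ennreal (T u n x)) = u x" for x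
    proof -
      have "(SUP n. min (u x) (of_nat n)) = u x"
      proof (cases "u x")
        case (real r)
        obtain n where "r \<le> real n" using real_arch_simple by blast
        then have "u x \<le> of_nat n" using real by (simp add: ennreal_of_nat_eq_real_of_nat ennreal_leI)
        then show ?thesis by (intro antisym SUP_least SUP_upper2[of n]) auto
      qed (simp add: ennreal_SUP_of_nat_eq_top)
      then show ?thesis unfolding T .
    qed
    then have "(\<integral>\<^sup>+x. u x \<partial>lborel) = (\<integral>\<^sup>+x. (SUP n. ennreal (T u n x)) \<partial>lborel)" by simp
    also have "\<dots> = (SUP n. \<integral>\<^sup>+x. ennreal (T u n x) \<partial>lborel)"
      by (rule nn_integral_monotone_convergence_SUP[OF inc]) measurable
    finally show ?thesis .
  qed
  \<comment> \<open>Truncation levels m for f and n for g are kept separate, both dominated by their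
    maximum, so that the two suprema can be taken one after the other.\<close>
  have incI: "(\<integral>\<^sup>+x. ennreal (T u m x) \<partial>lborel) \<le> (\<integral>\<^sup>+x. ennreal (T u n x) \<partial>lborel)" if "m \<le> n" for u m n
    using inc[of u] that by (intro nn_integral_mono) (auto simp: incseq_def le_fun_def)
  have "(\<integral>\<^sup>+x. ennreal (T f m x) \<partial>lborel) * (\<integral>\<^sup>+x. ennreal (T g n x) \<partial>lborel) \<le> (\<integral>\<^sup>+x. h x \<partial>lborel)\<^sup>2" for m n
    by (rule order_trans[OF mult_mono[OF incI[of m "max m n"] incI[of n "max m n"]] trunc[of "max m n"]]) auto
  then have "(\<integral>\<^sup>+x. ennreal (T f m x) \<partial>lborel) * (\<integral>\<^sup>+x. g x \<partial>lborel) \<le> (\<integral>\<^sup>+x. h x \<partial>lborel)\<^sup>2" for m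
    unfolding lim[of g, simplified] SUP_mult_left_ennreal by (intro SUP_least)
  then show ?thesis
    unfolding lim[of f, simplified] SUP_mult_right_ennreal by (intro SUP_least)
qed

text \<open>Integrals over the fibres parallel to b satisfy the midpoint hypothesis again, by the
  one-dimensional inequality on a pair of fibres and the fibre halfway between them.\<close>

lemma prekopa_leindler:
  fixes f g h :: "'a::{real_inner,polish_space} \<Rightarrow> ennreal"
  assumes "finite B" "f \<in> borel_measurable borel" "g \<in> borel_measurable borel" "h \<in> borel_measurable borel"
    and "\<And>x y. f x * g y \<le> (h ((1/2) *\<^sub>R (x + y)))\<^sup>2"
  shows "(\<integral>\<^sup>+x. f x \<partial>span_lborel B) * (\<integral>\<^sup>+x. g x \<partial>span_lborel B) \<le> (\<integral>\<^sup>+x. h x \<partial>span_lborel B)\<^sup>2"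
  using assms
proof (induction B arbitrary: f g h rule: finite_induct)
  case empty
  then show ?case using empty(4)[of 0 0] by (simp add: nn_integral_span_lborel_empty)
next
  case (insert b B)
  note [measurable] = insert.prems(1-3)
  show ?case
    unfolding nn_integral_span_lborel_insert[OF insert.hyps insert.prems(1)]
      nn_integral_span_lborel_insert[OF insert.hyps insert.prems(2)]
      nn_integral_span_lborel_insert[OF insert.hyps insert.prems(3)]
  proof (rule insert.IH)
    fix x y
    show "(\<integral>\<^sup>+s. f (s *\<^sub>R b + x) \<partial>lborel) * (\<integral>\<^sup>+s. g (s *\<^sub>R b + y) \<partial>lborel) \<le>
      (\<integral>\<^sup>+s. h (s *\<^sub>R b + (1/2) *\<^sub>R (x + y)) \<partial>lborel)\<^sup>2"
    proof (rule prekopa_leindler_1d)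
      fix s t :: real
      have "(1/2) *\<^sub>R ((s *\<^sub>R b + x) + (t *\<^sub>R b + y)) = ((s + t) / 2) *\<^sub>R b + (1/2) *\<^sub>R (x + y)"
        by (simp add: scaleR_add_right scaleR_add_left add_divide_distrib add_ac)
      then show "f (s *\<^sub>R b + x) * g (t *\<^sub>R b + y) \<le> (h (((s + t) / 2) *\<^sub>R b + (1/2) *\<^sub>R (x + y)))\<^sup>2"
        using insert.prems(4)[of "s *\<^sub>R b + x" "t *\<^sub>R b + y"] by simp
    qed measurable
  qed measurable
qed

section \<open>Exponential bound for intrinsic volumes\<close>

lemma wills_scale:
  fixes B :: "'a::{real_inner,polish_space} set"
  assumes B: "orthonormal_set B" and L: "convex_body B L" "L \<noteq> {}" and x: "x > 0"
  shows "wills B ((*\<^sub>R) x ` L) = ennreal (\<Sum>k\<le>card B. fin_intrinsic_volume k L * x ^ k)"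
  using wills_eq_sum[OF B convex_body_scale[OF L(1)], of x] L(2)
  by (simp add: fin_intrinsic_volume_scale[OF B L x] mult.commute)

text \<open>The dilate of L by x / 2 is the midpoint of {0} and of the dilate by x: half of a point
  nearest to v competes for the midpoint of u and v.\<close>

lemma infdist_midpoint_le:
  fixes L :: "'a::real_inner set"
  assumes "compact L" "L \<noteq> {}"
  shows "infdist ((1/2) *\<^sub>R (u + v)) ((*\<^sub>R) (x / 2) ` L) \<le> (norm u + infdist v ((*\<^sub>R) x ` L)) / 2"
proof -
  have c: "compact ((*\<^sub>R) x ` L)" using assms by (intro compact_scaling)
  obtain l where l: "l \<in> L" "infdist v ((*\<^sub>R) x ` L) = dist v (x *\<^sub>R l)"
    using infdist_attained[OF c, of v] assms(2) by auto
  have "infdist ((1/2) *\<^sub>R (u + v)) ((*\<^sub>R) (x / 2) ` L) \<le> dist ((1/2) *\<^sub>R (u + v)) ((x / 2) *\<^sub>R l)"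
    using l by (intro infdist_le) auto
  moreover have "dist ((1/2) *\<^sub>R (u + v)) ((x / 2) *\<^sub>R l) \<le> (norm u + dist v (x *\<^sub>R l)) / 2"
  proof -
    have "(1/2) *\<^sub>R (u + v) - (x / 2) *\<^sub>R l = (1/2) *\<^sub>R (u + (v - x *\<^sub>R l))"
      by (simp add: algebra_simps)
    then show ?thesis using norm_triangle_ineq[of u "v - x *\<^sub>R l"] by (simp add: dist_norm)
  qed
  ultimately show ?thesis using l(2) by simp
qed

text \<open>Let W y be the sum at y. Prekopa-Leindler for {0} and y L, with midpoint (y / 2) L,
  gives W y \<le> (W (y / 2))^2, because the functional of {0} is 1. Iteration bounds W x by the
  power 2^n of W (x / 2^n). Near 0, W y is at most 1 + V_1 y + M y^2, so these powers are
  asymptotically at most exp (x V_1).\<close>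

lemma sum_intrinsic_volume_le_exp:
  fixes B :: "'a::{real_inner,polish_space} set"
  assumes B: "orthonormal_set B" and L: "convex_body B L" "L \<noteq> {}" and x: "x > 0"
  shows "(\<Sum>k\<le>card B. fin_intrinsic_volume k L * x ^ k) \<le> exp (x * fin_intrinsic_volume 1 L)"
proof -
  let ?d = "card B" and ?V = "\<lambda>k. fin_intrinsic_volume k L"
  note V = fin_intrinsic_volume_nonneg[OF B L]
  define W where "W x = (\<Sum>k\<le>?d. ?V k * x ^ k)" for x
  have W0: "W y \<ge> 0" if "y \<ge> 0" for y unfolding W_def using V that by (intro sum_nonneg) auto
  have half: "W y \<le> (W (y / 2))\<^sup>2" if y: "y > 0" for y
  proof -
    have "wills B {0} * wills B ((*\<^sub>R) y ` L) \<le> (wills B ((*\<^sub>R) (y / 2) ` L))\<^sup>2"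
      unfolding wills_def
    proof (rule prekopa_leindler)
      show "finite B" using orthonormal_setD[OF B] by simp
      fix u v :: 'a
      let ?a = "infdist u {0}" and ?b = "infdist v ((*\<^sub>R) y ` L)" and ?c = "infdist ((1/2) *\<^sub>R (u + v)) ((*\<^sub>R) (y / 2) ` L)"
      have a: "?a = norm u" by (simp add: infdist_def)
      have "?c \<le> (?a + ?b) / 2" unfolding a by (rule infdist_midpoint_le[OF convex_bodyD(1)[OF L(1)] L(2)])
      then have "?c\<^sup>2 \<le> ((?a + ?b) / 2)\<^sup>2" by (intro power_mono infdist_nonneg)
      moreover have "2 * ((?a + ?b) / 2)\<^sup>2 \<le> ?a\<^sup>2 + ?b\<^sup>2"
        using zero_le_power2[of "?a - ?b"] by (simp add: power2_eq_square algebra_simps field_simps)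
      ultimately have "2 * ?c\<^sup>2 \<le> ?a\<^sup>2 + ?b\<^sup>2" by linarith
      then have "pi * (2 * ?c\<^sup>2) \<le> pi * (?a\<^sup>2 + ?b\<^sup>2)" by (intro mult_left_mono) auto
      then have "exp (- pi * ?a\<^sup>2 + - pi * ?b\<^sup>2) \<le> exp (- pi * ?c\<^sup>2 + - pi * ?c\<^sup>2)" by (simp add: algebra_simps)
      then have "exp (- pi * ?a\<^sup>2) * exp (- pi * ?b\<^sup>2) \<le> (exp (- pi * ?c\<^sup>2))\<^sup>2"
        unfolding exp_add power2_eq_square .
      then show "ennreal (exp (- pi * ?a\<^sup>2)) * ennreal (exp (- pi * ?b\<^sup>2)) \<le> (ennreal (exp (- pi * ?c\<^sup>2)))\<^sup>2"
        by (simp add: ennreal_mult[symmetric] ennreal_power)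
    qed measurable
    then show ?thesis
      using wills_scale[OF B L y] wills_scale[OF B L, of "y / 2"] y W0[of y] W0[of "y / 2"]
      unfolding wills_origin[OF B] W_def[symmetric] by (simp add: ennreal_power)
  qed
  have iter: "W x \<le> W (x / 2 ^ n) ^ (2 ^ n)" for n
  proof (induction n)
    case (Suc n)
    have "W (x / 2 ^ n) ^ (2 ^ n) \<le> ((W (x / 2 ^ n / 2))\<^sup>2) ^ (2 ^ n)"
      using x by (intro power_mono half W0) auto
    also have "\<dots> = W (x / 2 ^ Suc n) ^ (2 ^ Suc n)" by (simp add: power_mult[symmetric] mult.commute)
    finally show ?case using Suc by linarith
  qed simp
  \<comment> \<open>All terms with k at least 2 are absorbed in M y^2, as y is at most 1.\<close>
  define M where "M = (\<Sum>k\<le>?d. ?V k)"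
  have small: "W y \<le> exp (?V 1 * y + M * y\<^sup>2)" if y: "0 < y" "y \<le> 1" for y
  proof -
    have "W y \<le> (\<Sum>k\<le>?d. (if k = 0 then 1 else 0) + (if k = 1 then ?V 1 * y else 0) + ?V k * y\<^sup>2)"
      unfolding W_def
    proof (rule sum_mono)
      fix k assume "k \<in> {..?d}"
      consider "k = 0" | "k = 1" | "k \<ge> 2" by linarith
      then show "?V k * y ^ k \<le> (if k = 0 then 1 else 0) + (if k = 1 then ?V 1 * y else 0) + ?V k * y\<^sup>2"
      proof cases
        case 1
        then show ?thesis using fin_intrinsic_volume_0_le_1[OF B L] V[of 0] by (simp add: add_increasing2)
      next
        case 2
        then show ?thesis using V[of 1] by simp
      next
        case 3
        then show ?thesis using V[of k] y by (simp add: mult_left_mono power_decreasing)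
      qed
    qed
    also have "\<dots> \<le> 1 + ?V 1 * y + M * y\<^sup>2"
      using V[of 1] y by (simp add: sum.distrib M_def sum_distrib_right)
    also have "\<dots> \<le> exp (?V 1 * y + M * y\<^sup>2)" using exp_ge_add_one_self[of "?V 1 * y + M * y\<^sup>2"] by linarith
    finally show ?thesis .
  qed
  have "W x \<le> exp (?V 1 * x + M * x\<^sup>2 * (1 / 2) ^ n)" if n: "x \<le> 2 ^ n" for n
  proof -
    have "W x \<le> W (x / 2 ^ n) ^ (2 ^ n)" by (rule iter)
    also have "\<dots> \<le> exp (?V 1 * (x / 2 ^ n) + M * (x / 2 ^ n)\<^sup>2) ^ (2 ^ n)"
      using x n by (intro power_mono small W0) auto
    also have "\<dots> = exp (2 ^ n * (?V 1 * (x / 2 ^ n) + M * (x / 2 ^ n)\<^sup>2))"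
      by (simp add: exp_of_nat_mult[symmetric])
    also have "2 ^ n * (?V 1 * (x / 2 ^ n) + M * (x / 2 ^ n)\<^sup>2) = ?V 1 * x + M * x\<^sup>2 * (1 / 2) ^ n"
      by (simp add: field_simps power2_eq_square power_one_over)
    finally show ?thesis .
  qed
  moreover have "\<forall>\<^sub>F n in sequentially. x \<le> 2 ^ n"
  proof -
    obtain N where "x < 2 ^ N" using real_arch_pow[of 2 x] by auto
    then have "x \<le> 2 ^ n" if "n \<ge> N" for n
      using power_increasing[OF that, of "2::real"] by linarith
    then show ?thesis by (auto simp: eventually_sequentially)
  qed
  ultimately have "\<forall>\<^sub>F n in sequentially. W x \<le> exp (?V 1 * x + M * x\<^sup>2 * (1 / 2) ^ n)"
    by (auto elim: eventually_mono)
  moreover have "(\<lambda>n. exp (?V 1 * x + M * x\<^sup>2 * (1 / 2) ^ n)) \<longlonglongrightarrow> exp (?V 1 * x + M * x\<^sup>2 * 0)"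
    by (intro tendsto_intros) auto
  ultimately have "W x \<le> exp (?V 1 * x + M * x\<^sup>2 * 0)"
    by (intro tendsto_lowerbound[where f = "\<lambda>n. exp (?V 1 * x + M * x\<^sup>2 * (1 / 2) ^ n)" and F = sequentially]) auto
  then show ?thesis by (simp add: W_def mult.commute)
qed

lemma intrinsic_volume_term_le_sum:
  fixes B :: "'a::{real_inner,polish_space} set"
  assumes B: "orthonormal_set B" and L: "convex_body B L" "L \<noteq> {}" and x: "x \<ge> 0"
  shows "fin_intrinsic_volume k L * x ^ k \<le> (\<Sum>k\<le>card B. fin_intrinsic_volume k L * x ^ k)"
proof -
  have "fin_intrinsic_volume k L * x ^ k \<le> (\<Sum>k\<le>max k (card B). fin_intrinsic_volume k L * x ^ k)"
    using fin_intrinsic_volume_nonneg[OF B L] x by (intro member_le_sum) auto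
  also have "\<dots> = (\<Sum>k\<le>card B. fin_intrinsic_volume k L * x ^ k)"
    using fin_intrinsic_volume_eq_0[OF B L] by (intro sum.mono_neutral_right) auto
  finally show ?thesis .
qed

section \<open>Vanishing of intrinsic volumes\<close>

text \<open>The coordinate cube with sides 1 / (k + 1) has positive measure, and its points give
  convex combinations of 0 and J: the coordinates add up to at most 1, and the rest of the weight
  goes to 0.\<close>

lemma emeasure_span_lborel_simplex_pos:
  fixes J :: "'a::{real_inner,polish_space} set"
  assumes J: "finite J" "0 \<notin> J" and Q: "convex Q" "0 \<in> Q" "J \<subseteq> Q" "Q \<in> sets borel"
  shows "emeasure (span_lborel J) Q > 0"
proof -
  interpret product_sigma_finite "\<lambda>_::'a. lborel :: real measure" by standard
  let ?k = "real (card J)"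
  let ?P = "PiE J (\<lambda>_. {0..1 / (?k + 1)})"
  have "(\<Prod>j\<in>J. emeasure lborel {0..1 / (?k + 1)}) = ennreal ((1 / (?k + 1)) ^ card J)"
    by (subst ennreal_power[symmetric]) simp_all
  moreover have "0 < (1 / (?k + 1)) ^ card J" by (intro zero_less_power) simp
  ultimately have "0 < (\<Prod>j\<in>J. emeasure lborel {0..1 / (?k + 1)})" by (simp only: ennreal_less_zero_iff)
  also have "\<dots> = emeasure (\<Pi>\<^sub>M j\<in>J. (lborel :: real measure)) ?P"
    using J by (subst emeasure_PiM) auto
  also have "\<dots> \<le> emeasure (\<Pi>\<^sub>M j\<in>J. (lborel :: real measure)) ((\<lambda>x. \<Sum>b\<in>J. x b *\<^sub>R b) -` Q \<inter> space (\<Pi>\<^sub>M j\<in>J. (lborel :: real measure)))"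
  proof (rule emeasure_mono)
    show "(\<lambda>x. \<Sum>b\<in>J. x b *\<^sub>R b) -` Q \<inter> space (\<Pi>\<^sub>M j\<in>J. (lborel :: real measure)) \<in> sets (\<Pi>\<^sub>M j\<in>J. (lborel :: real measure))"
      by (rule measurable_sets[OF measurable_lincomb Q(4)])
    show "?P \<subseteq> (\<lambda>x. \<Sum>b\<in>J. x b *\<^sub>R b) -` Q \<inter> space (\<Pi>\<^sub>M j\<in>J. (lborel :: real measure))"
    proof
      fix x assume x: "x \<in> ?P"
      then have x': "0 \<le> x j" "x j \<le> 1 / (?k + 1)" if "j \<in> J" for j using that by (auto simp: PiE_iff)
      have "(\<Sum>j\<in>J. x j) \<le> (\<Sum>j\<in>J. 1 / (?k + 1))" using x' by (intro sum_mono) auto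
      also have "\<dots> \<le> 1" by simp
      finally have s: "(\<Sum>j\<in>J. x j) \<le> 1" .
      define w where "w j = (if j = 0 then 1 - (\<Sum>j\<in>J. x j) else x j)" for j
      have wJ: "w j = x j" if "j \<in> J" for j using that J by (auto simp: w_def)
      have "(\<Sum>j\<in>insert 0 J. w j *\<^sub>R j) \<in> Q"
      proof (rule convex_sum[OF _ Q(1)])
        show "(\<Sum>j\<in>insert 0 J. w j) = 1" using J wJ by (simp add: w_def)
        show "w j \<ge> 0" if "j \<in> insert 0 J" for j using that s x' by (auto simp: w_def)
      qed (use J Q in auto)
      also have "(\<Sum>j\<in>insert 0 J. w j *\<^sub>R j) = (\<Sum>j\<in>J. x j *\<^sub>R j)" using J wJ by simp
      finally show "x \<in> (\<lambda>x. \<Sum>b\<in>J. x b *\<^sub>R b) -` Q \<inter> space (\<Pi>\<^sub>M j\<in>J. (lborel :: real measure))"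
        using x by (auto simp: space_PiM PiE_iff)
    qed
  qed
  also have "\<dots> = emeasure (span_lborel J) Q"
    unfolding span_lborel_def by (rule emeasure_distr[OF measurable_lincomb Q(4), symmetric])
  finally show ?thesis .
qed

lemma card_eq_of_span_eq:
  fixes I J :: "'a::real_vector set"
  assumes "independent I" "independent J" "span I = span J"
  shows "card I = card J"
proof -
  have "card I = dim (span I)" using dim_eq_card_independent[OF assms(1)] by (simp add: dim_span)
  also have "\<dots> = card J" using dim_eq_card_independent[OF assms(2)] by (simp add: assms(3) dim_span)
  finally show ?thesis .
qed

lemma fin_intrinsic_volume_Suc_eq_0:
  fixes B :: "'a::{real_inner,polish_space} set"
  assumes B: "orthonormal_set B" and L: "convex_body B L" "L \<noteq> {}" and 0: "fin_intrinsic_volume k L = 0"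
  shows "fin_intrinsic_volume (Suc k) L = 0"
proof (rule ccontr)
  assume nz: "fin_intrinsic_volume (Suc k) L \<noteq> 0"
  \<comment> \<open>otherwise a translate of \<open>L\<close> contains a simplex of dimension \<open>k\<close>, and \<open>V\<^sub>k\<close> is at least its volume\<close>
  obtain a where a: "a \<in> L" using L by auto
  then have aB: "- a \<in> span B" using convex_bodyD(3)[OF L(1)] by (auto intro: span_neg)
  define M where "M = (+) (- a) ` L"
  have M: "convex_body B M" "M \<noteq> {}" "0 \<in> M"
    using convex_body_translate[OF L(1) aB] L a by (force simp: M_def)+
  have VM: "fin_intrinsic_volume k M = 0" "fin_intrinsic_volume (Suc k) M \<noteq> 0"
    using fin_intrinsic_volume_translate[OF B L aB] 0 nz by (simp_all add: M_def)
  obtain I where I: "I \<subseteq> M" "independent I" "M \<subseteq> span I" by (rule maximal_independent_subset)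
  have finI: "finite I"
    using independent_span_bound[OF orthonormal_setD(1)[OF B] I(2)] I(1) convex_bodyD(3)[OF M(1)] by auto
  obtain C where C: "orthonormal_set C" "span C = span I" using orthonormal_basis_span[OF finI] by blast
  have MC: "convex_body C M" using M I C unfolding convex_body_def by simp
  have "card C = card I"
    by (rule card_eq_of_span_eq[OF orthonormal_set_independent[OF C(1)] I(2) C(2)])
  \<comment> \<open>The body spans more than k dimensions, for otherwise its intrinsic volume of
    index k + 1 would vanish.\<close>
  then have "card I \<ge> Suc k"
    using fin_intrinsic_volume_eq_0[OF C(1) MC M(2), of "Suc k"] VM(2) by linarith
  then obtain J where J: "J \<subseteq> I" "card J = k"
    by (rule obtain_subset_with_card_n[OF Suc_leD])
  have Jf: "finite J" "independent J" using J I finI finite_subset independent_mono by blast+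
  have J0: "0 \<notin> J" using Jf(2) dependent_zero by blast
  obtain D where D: "orthonormal_set D" "span D = span J" using orthonormal_basis_span[OF Jf(1)] by blast
  have cardD: "card D = k"
    using card_eq_of_span_eq[OF orthonormal_set_independent[OF D(1)] Jf(2) D(2)] J(2) by simp
  define Q where "Q = M \<inter> span J"
  have Q: "convex_body D Q" "0 \<in> Q" "J \<subseteq> Q"
  proof -
    have "compact Q" unfolding Q_def D(2)[symmetric]
      by (intro compact_Int_closed convex_bodyD(1)[OF M(1)] closed_span_orthonormal D)
    then show "convex_body D Q" unfolding convex_body_def D(2)
      by (auto simp: Q_def intro!: convex_Int convex_bodyD(2)[OF M(1)] subspace_imp_convex[OF subspace_span])
    show "0 \<in> Q" using M(3) by (simp add: Q_def span_zero)
    show "J \<subseteq> Q" using J I by (auto simp: Q_def intro: span_base)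
  qed
  have "emeasure (span_lborel J) Q > 0"
    by (rule emeasure_span_lborel_simplex_pos[OF Jf(1) J0 convex_bodyD(2)[OF Q(1)] Q(2,3) convex_bodyD(6)[OF Q(1)]])
  \<comment> \<open>The vectors of J are those found in the body, not orthonormal ones;
    proportionality of the measures carries positivity over to D.\<close>
  moreover obtain c where c: "c > 0" "\<forall>f. f \<in> borel_measurable borel \<longrightarrow>
       (\<integral>\<^sup>+x. f x \<partial>span_lborel J) = ennreal c * (\<integral>\<^sup>+x. f x \<partial>span_lborel D)"
    using span_lborel_proportional[OF Jf(1) orthonormal_setD(1)[OF D(1)] Jf(2) orthonormal_set_independent[OF D(1)]] D(2) by auto
  have "emeasure (span_lborel J) Q = ennreal c * emeasure (span_lborel D) Q"
    using c(2)[rule_format, of "indicator Q"] convex_bodyD(6)[OF Q(1)] by simp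
  ultimately have "emeasure (span_lborel D) Q > 0" by (cases "emeasure (span_lborel D) Q = 0") (auto simp: zero_less_iff_neq_zero)
  then have "measure (span_lborel D) Q > 0"
    using emeasure_span_lborel_eq_measure[OF D(1) convex_bodyD(4)[OF Q(1)]] by simp
  then have "fin_intrinsic_volume k Q > 0"
    using fin_intrinsic_volume_top[OF D(1) Q(1)] Q(2) cardD by (metis empty_iff)
  moreover have "convex_body B Q"
    using Q(1) convex_bodyD(3)[OF M(1)] unfolding convex_body_def by (auto simp: Q_def)
  then have "fin_intrinsic_volume k Q \<le> fin_intrinsic_volume k M"
    using Q(2) by (intro fin_intrinsic_volume_mono[OF B _ _ M(1)]) (auto simp: Q_def)
  ultimately show False using VM(1) by simp
qed

section \<open>Intrinsic volumes of GB-sets\<close>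

lemma finite_dimensional_body:
  fixes L :: "'a::{real_inner,polish_space} set"
  assumes "compact L" "convex L" "finite_dimensional L"
  shows "\<exists>B. orthonormal_set B \<and> convex_body B L"
proof -
  obtain C where "orthonormal_set C" "span C = span L"
    using orthonormal_basis_of_finite_dimensional[OF assms(3)] by blast
  then show ?thesis using assms span_superset unfolding convex_body_def by blast
qed

lemma fin_intrinsic_volume_le_intrinsic_volume:
  assumes "L \<noteq> {}" "compact L" "convex L" "finite_dimensional L" "L \<subseteq> K"
  shows "ennreal (fin_intrinsic_volume k L) \<le> intrinsic_volume k K"
  unfolding intrinsic_volume_def using assms by (intro SUP_upper) auto

text \<open>One term of the exponential bound, for every finite-dimensional L in K. The free x plays
  the role of the radius in a Cauchy estimate: letting it vary yields decay faster than any
  geometric sequence.\<close>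

lemma GB_intrinsic_volume_le:
  fixes K :: "'a::{real_inner,polish_space} set"
  assumes K: "GB_set K" and x: "x > 0"
  shows "intrinsic_volume k K \<le> ennreal (exp (x * enn2real (intrinsic_volume 1 K)) / x ^ k)"
  unfolding intrinsic_volume_def[of k]
proof (rule SUP_least)
  fix L assume L: "L \<in> {L. L \<noteq> {} \<and> compact L \<and> convex L \<and> finite_dimensional L \<and> L \<subseteq> K}"
  obtain B where B: "orthonormal_set B" "convex_body B L" using finite_dimensional_body L by blast
  have ne: "L \<noteq> {}" using L by auto
  have "ennreal (fin_intrinsic_volume 1 L) \<le> intrinsic_volume 1 K"
    using L by (intro fin_intrinsic_volume_le_intrinsic_volume) auto
  also have "\<dots> = ennreal (enn2real (intrinsic_volume 1 K))"
    using K by (simp add: GB_set_def)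
  finally have 1: "fin_intrinsic_volume 1 L \<le> enn2real (intrinsic_volume 1 K)" by simp
  have "fin_intrinsic_volume k L * x ^ k \<le> (\<Sum>k\<le>card B. fin_intrinsic_volume k L * x ^ k)"
    by (rule intrinsic_volume_term_le_sum[OF B ne less_imp_le[OF x]])
  also have "\<dots> \<le> exp (x * fin_intrinsic_volume 1 L)" by (rule sum_intrinsic_volume_le_exp[OF B ne x])
  also have "\<dots> \<le> exp (x * enn2real (intrinsic_volume 1 K))" using 1 x by simp
  finally show "ennreal (fin_intrinsic_volume k L) \<le> ennreal (exp (x * enn2real (intrinsic_volume 1 K)) / x ^ k)"
    using x by (intro ennreal_leI) (simp add: field_simps)
qed

lemma intrinsic_volume_Suc_eq_0:
  fixes K :: "'a::{real_inner,polish_space} set"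
  assumes "intrinsic_volume k K = 0"
  shows "intrinsic_volume (Suc k) K = 0"
proof -
  have "fin_intrinsic_volume (Suc k) L = 0"
    if L: "L \<noteq> {}" "compact L" "convex L" "finite_dimensional L" "L \<subseteq> K" for L
  proof -
    obtain B where B: "orthonormal_set B" "convex_body B L" using finite_dimensional_body L by blast
    have "ennreal (fin_intrinsic_volume k L) \<le> 0"
      using fin_intrinsic_volume_le_intrinsic_volume[OF L, of k] assms by simp
    then have "fin_intrinsic_volume k L = 0"
      using fin_intrinsic_volume_nonneg[OF B L(1), of k] by (simp add: ennreal_eq_0_iff)
    then show ?thesis by (rule fin_intrinsic_volume_Suc_eq_0[OF B L(1)])
  qed
  then have "intrinsic_volume (Suc k) K \<le> 0"
    unfolding intrinsic_volume_def by (intro SUP_least) auto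
  then show ?thesis by simp
qed

section \<open>The order of the Steiner function\<close>

abbreviation GB_volume :: "'a::real_inner set \<Rightarrow> nat \<Rightarrow> real" where
  "GB_volume K k \<equiv> enn2real (intrinsic_volume k K)"

lemma GB_volume_le:
  fixes K :: "'a::{real_inner,polish_space} set"
  assumes "GB_set K" "x > 0"
  shows "GB_volume K k \<le> exp (x * GB_volume K 1) / x ^ k"
  using GB_intrinsic_volume_le[OF assms, of k] assms(2)
  by (intro enn2real_leI) auto

lemma intrinsic_volume_eq_GB_volume:
  fixes K :: "'a::{real_inner,polish_space} set"
  assumes "GB_set K"
  shows "intrinsic_volume k K = ennreal (GB_volume K k)"
proof -
  have "intrinsic_volume k K < \<infinity>"
    using GB_intrinsic_volume_le[OF assms, of 1 k] by (rule le_less_trans) simp_all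
  then show ?thesis by (simp add: less_top)
qed

text \<open>This accounts for the convention 0/0 = 0: where V_k = 0 the ratio is 0 and carries no
  information on V_(k+1), so the recursion from ratios to volumes has to be secured
  separately.\<close>

lemma GB_volume_Suc_eq_0:
  fixes K :: "'a::{real_inner,polish_space} set"
  assumes K: "GB_set K" and "GB_volume K k = 0"
  shows "GB_volume K (Suc k) = 0"
  using intrinsic_volume_Suc_eq_0[of k K] intrinsic_volume_eq_GB_volume[OF K, of k] assms(2) by simp

lemma summable_GB_volume:
  fixes K :: "'a::{real_inner,polish_space} set"
  assumes K: "GB_set K" and r: "r \<ge> 0"
  shows "summable (\<lambda>k. GB_volume K k * r ^ k)"
proof (rule summable_comparison_test')
  \<comment> \<open>Larger than 2 r, so that r / x is below 1/2, and positive even for r =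
    0.\<close>
  let ?x = "2 * r + 1"
  show "summable (\<lambda>k. exp (?x * GB_volume K 1) * (1 / 2) ^ k)"
    by (intro summable_mult summable_geometric) simp
  fix k :: nat
  have "GB_volume K k * r ^ k \<le> exp (?x * GB_volume K 1) / ?x ^ k * r ^ k"
    using GB_volume_le[OF K, of ?x k] r by (intro mult_right_mono) auto
  also have "\<dots> = exp (?x * GB_volume K 1) * (r / ?x) ^ k" by (simp add: power_divide)
  also have "\<dots> \<le> exp (?x * GB_volume K 1) * (1 / 2) ^ k"
    using r by (intro mult_left_mono power_mono) (auto simp: field_simps)
  finally show "norm (GB_volume K k * r ^ k) \<le> exp (?x * GB_volume K 1) * (1 / 2) ^ k"
    using r by simp
qed

lemma norm_steiner_function_le:
  fixes K :: "'a::{real_inner,polish_space} set"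
  assumes K: "GB_set K"
  shows "norm (steiner_function K z) \<le> (\<Sum>k. GB_volume K k * norm z ^ k)"
proof -
  have eq: "norm (complex_of_real (GB_volume K k) * z ^ k) = GB_volume K k * norm z ^ k" for k
    by (simp add: norm_mult norm_power)
  show ?thesis
    unfolding steiner_function_def
    using summable_norm[of "\<lambda>k. complex_of_real (GB_volume K k) * z ^ k"] summable_GB_volume[OF K, of "norm z"]
    unfolding eq by simp
qed

text \<open>With non-negative coefficients the modulus on a circle is largest at the positive real
  point, so the order can be tested on the positive axis alone.\<close>

lemma norm_steiner_function_of_real:
  fixes K :: "'a::{real_inner,polish_space} set"
  assumes K: "GB_set K" and r: "r \<ge> 0"
  shows "norm (steiner_function K (complex_of_real r)) = (\<Sum>k. GB_volume K k * r ^ k)"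
proof -
  have "steiner_function K (complex_of_real r) = (\<Sum>k. complex_of_real (GB_volume K k * r ^ k))"
    unfolding steiner_function_def by simp
  also have "\<dots> = complex_of_real (\<Sum>k. GB_volume K k * r ^ k)"
    by (rule suminf_of_real[OF summable_GB_volume[OF assms], symmetric])
  finally show ?thesis
    using suminf_nonneg[OF summable_GB_volume[OF assms]] r by simp
qed

lemma powr_eventually_le_powr:
  fixes a \<mu> A :: real
  assumes "a < \<mu>"
  shows "\<forall>\<^sub>F r in at_top. A * r powr a \<le> r powr \<mu>"
proof -
  have "filterlim (\<lambda>r::real. r powr (\<mu> - a)) at_top at_top"
    using assms by (intro real_powr_at_top) auto
  then have "\<forall>\<^sub>F r in at_top. A \<le> r powr (\<mu> - a)" by (simp add: filterlim_at_top)
  then show ?thesis using eventually_gt_at_top[of 0]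
  proof eventually_elim
    case (elim r)
    then have "A * r powr a \<le> r powr (\<mu> - a) * r powr a" by (intro mult_right_mono) auto
    then show ?case by (simp add: powr_add[symmetric])
  qed
qed

text \<open>The definition of the order admits no constant in front of the power, but every exponent
  above a absorbs the factor A; hence the infimum is at most a.\<close>

lemma GB_order_le:
  fixes K :: "'a::{real_inner,polish_space} set"
  assumes K: "GB_set K" and D: "D \<ge> 0" and bd: "\<And>r. r \<ge> 1 \<Longrightarrow> (\<Sum>k. GB_volume K k * r ^ k) \<le> D * exp (A * r powr a)"
  shows "GB_order K \<le> ereal a"
proof (rule dense_ge)
  fix y assume y: "ereal a < y"
  show "GB_order K \<le> y"
  proof (cases y)
    case (real \<mu>)
    then have \<mu>: "a < \<mu>" using y by simp
    have "filterlim norm at_top (at_infinity :: complex filter)" by (rule filterlim_norm_at_top)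
    then have ev: "\<forall>\<^sub>F z in (at_infinity :: complex filter). A * norm z powr a \<le> norm z powr \<mu> \<and> norm z \<ge> 1"
      using powr_eventually_le_powr[OF \<mu>, of A] eventually_ge_at_top[of "1::real"]
      by (intro eventually_compose_filterlim[of "\<lambda>r. A * r powr a \<le> r powr \<mu> \<and> r \<ge> 1" at_top norm]) (auto intro: eventually_conj)
    have "steiner_function K \<in> O[at_infinity](\<lambda>z. complex_of_real (exp (norm z powr \<mu>)))"
    proof (rule landau_o.bigI[of "D + 1"])
      show "\<forall>\<^sub>F z in at_infinity. norm (steiner_function K z) \<le> (D + 1) * norm (complex_of_real (exp (norm z powr \<mu>)))"
        using ev
      proof eventually_elim
        case (elim z)
        have "norm (steiner_function K z) \<le> D * exp (A * norm z powr a)"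
          using norm_steiner_function_le[OF K, of z] bd[of "norm z"] elim by linarith
        also have "\<dots> \<le> (D + 1) * exp (norm z powr \<mu>)" using elim D by (intro mult_mono) auto
        finally show ?case by simp
      qed
    qed (use D in simp)
    then show ?thesis unfolding GB_order_def entire_order_def real by (intro INF_lower) auto
  qed (use y in auto)
qed

text \<open>The recursion gives V_k (k!)^s \<le> E C^k. With y = (2 C r)^(1/s), the quotient (2 C
  r)^k / (k!)^s equals (y^k / k!)^s, at most exp (s y), and the spare factor 2 leaves a geometric
  series. As y is a multiple of r^(1/s), the order is at most 1/s.\<close>

lemma GB_order_le_of_ratio_bigo:
  fixes K :: "'a::{real_inner,polish_space} set"
  assumes K: "GB_set K" and s: "s > 0" and O: "GB_ratio K \<in> O(\<lambda>k. real k powr (1 - s))"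
  shows "GB_order K \<le> ereal (1 / s)"
proof -
  let ?v = "GB_volume K"
  obtain c where c: "c > 0" "\<forall>\<^sub>F k in sequentially. norm (GB_ratio K k) \<le> c * norm (real k powr (1 - s))"
    using O by (rule landau_o.bigE)
  then obtain k0 where k0: "\<And>k. k \<ge> k0 \<Longrightarrow> \<bar>GB_ratio K k\<bar> \<le> c * real k powr (1 - s)"
    by (auto simp: eventually_sequentially)
  define N where "N = max k0 1"
  \<comment> \<open>c' pays for passing from k to k + 1: for k at least 1 one has (k + 1) / 2 \<le>
    k \<le> k + 1, which settles both signs of 1 - s.\<close>
  define c' where "c' = 2 powr \<bar>1 - s\<bar>"
  have pw: "real k powr (1 - s) \<le> c' * real (Suc k) powr (1 - s)" if k: "k \<ge> 1" for k
  proof (cases "s \<le> 1")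
    case True
    have "1 * real k powr (1 - s) \<le> c' * real (Suc k) powr (1 - s)"
      using True by (intro mult_mono powr_mono2) (auto simp: c'_def ge_one_powr_ge_zero)
    then show ?thesis by simp
  next
    case False
    have "real k powr (1 - s) \<le> (real (Suc k) / 2) powr (1 - s)"
      using False k by (intro powr_mono2') auto
    also have "\<dots> = c' * real (Suc k) powr (1 - s)"
      using False by (simp add: powr_divide c'_def field_simps powr_add[symmetric])
    finally show ?thesis .
  qed
  have step: "?v (Suc k) \<le> c * c' * real (Suc k) powr (- s) * ?v k" if k: "k \<ge> N" for k
  proof (cases "?v k = 0")
    case True
    then show ?thesis using GB_volume_Suc_eq_0[OF K True] by simp
  next
    case False
    have "?v (Suc k) = GB_ratio K k * ?v k / real (Suc k)" using False by (simp add: GB_ratio_def)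
    also have "\<dots> \<le> (c * (c' * real (Suc k) powr (1 - s))) * ?v k / real (Suc k)"
    proof (intro divide_right_mono mult_right_mono)
      have "GB_ratio K k \<le> c * real k powr (1 - s)" using k0[of k] k by (simp add: N_def)
      also have "\<dots> \<le> c * (c' * real (Suc k) powr (1 - s))" using pw[of k] k c by (intro mult_left_mono) (auto simp: N_def)
      finally show "GB_ratio K k \<le> c * (c' * real (Suc k) powr (1 - s))" .
    qed auto
    also have "\<dots> = c * c' * (real (Suc k) powr (1 - s) / real (Suc k)) * ?v k" by simp
    also have "real (Suc k) powr (1 - s) / real (Suc k) = real (Suc k) powr (- s)"
      using powr_diff[of "real (Suc k)" "1 - s" 1] by simp
    finally show ?thesis .
  qed
  define C where "C = max 1 (c * c')"
  define u where "u k = ?v k * fact k powr s" for k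
  have u0: "u k \<ge> 0" for k by (simp add: u_def)
  define E where "E = (\<Sum>j\<le>N. u j)"
  have E: "E \<ge> 0" unfolding E_def by (intro sum_nonneg u0)
  have C1: "C \<ge> 1" by (simp add: C_def)
  have ub: "u k \<le> E * C ^ k" for k
  proof (cases "k \<le> N")
    case True
    have "u k \<le> E" unfolding E_def using True u0 by (intro member_le_sum) auto
    also have "\<dots> \<le> E * C ^ k" using E one_le_power[OF C1, of k] by (simp add: mult_le_cancel_left1)
    finally show ?thesis .
  next
    case False
    then have "N \<le> k" by simp
    then show ?thesis
    proof (induction k rule: dec_induct)
      case base
      have "u N \<le> E" unfolding E_def using u0 by (intro member_le_sum) auto
      also have "\<dots> \<le> E * C ^ N" using E one_le_power[OF C1, of N] by (simp add: mult_le_cancel_left1)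
      finally show ?case .
    next
      case (step k)
      have "u (Suc k) \<le> (c * c' * real (Suc k) powr (- s) * ?v k) * fact (Suc k) powr s"
        unfolding u_def using \<open>N \<le> k\<close> by (intro mult_right_mono \<open>\<And>k. N \<le> k \<Longrightarrow> _\<close>) auto
      also have "(fact (Suc k) :: real) powr s = real (Suc k) powr s * fact k powr s"
        by (simp add: powr_mult)
      also have "(c * c' * real (Suc k) powr (- s) * ?v k) * (real (Suc k) powr s * fact k powr s)
         = c * c' * (real (Suc k) powr (- s) * real (Suc k) powr s) * u k" by (simp add: u_def)
      also have "real (Suc k) powr (- s) * real (Suc k) powr s = 1" by (simp add: powr_add[symmetric])
      also have "c * c' * 1 * u k \<le> C * (E * C ^ k)"
        using step.IH u0 C1 by (intro mult_mono) (auto simp: C_def)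
      finally show ?case by (simp add: mult_ac)
    qed
  qed
  show ?thesis
  proof (rule GB_order_le[OF K])
    show "2 * E \<ge> 0" using E by simp
    fix r :: real assume r: "r \<ge> 1"
    define y where "y = (2 * C * r) powr (1 / s)"
    have y0: "y > 0" unfolding y_def using r C1 by simp
    have ys: "y powr s = 2 * C * r" unfolding y_def using s r C1 by (simp add: powr_powr)
    have exp_ge: "y ^ k / fact k \<le> exp y" for k
    proof -
      have "(\<Sum>n<Suc k. y ^ n / fact n) \<le> exp y"
        unfolding exp_def using y0 summable_exp[of y]
        by (intro order_trans[OF sum_le_suminf[of "\<lambda>n. y ^ n / fact n" "{..<Suc k}"]]) (auto simp: divide_inverse mult.commute)
      moreover have "y ^ k / fact k \<le> (\<Sum>n<Suc k. y ^ n / fact n)"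
        using y0 by (intro member_le_sum) auto
      ultimately show ?thesis by linarith
    qed
    have term_le: "?v k * r ^ k \<le> E * exp (s * y) * (1 / 2) ^ k" for k
    proof -
      have f: "(fact k :: real) powr s > 0" by simp
      have "?v k = u k / fact k powr s" using f by (simp add: u_def)
      also have "\<dots> \<le> E * C ^ k / fact k powr s" using ub f by (intro divide_right_mono) auto
      finally have "?v k * r ^ k \<le> E * C ^ k / fact k powr s * r ^ k" using r by (intro mult_right_mono) auto
      also have "\<dots> = E * ((2 * C * r) ^ k / fact k powr s) * (1 / 2) ^ k"
        by (simp add: power_mult_distrib power_one_over field_simps)
      also have "(2 * C * r) ^ k = (y ^ k) powr s"
        unfolding ys[symmetric] using y0 by (simp add: powr_powr powr_realpow[symmetric] mult.commute)
      also have "(y ^ k) powr s / fact k powr s = (y ^ k / fact k) powr s" using y0 by (simp add: powr_divide)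
      also have "E * (y ^ k / fact k) powr s * (1 / 2) ^ k \<le> E * exp y powr s * (1 / 2) ^ k"
        using exp_ge[of k] y0 s E by (intro mult_right_mono mult_left_mono powr_mono2) auto
      also have "exp y powr s = exp (s * y)" by (simp add: powr_def)
      finally show ?thesis .
    qed
    have "(\<Sum>k. ?v k * r ^ k) \<le> (\<Sum>k. E * exp (s * y) * (1 / 2) ^ k)"
      using summable_GB_volume[OF K, of r] r term_le
      by (intro suminf_le summable_mult summable_geometric) auto
    also have "\<dots> = E * exp (s * y) * 2"
      by (subst suminf_mult) (auto simp: suminf_geometric summable_geometric)
    also have "s * y = (s * (2 * C) powr (1 / s)) * r powr (1 / s)"
      unfolding y_def using r C1 by (simp add: powr_mult)
    finally show "(\<Sum>k. ?v k * r ^ k) \<le> 2 * E * exp (s * (2 * C) powr (1 / s) * r powr (1 / s))"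
      by (simp add: mult_ac)
  qed
qed

text \<open>An order below b only says that some smaller exponent works, possibly a negative one.
  Raising it to at least a costs nothing once r is at least 1.\<close>

lemma GB_order_less_imp:
  fixes K :: "'a::{real_inner,polish_space} set"
  assumes K: "GB_set K" and "GB_order K < ereal b" "a < b"
  shows "\<exists>\<mu> D. a \<le> \<mu> \<and> \<mu> < b \<and> D > 0 \<and> (\<forall>\<^sub>F r in at_top. (\<Sum>k. GB_volume K k * r ^ k) \<le> D * exp (r powr \<mu>))"
proof -
  obtain \<nu> :: real where \<nu>: "\<nu> < b" "steiner_function K \<in> O[at_infinity](\<lambda>z. complex_of_real (exp (norm z powr \<nu>)))"
    using assms(2) unfolding GB_order_def entire_order_def by (auto simp: INF_less_iff)
  obtain D where D: "D > 0" "\<forall>\<^sub>F z in at_infinity. norm (steiner_function K z) \<le> D * norm (complex_of_real (exp (norm z powr \<nu>)))"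
    using \<nu>(2) by (rule landau_o.bigE)
  have "filterlim (\<lambda>r. complex_of_real r) at_infinity at_top"
    by (rule filterlim_of_real_at_infinity)
  then have "\<forall>\<^sub>F r in at_top. norm (steiner_function K (complex_of_real r)) \<le> D * norm (complex_of_real (exp (norm (complex_of_real r) powr \<nu>)))"
    using D(2) by (rule eventually_compose_filterlim[rotated])
  then have "\<forall>\<^sub>F r in at_top. (\<Sum>k. GB_volume K k * r ^ k) \<le> D * exp (r powr (max a \<nu>))"
    using eventually_ge_at_top[of 1]
  proof eventually_elim
    case (elim r)
    then have "(\<Sum>k. GB_volume K k * r ^ k) \<le> D * exp (r powr \<nu>)"
      using norm_steiner_function_of_real[OF K, of r] by simp
    also have "\<dots> \<le> D * exp (r powr (max a \<nu>))"
      using elim D by (intro mult_left_mono) (auto intro: powr_mono)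
    finally show ?case .
  qed
  then show ?thesis using \<nu> D assms(3) by (intro exI[of _ "max a \<nu>"] exI[of _ D]) auto
qed

text \<open>If m_k exceeds l = L / 2 from N on, then V_k is at least c l^k / k!, and the Steiner
  function dominates c exp (l r) up to a polynomial. An order below 1 would make it, divided by exp
  (l r), tend to 0.\<close>

lemma GB_order_ge_1_of_ratio_limit:
  fixes K :: "'a::{real_inner,polish_space} set"
  assumes K: "GB_set K" and L: "L > 0" "GB_ratio K \<longlonglongrightarrow> L"
  shows "GB_order K \<ge> 1"
proof (rule ccontr)
  assume "\<not> GB_order K \<ge> 1"
  then have "GB_order K < ereal 1" by (simp add: one_ereal_def)
  then obtain \<mu> D where \<mu>: "0 \<le> \<mu>" "\<mu> < 1" "D > 0"
    and ev: "\<forall>\<^sub>F r in at_top. (\<Sum>k. GB_volume K k * r ^ k) \<le> D * exp (r powr \<mu>)"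
    using GB_order_less_imp[OF K, of 1 0] by auto
  let ?v = "GB_volume K"
  define l where "l = L / 2"
  have l: "l > 0" "l < L" using L by (auto simp: l_def)
  have "\<forall>\<^sub>F k in sequentially. l < GB_ratio K k" using order_tendstoD(1)[OF L(2) l(2)] .
  then obtain N where N: "\<And>k. k \<ge> N \<Longrightarrow> l < GB_ratio K k" by (auto simp: eventually_sequentially)
  have vpos: "?v k > 0" if "k \<ge> N" for k
  proof -
    have "?v k \<noteq> 0" using N[OF that] l by (auto simp: GB_ratio_def)
    then show ?thesis by (simp add: less_le)
  qed
  have step: "l * ?v k \<le> ?v (Suc k) * real (Suc k)" if "k \<ge> N" for k
    using N[OF that] vpos[OF that] by (simp add: GB_ratio_def field_simps)
  \<comment> \<open>Chosen so that the lower bound is an equality at k = N.\<close>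
  define c where "c = ?v N * fact N / l ^ N"
  have c: "c > 0" using vpos[of N] l by (simp add: c_def)
  have low: "c * l ^ k / fact k \<le> ?v k" if "k \<ge> N" for k
    using that
  proof (induction k rule: dec_induct)
    case base
    then show ?case using l by (simp add: c_def)
  next
    case (step k)
    have "c * l ^ Suc k / fact (Suc k) = (c * l ^ k / fact k) * l / real (Suc k)" by (simp add: field_simps)
    also have "\<dots> \<le> ?v k * l / real (Suc k)" using step.IH l by (intro divide_right_mono mult_right_mono) auto
    also have "\<dots> \<le> ?v (Suc k)" using \<open>\<And>k. N \<le> k \<Longrightarrow> l * _ k \<le> _\<close>[OF step.hyps(1)] by (simp add: field_simps)
    finally show ?case .
  qed
  \<comment> \<open>The first N terms of the exponential series, where no lower bound for V_k is at
    hand.\<close>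
  define P where "P y = (\<Sum>k<N. y ^ k / fact k)" for y :: real
  have main: "c * exp (l * r) \<le> (\<Sum>k. ?v k * r ^ k) + c * P (l * r)" if r: "r \<ge> 0" for r
  proof -
    have sums: "(\<lambda>k. c * ((l * r) ^ k / fact k)) sums (c * exp (l * r))"
      using sums_mult[OF exp_converges[of "l * r"], of c] by (simp add: divide_inverse mult_ac)
    have fin: "(\<lambda>k. if k \<in> {..<N} then c * ((l * r) ^ k / fact k) else 0) sums (\<Sum>k<N. c * ((l * r) ^ k / fact k))"
      by (rule sums_If_finite_set) simp
    have "c * exp (l * r) \<le> (\<Sum>k. ?v k * r ^ k) + (\<Sum>k<N. c * ((l * r) ^ k / fact k))"
    proof (rule sums_le[OF _ sums sums_add[OF summable_sums[OF summable_GB_volume[OF K r]] fin]])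
      fix k
      show "c * ((l * r) ^ k / fact k) \<le> ?v k * r ^ k + (if k \<in> {..<N} then c * ((l * r) ^ k / fact k) else 0)"
      proof (cases "k < N")
        case True
        then show ?thesis using r by simp
      next
        case False
        have "c * ((l * r) ^ k / fact k) = (c * l ^ k / fact k) * r ^ k" by (simp add: power_mult_distrib)
        also have "\<dots> \<le> ?v k * r ^ k" using low[of k] False r by (intro mult_right_mono) auto
        finally show ?thesis using False by simp
      qed
    qed
    then show ?thesis by (simp add: P_def sum_distrib_left)
  qed
  have "\<forall>\<^sub>F r in at_top. c \<le> D * exp (r powr \<mu> - l * r) + c * (P (l * r) / exp (l * r))"
    using ev eventually_ge_at_top[of 0]
  proof eventually_elim
    case (elim r)
    then have "c * exp (l * r) \<le> D * exp (r powr \<mu>) + c * P (l * r)" using main[of r] by linarith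
    then have "c * exp (l * r) / exp (l * r) \<le> (D * exp (r powr \<mu>) + c * P (l * r)) / exp (l * r)"
      by (intro divide_right_mono) auto
    then show ?case by (simp add: exp_diff add_divide_distrib)
  qed
  moreover have "((\<lambda>r. D * exp (r powr \<mu> - l * r) + c * (P (l * r) / exp (l * r))) \<longlongrightarrow> D * 0 + c * 0) at_top"
  proof (intro tendsto_intros)
    have "\<forall>\<^sub>F r in at_top. r powr \<mu> - l * r \<le> - (l / 2) * r"
      using powr_eventually_le_powr[OF \<mu>(2), of "2 / l"] eventually_gt_at_top[of 0]
      by eventually_elim (use l in \<open>simp add: field_simps\<close>)
    moreover have "filterlim (\<lambda>r::real. - (l / 2) * r) at_bot at_top"
      using l by (intro filterlim_tendsto_neg_mult_at_bot[OF tendsto_const _ filterlim_ident]) auto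
    ultimately have "filterlim (\<lambda>r. r powr \<mu> - l * r) at_bot at_top"
      by (rule filterlim_at_bot_mono[rotated])
    then show "((\<lambda>r. exp (r powr \<mu> - l * r)) \<longlongrightarrow> 0) at_top" by (rule filterlim_compose[OF exp_at_bot])
    have lim: "filterlim (\<lambda>r. l * r) at_top at_top"
      using l by (intro filterlim_tendsto_pos_mult_at_top[OF tendsto_const _ filterlim_ident]) auto
    have "((\<lambda>y::real. \<Sum>k<N. (1 / fact k) * (y ^ k / exp y)) \<longlongrightarrow> (\<Sum>k<N. (1 / fact k) * 0)) at_top"
      by (intro tendsto_sum tendsto_mult tendsto_const tendsto_power_div_exp_0)
    moreover have "P y / exp y = (\<Sum>k<N. (1 / fact k) * (y ^ k / exp y))" for y
      by (simp add: P_def sum_divide_distrib)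
    ultimately have "((\<lambda>y. P y / exp y) \<longlongrightarrow> 0) at_top" by simp
    then show "((\<lambda>r. P (l * r) / exp (l * r)) \<longlongrightarrow> 0) at_top" by (rule filterlim_compose[OF _ lim])
  qed
  ultimately have "c \<le> D * 0 + c * 0"
    by (intro tendsto_lowerbound[where F = at_top and f = "\<lambda>r. D * exp (r powr \<mu> - l * r) + c * (P (l * r) / exp (l * r))"]) auto
  then show False using c by simp
qed

text \<open>The exponent is 1 - s with s = 1/\<rho> + \<epsilon>, so the estimate would force \<rho>
  \<le> 1/s < \<rho>.\<close>

lemma GB_ratio_not_bigo:
  fixes K :: "'a::{real_inner,polish_space} set"
  assumes K: "GB_set K" and \<rho>: "GB_order K > ereal (2/3)" and \<epsilon>: "\<epsilon> > 0"
  shows "GB_ratio K \<notin> O(\<lambda>k. real k powr (1 - 1 / real_of_ereal (GB_order K) - \<epsilon>))"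
proof
  define s where "s = 1 / real_of_ereal (GB_order K) + \<epsilon>"
  assume "GB_ratio K \<in> O(\<lambda>k. real k powr (1 - 1 / real_of_ereal (GB_order K) - \<epsilon>))"
  then have O: "GB_ratio K \<in> O(\<lambda>k. real k powr (1 - s))" by (simp add: s_def algebra_simps)
  \<comment> \<open>An infinite order is not excluded yet: \<open>real_of_ereal\<close> sends it to
    0, so that s = \<epsilon>, and the bound \<open>le\<close> below shows that the order is
    finite.\<close>
  have "real_of_ereal (GB_order K) \<ge> 0" using \<rho> by (intro real_of_ereal_pos) (simp add: order.trans[OF _ less_imp_le[OF \<rho>]])
  then have s: "s > 0" unfolding s_def using \<epsilon> by (intro add_nonneg_pos) auto
  have le: "GB_order K \<le> ereal (1 / s)" by (rule GB_order_le_of_ratio_bigo[OF K s O])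
  then obtain x where x: "GB_order K = ereal x" using \<rho> by (cases "GB_order K") auto
  have "x > 2/3" using \<rho> x by simp
  then have "1 / x < s" using \<epsilon> unfolding s_def x by simp
  then have "1 / s < x" using \<open>x > 2/3\<close> s by (simp add: field_simps)
  then show False using le x by simp
qed

lemma GB_ratio_not_bigo_half:
  fixes K :: "'a::{real_inner,polish_space} set"
  assumes K: "GB_set K" and \<rho>: "GB_order K > ereal (2/3)"
  shows "GB_ratio K \<notin> O(\<lambda>k. real k powr (- 1 / 2))"
  using GB_order_le_of_ratio_bigo[OF K, of "3/2"] \<rho> by auto

lemma not_gao_vitale_alternative:
  fixes K :: "'a::{real_inner,polish_space} set"
  assumes K: "GB_set K" and \<rho>: "GB_order K > ereal (2/3)" and "GB_ratio K \<longlonglongrightarrow> 0 \<or> GB_order K < 1"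
  shows "\<not> gao_vitale_alternative K"
proof
  assume "gao_vitale_alternative K"
  then obtain L where L: "L > 0" "GB_ratio K \<longlonglongrightarrow> L"
    using GB_ratio_not_bigo_half[OF K \<rho>] unfolding gao_vitale_alternative_def by blast
  from assms(3) show False
  proof
    assume "GB_ratio K \<longlonglongrightarrow> 0"
    then show False using LIMSEQ_unique[OF L(2)] L(1) by blast
  next
    assume "GB_order K < 1"
    then show False using GB_order_ge_1_of_ratio_limit[OF K L] by (simp add: not_le[symmetric])
  qed
qed

section \<open>Contractions and products\<close>

lemma nn_integral_span_lborel_linear_image:
  fixes T :: "'a::{real_inner,polish_space} \<Rightarrow> 'a" and f :: "'a \<Rightarrow> ennreal"
  assumes "finite B" "bounded_linear T" "inj_on T B" "f \<in> borel_measurable borel"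
  shows "(\<integral>\<^sup>+x. f x \<partial>span_lborel (T ` B)) = (\<integral>\<^sup>+x. f (T x) \<partial>span_lborel B)"
  using assms
proof (induction B arbitrary: f rule: finite_induct)
  case empty
  note [measurable] = borel_measurable_continuous_onI[OF linear_continuous_on[OF empty(1)]] empty(3)
  have "(\<lambda>x. f (T x)) \<in> borel_measurable borel" by measurable
  then show ?case using linear_0[OF bounded_linear.linear[OF empty(1)]] empty(3) by (simp add: nn_integral_span_lborel_empty)
next
  case (insert b B)
  note [measurable] = borel_measurable_continuous_onI[OF linear_continuous_on[OF insert.prems(1)]] insert.prems(3)
  have lin: "linear T" using insert.prems(1) by (rule bounded_linear.linear)
  have nin: "T b \<notin> T ` B" using insert.prems(2) insert.hyps(2) by (auto simp: inj_on_def)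
  have "(\<integral>\<^sup>+x. f x \<partial>span_lborel (insert (T b) (T ` B))) = (\<integral>\<^sup>+y. (\<integral>\<^sup>+s. f (s *\<^sub>R T b + y) \<partial>lborel) \<partial>span_lborel (T ` B))"
    using insert.hyps(1) nin by (intro nn_integral_span_lborel_insert) auto
  also have "\<dots> = (\<integral>\<^sup>+y. (\<integral>\<^sup>+s. f (s *\<^sub>R T b + T y) \<partial>lborel) \<partial>span_lborel B)"
  proof (rule insert.IH[OF insert.prems(1)])
    show "inj_on T B" using insert.prems(2) by (auto simp: inj_on_def)
    show "(\<lambda>y. \<integral>\<^sup>+s. f (s *\<^sub>R T b + y) \<partial>lborel) \<in> borel_measurable borel" by measurable
  qed
  also have "\<dots> = (\<integral>\<^sup>+y. (\<integral>\<^sup>+s. f (T (s *\<^sub>R b + y)) \<partial>lborel) \<partial>span_lborel B)"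
    by (simp add: linear_add[OF lin] linear_scale[OF lin])
  also have "\<dots> = (\<integral>\<^sup>+x. f (T x) \<partial>span_lborel (insert b B))"
    by (rule nn_integral_span_lborel_insert[OF insert.hyps, symmetric]) measurable
  finally show ?case by simp
qed

lemma sum_intrinsic_volume_extend:
  fixes B :: "'a::{real_inner,polish_space} set"
  assumes "orthonormal_set B" "convex_body B L" "L \<noteq> {}" "card B \<le> n"
  shows "(\<Sum>k\<le>n. fin_intrinsic_volume k L) = (\<Sum>k\<le>card B. fin_intrinsic_volume k L)"
  using fin_intrinsic_volume_eq_0[OF assms(1-3)] assms(4) by (intro sum.mono_neutral_right) auto

text \<open>Both sides are the same sum of intrinsic volumes, padded by zeros up to the larger
  dimension.\<close>

lemma wills_ambient:
  fixes B C :: "'a::{real_inner,polish_space} set"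
  assumes "orthonormal_set B" "convex_body B L" "orthonormal_set C" "convex_body C L" "L \<noteq> {}"
  shows "wills B L = wills C L"
  using sum_intrinsic_volume_extend[OF assms(1,2,5), of "max (card B) (card C)"]
    sum_intrinsic_volume_extend[OF assms(3,4,5), of "max (card B) (card C)"]
  by (simp add: wills_eq_sum assms)

lemma wills_mono:
  fixes B :: "'a::{real_inner,polish_space} set"
  assumes "L \<subseteq> L'" "L \<noteq> {}"
  shows "wills B L \<le> wills B L'"
  unfolding wills_def
proof (intro nn_integral_mono ennreal_leI)
  fix x
  have "infdist x L' \<le> infdist x L" using assms by (rule infdist_mono)
  then have "(infdist x L')\<^sup>2 \<le> (infdist x L)\<^sup>2" by (intro power_mono infdist_nonneg)
  then show "exp (- pi * (infdist x L)\<^sup>2) \<le> exp (- pi * (infdist x L')\<^sup>2)" by simp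
qed

text \<open>A contraction does not increase the distance to L, so the Gaussian weight does not
  decrease. The change of variables costs a factor c, the inverse Jacobian of T on span B.\<close>

lemma wills_near_isometry:
  fixes B D :: "'a::{real_inner,polish_space} set"
  assumes B: "orthonormal_set B" and L: "convex_body B L" "L \<noteq> {}" and T: "bounded_linear T"
    and up: "\<And>x. x \<in> span B \<Longrightarrow> norm (T x) \<le> norm x"
    and lo: "\<And>x. x \<in> span B \<Longrightarrow> (1 - \<delta>) * norm x \<le> norm (T x)" and \<delta>: "\<delta> < 1"
    and D: "orthonormal_set D" "convex_body D (T ` L)"
  shows "wills B L \<le> ennreal ((1 / (1 - \<delta>)) ^ card B) * wills D (T ` L)"
proof -
  have lin: "linear T" using T by (rule bounded_linear.linear)
  note [measurable] = borel_measurable_continuous_onI[OF linear_continuous_on[OF T]]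
  have fin: "finite B" using orthonormal_setD[OF B] by simp
  have inj: "inj_on T (span B)"
  proof (rule inj_onI)
    fix x y assume xy: "x \<in> span B" "y \<in> span B" "T x = T y"
    then have "(1 - \<delta>) * norm (x - y) \<le> norm (T (x - y))" by (intro lo span_diff)
    also have "T (x - y) = 0" using xy by (simp add: linear_diff[OF lin])
    finally have "norm (x - y) \<le> 0" using \<delta> by (simp add: mult_le_0_iff)
    then show "x = y" by simp
  qed
  have injB: "inj_on T B" using inj by (rule inj_on_subset) (rule span_superset)
  have indep: "independent (T ` B)"
    by (rule linear_independent_injective_image[OF lin orthonormal_set_independent[OF B] inj])
  obtain C where C: "orthonormal_set C" "span C = span (T ` B)"
    using orthonormal_basis_span[of "T ` B"] fin by blast
  have TL: "convex_body C (T ` L)"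
    unfolding convex_body_def C(2) span_linear_image[OF lin]
    using convex_bodyD[OF L(1)]
    by (auto intro!: compact_continuous_image convex_linear_image lin linear_continuous_on T)
  obtain c where c: "c > 0" "\<And>f. f \<in> borel_measurable borel \<Longrightarrow>
       (\<integral>\<^sup>+x. f x \<partial>span_lborel (T ` B)) = ennreal c * (\<integral>\<^sup>+x. f x \<partial>span_lborel C)"
    using span_lborel_proportional[OF finite_imageI[OF fin] orthonormal_setD(1)[OF C(1)] indep orthonormal_set_independent[OF C(1)]] C(2)
    by auto
  have cardC: "card C = card B"
    using card_eq_of_span_eq[OF orthonormal_set_independent[OF C(1)] indep C(2)] card_image[OF injB] by simp
  \<comment> \<open>No determinant is computed: the preimage of the unit ball under T lies in the
    ball of radius 1 / (1 - \<delta>), and comparing the two volumes bounds c.\<close>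
  have cle: "c \<le> (1 / (1 - \<delta>)) ^ card B"
  proof -
    let ?\<kappa> = "unit_ball_vol (real (card B))"
    have "ennreal c * emeasure (span_lborel C) (cball 0 1) = (\<integral>\<^sup>+x. indicator (cball 0 1) x \<partial>span_lborel (T ` B))"
      using c(2)[of "indicator (cball 0 1)"] by simp
    also have "\<dots> = (\<integral>\<^sup>+x. indicator (cball 0 1) (T x) \<partial>span_lborel B)"
      by (rule nn_integral_span_lborel_linear_image[OF fin T injB]) auto
    also have "\<dots> \<le> (\<integral>\<^sup>+x. indicator (cball 0 (1 / (1 - \<delta>))) x \<partial>span_lborel B)"
    proof (rule nn_integral_mono_AE, use AE_span_lborel[OF B] in eventually_elim)
      case (elim x)
      show ?case using lo[OF elim] \<delta> by (auto simp: indicator_def field_simps)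
    qed
    also have "\<dots> = ennreal (?\<kappa> * (1 / (1 - \<delta>)) ^ card B)"
      using emeasure_span_lborel_cball[OF B, of "1 / (1 - \<delta>)"] \<delta> by simp
    also have "ennreal c * emeasure (span_lborel C) (cball 0 1) = ennreal (c * ?\<kappa>)"
      using emeasure_span_lborel_cball[OF C(1), of 1] c(1) cardC by (simp add: ennreal_mult)
    finally have "c * ?\<kappa> \<le> ?\<kappa> * (1 / (1 - \<delta>)) ^ card B"
      using \<delta> by (subst (asm) ennreal_le_iff) auto
    then show ?thesis using unit_ball_vol_pos[of "real (card B)"] by (simp only: mult.commute[of c] mult_le_cancel_left_pos of_nat_0_le_iff)
  qed
  have "wills B L \<le> (\<integral>\<^sup>+x. ennreal (exp (- pi * (infdist (T x) (T ` L))\<^sup>2)) \<partial>span_lborel B)"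
    unfolding wills_def
  proof (rule nn_integral_mono_AE, use AE_span_lborel[OF B] in eventually_elim)
    case (elim x)
    have "infdist (T x) (T ` L) \<le> infdist x L"
      unfolding infdist_notempty[OF L(2)]
    proof (rule cINF_greatest[OF L(2)])
      fix l assume l: "l \<in> L"
      have "infdist (T x) (T ` L) \<le> dist (T x) (T l)" using l by (intro infdist_le) auto
      also have "\<dots> \<le> dist x l"
        using up[of "x - l"] elim l convex_bodyD(3)[OF L(1)] by (auto simp: dist_norm linear_diff[OF lin] span_diff)
      finally show "infdist (T x) (T ` L) \<le> dist x l" .
    qed
    then have "(infdist (T x) (T ` L))\<^sup>2 \<le> (infdist x L)\<^sup>2" by (intro power_mono infdist_nonneg)
    then show ?case by (intro ennreal_leI) simp
  qed
  also have "\<dots> = (\<integral>\<^sup>+x. ennreal (exp (- pi * (infdist x (T ` L))\<^sup>2)) \<partial>span_lborel (T ` B))"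
    by (rule nn_integral_span_lborel_linear_image[OF fin T injB, symmetric]) measurable
  also have "\<dots> = ennreal c * wills C (T ` L)"
    unfolding wills_def by (rule c(2)) measurable
  also have "wills C (T ` L) = wills D (T ` L)"
    using L by (intro wills_ambient C TL D) auto
  also have "ennreal c * wills D (T ` L) \<le> ennreal ((1 / (1 - \<delta>)) ^ card B) * wills D (T ` L)"
    using cle by (intro mult_right_mono ennreal_leI) auto
  finally show ?thesis .
qed

section \<open>A box in the Hilbert space of square-summable sequences\<close>

lift_definition ell2_unit :: "nat \<Rightarrow> ell2" is "\<lambda>n m. if m = n then 1 else 0"
  by (rule summable_finite[of "{_}"]) auto

lemma ell2_nth_unit: "ell2_nth (ell2_unit n) m = (if m = n then 1 else 0)"
  by transfer simp

lemma ell2_nth_add: "ell2_nth (x + y) n = ell2_nth x n + ell2_nth y n"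
  by transfer simp

lemma ell2_nth_scaleR: "ell2_nth (c *\<^sub>R x) n = c * ell2_nth x n"
  by transfer simp

lemma ell2_nth_zero: "ell2_nth 0 n = 0"
  by transfer simp

lemma ell2_nth_sum: "ell2_nth (sum f A) n = (\<Sum>a\<in>A. ell2_nth (f a) n)"
  by (induction A rule: infinite_finite_induct) (auto simp: ell2_nth_zero ell2_nth_add)

lemma ell2_eqI: "(\<And>n. ell2_nth x n = ell2_nth y n) \<Longrightarrow> x = y"
  by transfer auto

lemma inner_ell2_unit: "inner x (ell2_unit n) = ell2_nth x n"
proof transfer
  fix x :: "nat \<Rightarrow> real" and n
  have "(\<Sum>m. x m * (if m = n then 1 else 0)) = (\<Sum>m\<in>{n}. x m * (if m = n then 1 else 0))"
    by (rule suminf_finite) auto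
  then show "(\<Sum>m. x m * (if m = n then 1 else 0)) = x n" by simp
qed

lemma inj_ell2_unit: "inj ell2_unit"
  by (rule injI) (metis ell2_nth_unit zero_neq_one)

lemma orthonormal_ell2_units: "orthonormal_set (ell2_unit ` {..<N})"
proof -
  have "norm (ell2_unit n) = 1" for n
    by (simp add: norm_eq_1 inner_ell2_unit ell2_nth_unit)
  then show ?thesis
    unfolding orthonormal_set_def pairwise_def orthogonal_def
    by (auto simp: inner_ell2_unit ell2_nth_unit)
qed

definition ell2_trunc :: "nat \<Rightarrow> ell2 \<Rightarrow> ell2" where
  "ell2_trunc N x = (\<Sum>n<N. ell2_nth x n *\<^sub>R ell2_unit n)"

lemma ell2_nth_trunc: "ell2_nth (ell2_trunc N x) n = (if n < N then ell2_nth x n else 0)"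
proof -
  have "ell2_nth (ell2_trunc N x) n = (\<Sum>m<N. if m = n then ell2_nth x n else 0)"
    unfolding ell2_trunc_def ell2_nth_sum by (rule sum.cong) (auto simp: ell2_nth_scaleR ell2_nth_unit)
  then show ?thesis by simp
qed

lemma norm_ell2_le:
  assumes "\<And>n. \<bar>ell2_nth x n\<bar> \<le> \<bar>ell2_nth y n\<bar>"
  shows "norm x \<le> norm y"
proof -
  have "(norm x)\<^sup>2 \<le> (norm y)\<^sup>2"
    unfolding norm_ell2_squared using assms
    by (intro suminf_le summable_ell2) (simp add: abs_le_square_iff)
  then show ?thesis by (rule power2_le_imp_le) simp
qed

lemma linear_ell2_trunc: "linear (ell2_trunc N)"
  by (rule linearI; rule ell2_eqI) (auto simp: ell2_nth_trunc ell2_nth_add ell2_nth_scaleR)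

lemma norm_ell2_trunc_le: "norm (ell2_trunc N x) \<le> norm x"
  by (rule norm_ell2_le) (simp add: ell2_nth_trunc)

lemma bounded_linear_ell2_trunc: "bounded_linear (ell2_trunc N)"
  using linear_ell2_trunc norm_ell2_trunc_le
  by (intro bounded_linear_intro[of _ 1]) (auto simp: linear_add linear_scale)

lemma ell2_trunc_in_span: "ell2_trunc N x \<in> span (ell2_unit ` {..<N})"
  unfolding ell2_trunc_def by (intro span_sum span_scale span_base) auto

lemma norm_diff_ell2_trunc: "(norm (x - ell2_trunc N x))\<^sup>2 = (\<Sum>n. (ell2_nth x (n + N))\<^sup>2)"
proof -
  have "(norm (x - ell2_trunc N x))\<^sup>2 = (\<Sum>n. (ell2_nth (x - ell2_trunc N x) (n + N))\<^sup>2) + (\<Sum>n<N. (ell2_nth (x - ell2_trunc N x) n)\<^sup>2)"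
    unfolding norm_ell2_squared by (rule suminf_split_initial_segment[OF summable_ell2])
  then show ?thesis by (simp add: ell2_nth_diff ell2_nth_trunc)
qed

lemma ell2_trunc_tendsto: "(\<lambda>N. norm (x - ell2_trunc N x)) \<longlonglongrightarrow> 0"
proof -
  have "(\<lambda>N. (norm (x - ell2_trunc N x))\<^sup>2) \<longlonglongrightarrow> 0"
    unfolding norm_diff_ell2_trunc by (rule suminf_exist_split2[OF summable_ell2])
  then have "(\<lambda>N. sqrt ((norm (x - ell2_trunc N x))\<^sup>2)) \<longlonglongrightarrow> sqrt 0" by (intro tendsto_intros)
  then show ?thesis by simp
qed

text \<open>For large N the truncation moves the finitely many basis vectors by less than \<delta>
  in total. By linearity it then moves every x in the span by at most \<delta> times its
  norm.\<close>

lemma ell2_trunc_near_isometry: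
  assumes B: "orthonormal_set B" and \<delta>: "\<delta> > 0"
  shows "\<exists>N. \<forall>x\<in>span B. (1 - \<delta>) * norm x \<le> norm (ell2_trunc N x)"
proof -
  have "(\<lambda>N. \<Sum>b\<in>B. norm (b - ell2_trunc N b)) \<longlonglongrightarrow> (\<Sum>b\<in>B. 0)"
    by (intro tendsto_sum ell2_trunc_tendsto)
  then have "\<forall>\<^sub>F N in sequentially. (\<Sum>b\<in>B. norm (b - ell2_trunc N b)) < \<delta>"
    using \<delta> by (intro order_tendstoD) auto
  then obtain N where N: "(\<Sum>b\<in>B. norm (b - ell2_trunc N b)) < \<delta>"
    by (auto simp: eventually_sequentially)
  have "(1 - \<delta>) * norm x \<le> norm (ell2_trunc N x)" if x: "x \<in> span B" for x
  proof -
    note lin = linear_ell2_trunc[of N]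
    have "x - ell2_trunc N x = (\<Sum>b\<in>B. inner x b *\<^sub>R (b - ell2_trunc N b))"
    proof -
      have xe: "x = (\<Sum>b\<in>B. inner x b *\<^sub>R b)" by (rule orthonormal_expansion[OF B x])
      have "ell2_trunc N x = ell2_trunc N (\<Sum>b\<in>B. inner x b *\<^sub>R b)" using xe by (rule arg_cong)
      also have "\<dots> = (\<Sum>b\<in>B. inner x b *\<^sub>R ell2_trunc N b)"
        by (simp add: linear_sum[OF lin] linear_scale[OF lin])
      finally show ?thesis using xe by (simp add: scaleR_diff_right sum_subtractf)
    qed
    then have "norm (x - ell2_trunc N x) \<le> (\<Sum>b\<in>B. norm (inner x b *\<^sub>R (b - ell2_trunc N b)))"
      by (simp only:) (rule norm_sum)
    also have "\<dots> \<le> (\<Sum>b\<in>B. norm x * norm (b - ell2_trunc N b))"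
    proof (rule sum_mono)
      fix b assume "b \<in> B"
      then have "\<bar>inner x b\<bar> \<le> norm x" using Cauchy_Schwarz_ineq2[of x b] orthonormal_setD(2)[OF B] by simp
      then show "norm (inner x b *\<^sub>R (b - ell2_trunc N b)) \<le> norm x * norm (b - ell2_trunc N b)"
        by (simp add: mult_right_mono)
    qed
    also have "\<dots> = norm x * (\<Sum>b\<in>B. norm (b - ell2_trunc N b))" by (simp add: sum_distrib_left)
    also have "\<dots> \<le> norm x * \<delta>" using N by (intro mult_left_mono) auto
    finally show ?thesis using norm_triangle_ineq2[of x "x - ell2_trunc N x"] by (simp add: algebra_simps)
  qed
  then show ?thesis by blast
qed

section \<open>Boxes and their Wills functionals\<close>

definition ell2_box :: "(nat \<Rightarrow> real) \<Rightarrow> ell2 set" where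
  "ell2_box a = {x. \<forall>n. 0 \<le> ell2_nth x n \<and> ell2_nth x n \<le> a n}"

definition ell2_finite_box :: "(nat \<Rightarrow> real) \<Rightarrow> nat \<Rightarrow> ell2 set" where
  "ell2_finite_box a N = {x. (\<forall>n<N. 0 \<le> ell2_nth x n \<and> ell2_nth x n \<le> a n) \<and> (\<forall>n\<ge>N. ell2_nth x n = 0)}"

lemma ell2_finite_box_0: "ell2_finite_box a 0 = {0}"
  by (auto simp: ell2_finite_box_def ell2_nth_zero intro!: ell2_eqI)

lemma ell2_finite_box_Suc:
  "ell2_finite_box a (Suc N) = {t *\<^sub>R ell2_unit N + z |t z. t \<in> {0..a N} \<and> z \<in> ell2_finite_box a N}"
proof (intro set_eqI iffI)
  fix x assume x: "x \<in> ell2_finite_box a (Suc N)"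
  have "x = ell2_nth x N *\<^sub>R ell2_unit N + ell2_trunc N x"
    using x by (intro ell2_eqI) (auto simp: ell2_finite_box_def ell2_nth_add ell2_nth_scaleR ell2_nth_unit ell2_nth_trunc not_less_eq_eq[symmetric] dest: le_neq_implies_less)
  moreover have "ell2_trunc N x \<in> ell2_finite_box a N" using x by (auto simp: ell2_finite_box_def ell2_nth_trunc)
  moreover have "ell2_nth x N \<in> {0..a N}" using x by (auto simp: ell2_finite_box_def)
  ultimately show "x \<in> {t *\<^sub>R ell2_unit N + z |t z. t \<in> {0..a N} \<and> z \<in> ell2_finite_box a N}" by blast
next
  fix x assume "x \<in> {t *\<^sub>R ell2_unit N + z |t z. t \<in> {0..a N} \<and> z \<in> ell2_finite_box a N}"
  then show "x \<in> ell2_finite_box a (Suc N)"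
    by (auto simp: ell2_finite_box_def ell2_nth_add ell2_nth_scaleR ell2_nth_unit less_Suc_eq)
qed

lemma ell2_units_Suc: "ell2_unit ` {..<Suc N} = insert (ell2_unit N) (ell2_unit ` {..<N})"
  by (simp add: lessThan_Suc)

lemma convex_body_ell2_finite_box:
  assumes a: "\<And>n. a n \<ge> 0"
  shows "convex_body (ell2_unit ` {..<N}) (ell2_finite_box a N) \<and> ell2_finite_box a N \<noteq> {}"
proof (induction N)
  case 0
  then show ?case by (simp add: ell2_finite_box_0 convex_body_def)
next
  case (Suc N)
  let ?E = "ell2_unit ` {..<Suc N}"
  have eq: "ell2_finite_box a (Suc N) = minkowski_sum (ell2_finite_box a N) 1 ((\<lambda>s. s *\<^sub>R (a N *\<^sub>R ell2_unit N)) ` {0..1})"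
  proof (intro set_eqI iffI)
    fix x assume "x \<in> ell2_finite_box a (Suc N)"
    then obtain t z where x: "x = t *\<^sub>R ell2_unit N + z" "0 \<le> t" "t \<le> a N" "z \<in> ell2_finite_box a N"
      unfolding ell2_finite_box_Suc by auto
    have "t *\<^sub>R ell2_unit N \<in> (\<lambda>s. s *\<^sub>R (a N *\<^sub>R ell2_unit N)) ` {0..1}"
    proof (cases "a N = 0")
      case True
      then show ?thesis using x by (auto intro!: image_eqI[of _ _ 0])
    next
      case False
      then show ?thesis using x a[of N] by (intro image_eqI[of _ _ "t / a N"]) (auto simp: field_simps)
    qed
    then show "x \<in> minkowski_sum (ell2_finite_box a N) 1 ((\<lambda>s. s *\<^sub>R (a N *\<^sub>R ell2_unit N)) ` {0..1})"
      unfolding minkowski_sum_def using x by (force simp: add.commute)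
  next
    fix x assume "x \<in> minkowski_sum (ell2_finite_box a N) 1 ((\<lambda>s. s *\<^sub>R (a N *\<^sub>R ell2_unit N)) ` {0..1})"
    then obtain z s where x: "x = z + (s * a N) *\<^sub>R ell2_unit N" "z \<in> ell2_finite_box a N" "0 \<le> s" "s \<le> 1"
      unfolding minkowski_sum_def by auto
    have "s * a N \<in> {0..a N}" using x a[of N] by (auto simp: mult_left_le_one_le)
    then show "x \<in> ell2_finite_box a (Suc N)"
      unfolding ell2_finite_box_Suc using x by (force simp: add.commute)
  qed
  have "convex_body ?E (ell2_finite_box a N)"
    using Suc span_mono[OF image_mono[of "{..<N}" "{..<Suc N}" ell2_unit]] unfolding convex_body_def by fastforce
  then have "convex_body ?E (ell2_finite_box a (Suc N))"
    unfolding eq by (intro convex_body_minkowski_sum convex_body_segment span_scale span_base) auto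
  moreover have "ell2_finite_box a (Suc N) \<noteq> {}" unfolding eq minkowski_sum_image using Suc by simp
  ultimately show ?case by blast
qed

lemma wills_ell2_finite_box:
  assumes a: "\<And>n. a n \<ge> 0"
  shows "wills (ell2_unit ` {..<N}) (ell2_finite_box a N) = ennreal (\<Prod>n<N. 1 + a n)"
proof (induction N)
  case 0
  then show ?case using wills_origin[of "{}"] by (simp add: ell2_finite_box_0)
next
  case (Suc N)
  have "wills (ell2_unit ` {..<Suc N}) (ell2_finite_box a (Suc N)) = ennreal (1 + a N) * wills (ell2_unit ` {..<N}) (ell2_finite_box a N)"
    unfolding ell2_units_Suc ell2_finite_box_Suc
  proof (rule wills_orthogonal_sum)
    show "orthonormal_set (insert (ell2_unit N) (ell2_unit ` {..<N}))"
      using orthonormal_ell2_units[of "Suc N"] unfolding ell2_units_Suc .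
    show "ell2_unit N \<notin> ell2_unit ` {..<N}" using inj_ell2_unit by (auto simp: inj_eq)
  qed (use convex_body_ell2_finite_box[OF a] a in auto)
  also have "\<dots> = ennreal ((1 + a N) * (\<Prod>n<N. 1 + a n))"
    unfolding Suc using a by (subst ennreal_mult) (auto intro!: prod_nonneg add_nonneg_nonneg)
  finally show ?case by (simp add: mult.commute)
qed

lemma ell2_finite_box_subset: "(\<And>n. a n \<ge> 0) \<Longrightarrow> ell2_finite_box a N \<subseteq> ell2_box a"
  by (auto simp: ell2_finite_box_def ell2_box_def) (metis le_less_linear order_refl)+

lemma ell2_trunc_box: "x \<in> ell2_box a \<Longrightarrow> ell2_trunc N x \<in> ell2_finite_box a N"
  by (auto simp: ell2_finite_box_def ell2_box_def ell2_nth_trunc)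

lemma convex_ell2_box: "convex (ell2_box a)"
proof (rule convexI)
  fix x y :: ell2 and u v :: real
  assume *: "x \<in> ell2_box a" "y \<in> ell2_box a" "0 \<le> u" "0 \<le> v" "u + v = 1"
  have "0 \<le> u * ell2_nth x n + v * ell2_nth y n \<and> u * ell2_nth x n + v * ell2_nth y n \<le> a n" for n
  proof -
    have "u * ell2_nth x n + v * ell2_nth y n \<le> u * a n + v * a n"
      using * by (intro add_mono mult_left_mono) (auto simp: ell2_box_def)
    also have "\<dots> = a n" using *(5) by (simp add: distrib_right[symmetric])
    finally show ?thesis using * by (auto simp: ell2_box_def)
  qed
  then show "u *\<^sub>R x + v *\<^sub>R y \<in> ell2_box a" by (simp add: ell2_box_def ell2_nth_add ell2_nth_scaleR)
qed

text \<open>The box is closed as an intersection of slabs. It is totally bounded because its points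
  have uniformly small tails, while the truncated points fill a compact finite box.\<close>

lemma compact_ell2_box:
  assumes a: "\<And>n. a n \<ge> 0" "summable a"
  shows "compact (ell2_box a)"
  unfolding compact_eq_totally_bounded complete_eq_closed
proof (intro conjI allI impI)
  have "ell2_box a = (\<Inter>n. {x. inner x (ell2_unit n) \<in> {0..a n}})" by (auto simp: ell2_box_def inner_ell2_unit)
  moreover have "closed \<dots>"
  proof (intro closed_INT ballI)
    fix n
    have "{x. inner x (ell2_unit n) \<in> {0..a n}} = (\<lambda>x. inner x (ell2_unit n)) -` {0..a n}" by auto
    then show "closed {x. inner x (ell2_unit n) \<in> {0..a n}}"
      by (simp only:) (intro continuous_closed_vimage closed_atLeastAtMost, auto intro!: continuous_intros)
  qed
  ultimately show "closed (ell2_box a)" by simp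
  fix e :: real assume e: "e > 0"
  \<comment> \<open>Tails are measured by squares; from some index on a n < 1, hence its square is
    at most a n.\<close>
  have sq: "summable (\<lambda>n. (a n)\<^sup>2)"
  proof (rule summable_comparison_test_ev[OF _ a(2)])
    have "a \<longlonglongrightarrow> 0" by (rule summable_LIMSEQ_zero[OF a(2)])
    then have "\<forall>\<^sub>F n in sequentially. a n < 1" by (rule order_tendstoD) simp
    then show "\<forall>\<^sub>F n in sequentially. norm ((a n)\<^sup>2) \<le> a n"
    proof eventually_elim
      case (elim n)
      then show ?case using a(1)[of n] mult_left_le[of "a n" "a n"] by (simp add: power2_eq_square)
    qed
  qed
  have "(e / 2)\<^sup>2 > 0" using e by simp
  then obtain N where N: "norm (\<Sum>n. (a (n + N))\<^sup>2) < (e / 2)\<^sup>2"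
    using suminf_exist_split[OF _ sq] by blast
  have tail: "norm (x - ell2_trunc N x) < e / 2" if x: "x \<in> ell2_box a" for x
  proof -
    have "(norm (x - ell2_trunc N x))\<^sup>2 \<le> (\<Sum>n. (a (n + N))\<^sup>2)"
      unfolding norm_diff_ell2_trunc
    proof (rule suminf_le)
      show "(ell2_nth x (n + N))\<^sup>2 \<le> (a (n + N))\<^sup>2" for n
        using x by (intro power_mono) (auto simp: ell2_box_def)
      show "summable (\<lambda>n. (ell2_nth x (n + N))\<^sup>2)" by (rule summable_ignore_initial_segment[OF summable_ell2])
      show "summable (\<lambda>n. (a (n + N))\<^sup>2)" by (rule summable_ignore_initial_segment[OF sq])
    qed
    also have "\<dots> < (e / 2)\<^sup>2" using N by simp
    finally show ?thesis by (rule power2_less_imp_less) (use e in simp)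
  qed
  have "compact (ell2_finite_box a N)"
    using convex_body_ell2_finite_box[OF a(1)] by (simp add: convex_body_def)
  then obtain k where k: "finite k" "ell2_finite_box a N \<subseteq> (\<Union>x\<in>k. ball x (e / 2))"
    unfolding compact_eq_totally_bounded using e by (metis half_gt_zero)
  have "ell2_box a \<subseteq> (\<Union>x\<in>k. ball x e)"
  proof
    fix x assume x: "x \<in> ell2_box a"
    then obtain c where c: "c \<in> k" "dist c (ell2_trunc N x) < e / 2"
      using k(2) ell2_trunc_box[OF x, of N] by (auto simp: subset_iff)
    have "dist c x \<le> dist c (ell2_trunc N x) + dist (ell2_trunc N x) x" by (rule dist_triangle)
    then have "dist c x < e" using c(2) tail[OF x] by (simp add: dist_norm norm_minus_commute)
    then show "x \<in> (\<Union>x\<in>k. ball x e)" using c(1) by auto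
  qed
  then show "\<exists>k. finite k \<and> ell2_box a \<subseteq> (\<Union>x\<in>k. ball x e)" using k(1) by blast
qed

lemma scaled_ell2_box: "w > 0 \<Longrightarrow> x \<in> ell2_box a \<Longrightarrow> w *\<^sub>R x \<in> ell2_box (\<lambda>n. w * a n)"
  by (auto simp: ell2_box_def ell2_nth_scaleR)

lemma scaled_ell2_finite_box: "w > 0 \<Longrightarrow> (*\<^sub>R) w ` ell2_finite_box a N = ell2_finite_box (\<lambda>n. w * a n) N"
proof (intro set_eqI iffI)
  fix x assume w: "w > 0" and x: "x \<in> ell2_finite_box (\<lambda>n. w * a n) N"
  have "(1 / w) *\<^sub>R x \<in> ell2_finite_box a N"
    using x w by (auto simp: ell2_finite_box_def ell2_nth_scaleR field_simps)
  then show "x \<in> (*\<^sub>R) w ` ell2_finite_box a N" using w by (intro image_eqI[of _ _ "(1 / w) *\<^sub>R x"]) auto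
qed (auto simp: ell2_finite_box_def ell2_nth_scaleR)

text \<open>A finite-dimensional subset of the box need not lie in any coordinate subspace.
  Truncation at a large N sends it into a finite box and is nearly isometric on its span; the loss
  in the functional is a factor that tends to 1 as \<delta> tends to 0.\<close>

lemma wills_subset_ell2_box:
  assumes a: "\<And>n. a n \<ge> 0" and G: "\<And>N. (\<Prod>n<N. 1 + a n) \<le> G"
    and B: "orthonormal_set B" and L: "convex_body B L" "L \<noteq> {}" "L \<subseteq> ell2_box a"
  shows "wills B L \<le> ennreal G"
proof -
  have G0: "G \<ge> 0" using G[of 0] by simp
  have bd: "wills B L \<le> ennreal ((1 / (1 - \<delta>)) ^ card B * G)" if \<delta>: "0 < \<delta>" "\<delta> < 1" for \<delta>
  proof -
    obtain N where N: "\<And>x. x \<in> span B \<Longrightarrow> (1 - \<delta>) * norm x \<le> norm (ell2_trunc N x)"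
      using ell2_trunc_near_isometry[OF B \<delta>(1)] by blast
    let ?E = "ell2_unit ` {..<N}" and ?T = "ell2_trunc N"
    have TL: "convex_body ?E (?T ` L)"
      using convex_bodyD[OF L(1)] ell2_trunc_in_span unfolding convex_body_def
      by (auto intro!: compact_continuous_image convex_linear_image linear_ell2_trunc linear_continuous_on bounded_linear_ell2_trunc)
    have "wills B L \<le> ennreal ((1 / (1 - \<delta>)) ^ card B) * wills ?E (?T ` L)"
      by (rule wills_near_isometry[OF B L(1,2) bounded_linear_ell2_trunc norm_ell2_trunc_le N \<delta>(2) orthonormal_ell2_units TL])
    also have "wills ?E (?T ` L) \<le> wills ?E (ell2_finite_box a N)"
      using L ell2_trunc_box by (intro wills_mono) auto
    also have "\<dots> = ennreal (\<Prod>n<N. 1 + a n)" by (rule wills_ell2_finite_box[OF a])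
    also have "\<dots> \<le> ennreal G" by (intro ennreal_leI G)
    finally show ?thesis using G0 \<delta> by (simp add: ennreal_mult mult_left_mono)
  qed
  have "((\<lambda>\<delta>. ennreal ((1 / (1 - \<delta>)) ^ card B * G)) \<longlongrightarrow> ennreal ((1 / (1 - 0)) ^ card B * G)) (at_right (0::real))"
    by (intro tendsto_intros) auto
  moreover have "\<forall>\<^sub>F \<delta> in at_right (0::real). wills B L \<le> ennreal ((1 / (1 - \<delta>)) ^ card B * G)"
    using eventually_at_right_less[of "0::real"] eventually_at_right_field[of "\<lambda>x. x < 1" "0::real"]
    by (auto simp: eventually_at_right_field intro!: exI[of _ 1] bd)
  ultimately have "wills B L \<le> ennreal ((1 / (1 - 0)) ^ card B * G)"
    by (rule tendsto_lowerbound) simp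
  then show ?thesis by simp
qed

text \<open>The functional of w L is a polynomial in w with non-negative coefficients, so the
  product bound controls each coefficient, uniformly in L.\<close>

lemma intrinsic_volume_ell2_box_le:
  assumes a: "\<And>n. a n \<ge> 0" and w: "w > 0" and G: "\<And>N. (\<Prod>n<N. 1 + w * a n) \<le> G"
  shows "intrinsic_volume k (ell2_box a) \<le> ennreal (G / w ^ k)"
  unfolding intrinsic_volume_def
proof (rule SUP_least)
  fix L assume "L \<in> {L. L \<noteq> {} \<and> compact L \<and> convex L \<and> finite_dimensional L \<and> L \<subseteq> ell2_box a}"
  then have L: "L \<noteq> {}" "compact L" "convex L" "finite_dimensional L" "L \<subseteq> ell2_box a" by auto
  obtain B where B: "orthonormal_set B" "convex_body B L" using finite_dimensional_body[OF L(2-4)] by blast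
  have G0: "G \<ge> 0" using G[of 0] by simp
  have "wills B ((*\<^sub>R) w ` L) \<le> ennreal G"
    using L(1,5) a w by (intro wills_subset_ell2_box[OF _ G B(1) convex_body_scale[OF B(2)]]) (auto intro: scaled_ell2_box)
  then have "(\<Sum>k\<le>card B. fin_intrinsic_volume k L * w ^ k) \<le> G"
    using G0 unfolding wills_scale[OF B L(1) w] by (simp add: ennreal_le_iff)
  then have "fin_intrinsic_volume k L * w ^ k \<le> G"
    using intrinsic_volume_term_le_sum[OF B L(1) less_imp_le[OF w], of k] by linarith
  then show "ennreal (fin_intrinsic_volume k L) \<le> ennreal (G / w ^ k)"
    using w by (intro ennreal_leI) (simp add: field_simps)
qed

lemma GB_set_ell2_box:
  assumes a: "\<And>n. a n \<ge> 0" "summable a"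
  shows "GB_set (ell2_box a)"
proof -
  have "(\<Prod>n<N. 1 + 1 * a n) \<le> exp (suminf a)" for N
  proof -
    have "(\<Prod>n<N. 1 + 1 * a n) \<le> (\<Prod>n<N. exp (a n))"
      using a(1) by (intro prod_mono) (auto intro: add_nonneg_nonneg)
    also have "\<dots> = exp (\<Sum>n<N. a n)" by (simp add: exp_sum)
    also have "\<dots> \<le> exp (suminf a)" using a by (simp add: sum_le_suminf)
    finally show ?thesis .
  qed
  then have "intrinsic_volume 1 (ell2_box a) \<le> ennreal (exp (suminf a) / 1 ^ 1)"
    by (intro intrinsic_volume_ell2_box_le a) auto
  also have "\<dots> < \<infinity>" by simp
  finally have "intrinsic_volume 1 (ell2_box a) < \<infinity>" .
  moreover have "0 \<in> ell2_box a" using a by (simp add: ell2_box_def ell2_nth_zero)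
  ultimately show ?thesis
    unfolding GB_set_def using compact_ell2_box[OF a] convex_ell2_box by auto
qed

text \<open>The finite boxes are admissible in the supremum that defines the intrinsic volumes, and
  the product is exactly their polynomial of intrinsic volumes at r.\<close>

lemma steiner_ell2_box_ge:
  assumes a: "\<And>n. a n \<ge> 0" "summable a" and r: "r > 0"
  shows "(\<Prod>n<N. 1 + r * a n) \<le> (\<Sum>k. GB_volume (ell2_box a) k * r ^ k)"
proof -
  let ?E = "ell2_unit ` {..<N}" and ?K = "ell2_box a" and ?L = "ell2_finite_box a N"
  have K: "GB_set ?K" by (rule GB_set_ell2_box[OF a])
  have L: "convex_body ?E ?L" "?L \<noteq> {}" using convex_body_ell2_finite_box[OF a(1)] by auto
  have le: "fin_intrinsic_volume k ?L \<le> GB_volume ?K k" for k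
  proof -
    have "ennreal (fin_intrinsic_volume k ?L) \<le> intrinsic_volume k ?K"
      using L ell2_finite_box_subset[OF a(1)]
      by (intro fin_intrinsic_volume_le_intrinsic_volume)
         (auto simp: convex_body_def finite_dimensional_def intro!: exI[of _ ?E])
    also have "\<dots> = ennreal (GB_volume ?K k)" by (rule intrinsic_volume_eq_GB_volume[OF K])
    finally show ?thesis by (simp add: ennreal_le_iff)
  qed
  have "ennreal (\<Prod>n<N. 1 + r * a n) = wills ?E ((*\<^sub>R) r ` ?L)"
    unfolding scaled_ell2_finite_box[OF r] using a(1) r by (subst wills_ell2_finite_box) auto
  also have "\<dots> = ennreal (\<Sum>k\<le>card ?E. fin_intrinsic_volume k ?L * r ^ k)"
    by (rule wills_scale[OF orthonormal_ell2_units L r])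
  finally have "(\<Prod>n<N. 1 + r * a n) = (\<Sum>k\<le>card ?E. fin_intrinsic_volume k ?L * r ^ k)"
    using a(1) r fin_intrinsic_volume_nonneg[OF orthonormal_ell2_units L]
    by (subst (asm) ennreal_inj) (auto intro!: prod_nonneg sum_nonneg add_nonneg_nonneg)
  also have "\<dots> \<le> (\<Sum>k\<le>card ?E. GB_volume ?K k * r ^ k)"
    using le r by (intro sum_mono mult_right_mono) auto
  also have "\<dots> \<le> (\<Sum>k. GB_volume ?K k * r ^ k)"
    using r by (intro sum_le_suminf summable_GB_volume[OF K]) auto
  finally show ?thesis .
qed

text \<open>Each coefficient is bounded by means of the product at 2 r; evaluated at r, the terms
  then form a geometric series of ratio 1/2.\<close>

lemma steiner_ell2_box_le:
  assumes a: "\<And>n. a n \<ge> 0" "summable a" and r: "r > 0" and G: "\<And>N. (\<Prod>n<N. 1 + (2 * r) * a n) \<le> G"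
  shows "(\<Sum>k. GB_volume (ell2_box a) k * r ^ k) \<le> 2 * G"
proof -
  have G0: "G \<ge> 0" using G[of 0] by simp
  have "(\<Sum>k. GB_volume (ell2_box a) k * r ^ k) \<le> (\<Sum>k. G * (1 / 2) ^ k)"
  proof (rule suminf_le)
    show "summable (\<lambda>k. GB_volume (ell2_box a) k * r ^ k)" using r by (intro summable_GB_volume GB_set_ell2_box a) auto
    show "summable (\<lambda>k. G * (1 / 2) ^ k)" by (intro summable_mult summable_geometric) simp
    fix k
    have "GB_volume (ell2_box a) k \<le> G / (2 * r) ^ k"
      using intrinsic_volume_ell2_box_le[OF a(1) _ G, of k] r G0 by (intro enn2real_leI) auto
    then have "GB_volume (ell2_box a) k * r ^ k \<le> G / (2 * r) ^ k * r ^ k" using r by (intro mult_right_mono) auto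
    also have "\<dots> = G * (1 / 2) ^ k" using r by (simp add: power_mult_distrib power_one_over field_simps)
    finally show "GB_volume (ell2_box a) k * r ^ k \<le> G * (1 / 2) ^ k" .
  qed
  also have "\<dots> = 2 * G" by (subst suminf_mult) (auto simp: suminf_geometric summable_geometric)
  finally show ?thesis .
qed

text \<open>Subadditivity, (1 + x)^p \<le> 1 + x^p, followed by 1 + t \<le> exp t. A product over
  the sides is thereby controlled by the sum of their p-th powers.\<close>

lemma one_add_le_exp_powr:
  fixes x p :: real
  assumes x: "x \<ge> 0" and p: "0 < p" "p \<le> 1"
  shows "1 + x \<le> exp (x powr p / p)"
proof -
  have "(1 + x) powr p = (1 + x) powr (p - 1) + x * (1 + x) powr (p - 1)"
  proof -
    have "(1 + x) powr p = (1 + x) powr (p - 1) * (1 + x) powr 1" unfolding powr_add[symmetric] by simp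
    then show ?thesis using x by (simp add: algebra_simps)
  qed
  \<comment> \<open>Since p - 1 \<le> 0, the power grows when its base 1 + x is lowered to 1 in the
    first summand and to x in the second.\<close>
  also have "\<dots> \<le> 1 + x powr p"
  proof (cases "x = 0")
    case False
    then have "x > 0" using x by simp
    have "(1 + x) powr (p - 1) \<le> 1 powr (p - 1)" using x p by (intro powr_mono2') auto
    moreover have "x * (1 + x) powr (p - 1) \<le> x * x powr (p - 1)"
      using \<open>x > 0\<close> p by (intro mult_left_mono powr_mono2') auto
    moreover have "x * x powr (p - 1) = x powr p" using \<open>x > 0\<close> by (simp add: powr_diff)
    ultimately show ?thesis by simp
  qed (use p in simp)
  also have "\<dots> \<le> exp (x powr p)" by (rule exp_ge_add_one_self)
  finally have "((1 + x) powr p) powr (1 / p) \<le> exp (x powr p) powr (1 / p)" using p by (intro powr_mono2) auto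
  then show ?thesis using p x by (simp add: powr_powr powr_def)
qed

section \<open>The order of the box with sides \<open>n^(-5/4)\<close>\<close>

definition box_sides :: "nat \<Rightarrow> real" where
  "box_sides n = real (Suc n) powr (- 5 / 4)"

lemma box_sides_nonneg: "box_sides n \<ge> 0"
  by (simp add: box_sides_def)

lemma summable_Suc_powr: "s < -1 \<Longrightarrow> summable (\<lambda>n. real (Suc n) powr s)"
  by (subst summable_Suc_iff) (simp add: summable_real_powr_iff)

lemma summable_box_sides: "summable box_sides"
  unfolding box_sides_def by (rule summable_Suc_powr) simp

text \<open>For p = 9/10 the p-th powers of the sides have exponent -9/8 and are summable. Any p
  strictly between 4/5 and 1 would give a bound below 1 in the same way.\<close>

lemma box_order_le: "GB_order (ell2_box box_sides) \<le> ereal (9 / 10)"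
proof -
  define S where "S = (\<Sum>n. real (Suc n) powr (- 9 / 8))"
  have S: "summable (\<lambda>n. real (Suc n) powr (- 9 / 8))" by (rule summable_Suc_powr) simp
  define A where "A = 10 / 9 * S"
  have prod: "(\<Prod>n<N. 1 + w * box_sides n) \<le> exp (A * w powr (9 / 10))" if w: "w > 0" for w N
  proof -
    have "(\<Prod>n<N. 1 + w * box_sides n) \<le> (\<Prod>n<N. exp ((w * box_sides n) powr (9 / 10) / (9 / 10)))"
      using w box_sides_nonneg by (intro prod_mono conjI one_add_le_exp_powr add_nonneg_nonneg) auto
    also have "\<dots> = exp (\<Sum>n<N. (w * box_sides n) powr (9 / 10) / (9 / 10))" by (simp add: exp_sum)
    also have "(\<Sum>n<N. (w * box_sides n) powr (9 / 10) / (9 / 10)) = 10 / 9 * w powr (9 / 10) * (\<Sum>n<N. real (Suc n) powr (- 9 / 8))"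
      unfolding sum_distrib_left
      by (intro sum.cong) (use w in \<open>auto simp: box_sides_def powr_mult powr_powr\<close>)
    also have "\<dots> \<le> 10 / 9 * w powr (9 / 10) * S"
      unfolding S_def by (intro mult_left_mono sum_le_suminf S) auto
    finally show ?thesis by (simp add: A_def mult_ac)
  qed
  show ?thesis
  proof (rule GB_order_le[OF GB_set_ell2_box[OF box_sides_nonneg summable_box_sides]])
    fix r :: real assume r: "r \<ge> 1"
    have "(\<Sum>k. GB_volume (ell2_box box_sides) k * r ^ k) \<le> 2 * exp (A * (2 * r) powr (9 / 10))"
      using r prod[of "2 * r"] by (intro steiner_ell2_box_le box_sides_nonneg summable_box_sides) auto
    also have "A * (2 * r) powr (9 / 10) = (A * 2 powr (9 / 10)) * r powr (9 / 10)"
      using r by (simp add: powr_mult)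
    finally show "(\<Sum>k. GB_volume (ell2_box box_sides) k * r ^ k) \<le> 2 * exp ((A * 2 powr (9 / 10)) * r powr (9 / 10))" .
  qed simp
qed

text \<open>At r = m^(5/4) the first m factors are at least 2, so the Steiner function is at least
  2^m, where m = r^(4/5). A smaller order would bound it by D exp (m^\<nu>) with \<nu> < 1.\<close>

lemma box_order_ge: "GB_order (ell2_box box_sides) \<ge> ereal (4 / 5)"
proof (rule ccontr)
  let ?K = "ell2_box box_sides"
  have K: "GB_set ?K" by (rule GB_set_ell2_box[OF box_sides_nonneg summable_box_sides])
  assume "\<not> GB_order ?K \<ge> ereal (4 / 5)"
  then have "GB_order ?K < ereal (4 / 5)" by simp
  from GB_order_less_imp[OF K this, of 0]
  obtain \<mu> D where \<mu>: "0 \<le> \<mu>" "\<mu> < 4 / 5" "D > 0"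
    and ev: "\<forall>\<^sub>F r in at_top. (\<Sum>k. GB_volume ?K k * r ^ k) \<le> D * exp (r powr \<mu>)" by auto
  define \<nu> where "\<nu> = 5 / 4 * \<mu>"
  have \<nu>: "\<nu> < 1" using \<mu> by (simp add: \<nu>_def)
  have "filterlim (\<lambda>m. real m powr (5 / 4)) at_top sequentially"
    by (rule filterlim_compose[OF real_powr_at_top filterlim_real_sequentially]) simp
  with ev have ev1: "\<forall>\<^sub>F m in sequentially. (\<Sum>k. GB_volume ?K k * (real m powr (5 / 4)) ^ k) \<le> D * exp ((real m powr (5 / 4)) powr \<mu>)"
    by (rule eventually_compose_filterlim)
  \<comment> \<open>The constant 2 / ln 2 makes m^\<nu> at most (ln 2 / 2) m, half the exponent of
    2^m; after cancellation exp ((ln 2 / 2) m) \<le> D remains.\<close>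
  have ev2: "\<forall>\<^sub>F m in sequentially. 2 / ln 2 * real m powr \<nu> \<le> real m powr 1"
    by (rule eventually_compose_filterlim[OF powr_eventually_le_powr[OF \<nu>] filterlim_real_sequentially])
  have "\<forall>\<^sub>F m in sequentially. exp (ln 2 / 2 * real m) \<le> D"
    using ev1 ev2 eventually_ge_at_top[of 1]
  proof eventually_elim
    case (elim m)
    let ?r = "real m powr (5 / 4)"
    have r: "?r > 0" using elim by simp
    have "(2::real) ^ m = (\<Prod>n<m. 2)" by simp
    also have "\<dots> \<le> (\<Prod>n<m. 1 + ?r * box_sides n)"
    proof (intro prod_mono conjI)
      fix n assume n: "n \<in> {..<m}"
      have "real (Suc n) powr (5 / 4) \<le> ?r" using n by (intro powr_mono2) auto
      then have "real (Suc n) powr (5 / 4) * box_sides n \<le> ?r * box_sides n"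
        by (intro mult_right_mono box_sides_nonneg)
      moreover have "real (Suc n) powr (5 / 4) * box_sides n = 1"
        unfolding box_sides_def powr_add[symmetric] by simp
      ultimately show "2 \<le> 1 + ?r * box_sides n" by linarith
    qed simp
    also have "\<dots> \<le> (\<Sum>k. GB_volume ?K k * ?r ^ k)"
      by (rule steiner_ell2_box_ge[OF box_sides_nonneg summable_box_sides r])
    also have "\<dots> \<le> D * exp (?r powr \<mu>)" using elim by simp
    also have "?r powr \<mu> = real m powr \<nu>" by (simp add: powr_powr \<nu>_def)
    also have "D * exp (real m powr \<nu>) \<le> D * exp (ln 2 / 2 * real m)"
    proof -
      have "ln 2 / 2 * (2 / ln 2 * real m powr \<nu>) \<le> ln 2 / 2 * real m"
        using elim by (intro mult_left_mono) auto
      then show ?thesis using \<mu>(3) by (intro mult_left_mono) auto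
    qed
    also have "(2::real) ^ m = exp (ln 2 / 2 * real m) * exp (ln 2 / 2 * real m)"
      by (simp add: exp_add[symmetric] exp_of_nat_mult)
    finally show ?case by simp
  qed
  moreover have "filterlim (\<lambda>m. exp (ln 2 / 2 * real m)) at_top sequentially"
    by (intro filterlim_compose[OF exp_at_top] filterlim_tendsto_pos_mult_at_top[OF tendsto_const _ filterlim_real_sequentially]) simp
  then have "\<forall>\<^sub>F m in sequentially. D < exp (ln 2 / 2 * real m)" by (simp add: filterlim_at_top_dense)
  ultimately have "\<forall>\<^sub>F m in sequentially. False" by eventually_elim simp
  then show False by simp
qed

text \<open>In the third conjunct the failure of the rate k^(-1/2) is unconditional, but the negated
  alternative carries a condition: a set whose ratios have a positive limit satisfies the
  alternative through its first half, whatever its order. The box meets the condition because its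
  order is below 1. The class \<open>polish_space\<close> expresses completeness and separability of
  the Hilbert space.\<close>

theorem mainTheorem4:
  shows "(\<forall>(\<epsilon>::real) (K::'a::{real_inner, polish_space} set).
            \<epsilon> > 0 \<and> GB_set K \<and> GB_order K > ereal (2/3) \<longrightarrow>
              GB_ratio K \<notin> O(\<lambda>k. real k powr (1 - 1 / real_of_ereal (GB_order K) - \<epsilon>)))
       \<and> (\<exists>K::ell2 set. GB_set K \<and> GB_order K > ereal (2/3))
       \<and> (\<forall>K::'a set. GB_set K \<and> GB_order K > ereal (2/3) \<longrightarrow>
              GB_ratio K \<notin> O(\<lambda>k. real k powr (- 1 / 2)) \<and>
              (GB_ratio K \<longlonglongrightarrow> 0 \<or> GB_order K < 1 \<longrightarrow> \<not> gao_vitale_alternative K))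
       \<and> (\<exists>K::ell2 set. GB_set K \<and> GB_order K > ereal (2/3) \<and> \<not> gao_vitale_alternative K)"
proof -
  let ?K = "ell2_box box_sides"
  have K: "GB_set ?K" by (rule GB_set_ell2_box[OF box_sides_nonneg summable_box_sides])
  have gt: "GB_order ?K > ereal (2/3)" by (rule less_le_trans[OF _ box_order_ge]) simp
  have lt: "GB_order ?K < 1" by (rule le_less_trans[OF box_order_le]) (simp add: one_ereal_def)
  have "\<not> gao_vitale_alternative ?K" using not_gao_vitale_alternative[OF K gt] lt by blast
  then show ?thesis
    using K gt GB_ratio_not_bigo GB_ratio_not_bigo_half not_gao_vitale_alternative by blast
qed

end
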